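(* There exists an absolute constant $c>0$ such that the following holds. Let $p>0$ and let $f:\mathbb{C}\to\mathbb{C}$ be a mapping of finite distortion with distortion function $K_f$ such that $e^{pK_f(z)}\in L^1_{\mathrm{loc}}(\mathbb{C})$, normalized by $f(0)=0$ and $f(1)=1$. Then there exists a constant $\epsilon_f>0$ such that $$|\arg(f(z))|\le \frac{c}{p}\log^2\left(\frac{1}{|z|}\right)\qquad\text{for all } z\in\mathbb{C} \text{ with } 0<|z|<\epsilon_f,$$ where $\arg$ is the principal branch of the argument. The constant $c$ depends neither on $p$ nor on $f$.
   Context: Mapping of finite distortion: for a domain $\Omega\subset\mathbb{C}$, a sense preserving homeomorphism $f:\Omega\to\mathbb{C}$ (for $\Omega=\mathbb{C}$: a sense preserving homeomorphism of $\mathbb{C}$ onto $\mathbb{C}$) has finite distortion if $f\in W^{1,1}_{\mathrm{loc}}(\Omega)$, its Jacobian satisfies $J_f\in L^1_{\mathrm{loc}}(\Omega)$, and $|Df(z)|^2\le J_f(z)K(z)$ for almost every $z\in\Omega$, for some measurable function $K\ge 1$ that is finite almost everywhere. Here $Df(z)$ is the differential matrix and $|Df(z)|=\max\{|Df(z)e|: e\in\mathbb{C}, |e|=1\}$. The smallest such function $K$ is denoted $K_f$ and called the distortion function of $f$. Branch of the argument: $\arg(f(z))$ is not the principal value in $(-\pi,\pi]$ of the complex number $f(z)$; it measures the winding of the image under $f$ around the origin. Let $A:(0,\infty)\times\mathbb{R}\to\mathbb{R}$ be the unique continuous function with $f(re^{i\theta})=|f(re^{i\theta})|e^{iA(r,\theta)}$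 for all $r>0$, $\theta\in\mathbb{R}$ and $A(1,0)=0$ (recall $f(1)=1$). Then for $z=re^{i\theta}\neq 0$ with $\theta\in(-\pi,\pi]$, the principal branch is $\arg(f(z))=A(r,\theta)$. In particular $\arg(f(z))-\arg(f(z/|z|))$ is the total change of argument of $f$ along the radial segment from $z/|z|$ to $z$. Notation: $\log^2(x)=(\log x)^2$. *)

theory Defs
  imports "HOL-Complex_Analysis.Complex_Analysis"
begin

definition locally_integrable :: "complex set \<Rightarrow> (complex \<Rightarrow> 'b::euclidean_space) \<Rightarrow> bool" where
  "locally_integrable \<Omega> g \<longleftrightarrow> (\<forall>C. compact C \<and> C \<subseteq> \<Omega> \<longrightarrow> g absolutely_integrable_on C)"


section \<open>Weak derivatives\<close>

primrec k_times_cont_diff :: "nat \<Rightarrow> (complex \<Rightarrow> real) \<Rightarrow> bool" where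
  "k_times_cont_diff 0 \<phi> \<longleftrightarrow> continuous_on UNIV \<phi>"
| "k_times_cont_diff (Suc k) \<phi> \<longleftrightarrow>
     (\<forall>z. \<phi> differentiable (at z)) \<and>
     (\<forall>v. k_times_cont_diff k (\<lambda>z. frechet_derivative \<phi> (at z) v))"

text \<open>The class \<open>C\<^sub>c\<^sup>\<infinity>(\<Omega>)\<close>, each function being extended by zero to the whole plane.\<close>
definition test_fun :: "complex set \<Rightarrow> (complex \<Rightarrow> real) \<Rightarrow> bool" where
  "test_fun \<Omega> \<phi> \<longleftrightarrow>
     (\<forall>k. k_times_cont_diff k \<phi>) \<and>
     (\<exists>C. compact C \<and> C \<subseteq> \<Omega> \<and> (\<forall>z. z \<notin> C \<longrightarrow> \<phi> z = 0))"

definition has_weak_deriv ::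
  "complex set \<Rightarrow> (complex \<Rightarrow> complex) \<Rightarrow> complex \<Rightarrow> (complex \<Rightarrow> complex) \<Rightarrow> bool" where
  "has_weak_deriv \<Omega> f v g \<longleftrightarrow>
     locally_integrable \<Omega> g \<and>
     (\<forall>\<phi>. test_fun \<Omega> \<phi> \<longrightarrow>
        (LINT z|lebesgue. frechet_derivative \<phi> (at z) v *\<^sub>R f z) =
        - (LINT z|lebesgue. \<phi> z *\<^sub>R g z))"

definition W11_loc :: "complex set \<Rightarrow> (complex \<Rightarrow> complex) \<Rightarrow> bool" where
  "W11_loc \<Omega> f \<longleftrightarrow>
     locally_integrable \<Omega> f \<and>
     (\<exists>g. has_weak_deriv \<Omega> f 1 g) \<and> (\<exists>g. has_weak_deriv \<Omega> f \<i> g)"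

text \<open>A representative; any two representatives agree almost everywhere on \<open>\<Omega>\<close>.\<close>
definition weak_deriv ::
  "complex set \<Rightarrow> (complex \<Rightarrow> complex) \<Rightarrow> complex \<Rightarrow> complex \<Rightarrow> complex" where
  "weak_deriv \<Omega> f v = (SOME g. has_weak_deriv \<Omega> f v g)"

text \<open>The differential matrix at \<open>z\<close> as a real-linear map of the plane; its columns are the
  weak partial derivatives in the directions \<open>1\<close> and \<open>\<i>\<close>. Its \<^const>\<open>onorm\<close> is the maximum
  of \<open>|Df(z)e|\<close> over unit vectors \<open>e\<close>.\<close>
definition Df :: "complex set \<Rightarrow> (complex \<Rightarrow> complex) \<Rightarrow> complex \<Rightarrow> complex \<Rightarrow> complex" where
  "Df \<Omega> f z = (\<lambda>h. Re h *\<^sub>R weak_deriv \<Omega> f 1 z + Im h *\<^sub>R weak_deriv \<Omega> f \<i> z)"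

definition Jac :: "complex set \<Rightarrow> (complex \<Rightarrow> complex) \<Rightarrow> complex \<Rightarrow> real" where
  "Jac \<Omega> f z = Re (Df \<Omega> f z 1) * Im (Df \<Omega> f z \<i>) - Re (Df \<Omega> f z \<i>) * Im (Df \<Omega> f z 1)"


section \<open>Mappings of finite distortion\<close>

text \<open>Orientation is expressed by degree one: the image of every positively oriented circle
  bounding a disc in \<open>\<Omega>\<close> winds once around the image of the centre.\<close>
definition sense_preserving_homeomorphism ::
  "complex set \<Rightarrow> complex set \<Rightarrow> (complex \<Rightarrow> complex) \<Rightarrow> bool" where
  "sense_preserving_homeomorphism \<Omega> \<Omega>' f \<longleftrightarrow>
     (\<exists>g. homeomorphism \<Omega> \<Omega>' f g) \<and>
     (\<forall>z r. 0 < r \<and> cball z r \<subseteq> \<Omega> \<longrightarrow> winding_number (f \<circ> circlepath z r) (f z) = 1)"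

definition distortion_bound ::
  "complex set \<Rightarrow> (complex \<Rightarrow> complex) \<Rightarrow> (complex \<Rightarrow> ereal) \<Rightarrow> bool" where
  "distortion_bound \<Omega> f K \<longleftrightarrow>
     K \<in> borel_measurable (lebesgue_on \<Omega>) \<and>
     (\<forall>z\<in>\<Omega>. 1 \<le> K z) \<and>
     (AE z in lebesgue_on \<Omega>. K z < \<infinity>) \<and>
     (AE z in lebesgue_on \<Omega>. ereal ((onorm (Df \<Omega> f z))\<^sup>2) \<le> ereal (Jac \<Omega> f z) * K z)"

definition finite_distortion :: "complex set \<Rightarrow> (complex \<Rightarrow> complex) \<Rightarrow> bool" where
  "finite_distortion \<Omega> f \<longleftrightarrow>
     open \<Omega> \<and> connected \<Omega> \<and> \<Omega> \<noteq> {} \<and>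
     sense_preserving_homeomorphism \<Omega> (f ` \<Omega>) f \<and>
     (\<Omega> = UNIV \<longrightarrow> f ` \<Omega> = UNIV) \<and>
     W11_loc \<Omega> f \<and>
     locally_integrable \<Omega> (Jac \<Omega> f) \<and>
     (\<exists>K. distortion_bound \<Omega> f K)"

text \<open>The smallest distortion bound is determined only up to null sets, hence a predicate.\<close>
definition is_distortion_function ::
  "complex set \<Rightarrow> (complex \<Rightarrow> complex) \<Rightarrow> (complex \<Rightarrow> ereal) \<Rightarrow> bool" where
  "is_distortion_function \<Omega> f K \<longleftrightarrow>
     distortion_bound \<Omega> f K \<and>
     (\<forall>K'. distortion_bound \<Omega> f K' \<longrightarrow> (AE z in lebesgue_on \<Omega>. K z \<le> K' z))"


section \<open>The principal branch of the argument of a mapping\<close>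

text \<open>For \<open>f\<close> continuous with \<open>f(1) = 1\<close> and no zeros in the punctured plane, these conditions
  determine \<open>A\<close> uniquely on \<open>(0,\<infinity>) \<times> \<real>\<close>. Values elsewhere are arbitrary.\<close>
definition polar_arg :: "(complex \<Rightarrow> complex) \<Rightarrow> real \<times> real \<Rightarrow> real" where
  "polar_arg f = (SOME A.
     continuous_on ({0<..} \<times> UNIV) A \<and>
     (\<forall>r>0. \<forall>\<theta>. f (rcis r \<theta>) = rcis (cmod (f (rcis r \<theta>))) (A (r, \<theta>))) \<and>
     A (1, 0) = 0)"

definition principal_arg :: "(complex \<Rightarrow> complex) \<Rightarrow> complex \<Rightarrow> real" where
  "principal_arg f z = polar_arg f (cmod z, Arg z)"

end

theory Submission
  imports Defs
begin

text \<open>A homeomorphism \<open>f\<close> with locally integrable weak derivatives is absolutely continuous on almost all lines and differentiable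
  almost everywhere, hence \<open>\<integral> J \<phi>(f) \<le> \<integral> \<phi>\<close> for \<open>\<phi> \<ge> 0\<close>. Each coordinate of a branch of \<open>log f\<close> obeys the maximum
  principle, so its oscillation over a square \<open>Q\<close> away from the origin is at most a constant times
  \<open>\<integral> |Df| / (|f| |z|)\<close> over the doubled square. Following \<open>log f\<close> from \<open>1\<close> to \<open>z\<close> through such squares gives,
  with \<open>|Df|\<^sup>2 \<le> K J\<close> and the area inequality,
  \<open>osc \<le> C (s \<integral> K / |z|\<^sup>2 + (\<integral> 1 / |w|\<^sup>2) / s)\<close> for all \<open>s > 0\<close>, the second integral being taken over the image.
  Exponential integrability bounds the first integral by a multiple of \<open>(log (1/|z|))\<^sup>2 / p\<close>. Applied to
  \<open>log |f|\<close>, truncated to the band between \<open>|f(z)|\<close> and \<open>1\<close>, the estimate shows that \<open>log (1/|f(z)|)\<close> is of at most this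
  order. Hence the image integral has the same order, and the estimate for \<open>arg f\<close> follows with \<open>s = 1\<close>.\<close>

section \<open>Smooth test functions\<close>

text \<open>The shaping obstacle is low regularity: Df is merely locally integrable, and nothing
  secures that null sets have null images. Hence increments are controlled on lines by the first
  power of |Df|, and the area formula is used only as an inequality on the set of differentiability.
  Winding becomes single valued through a lift \<open>F\<close> with
  \<open>exp (F w) = f (exp w)\<close> on the whole w-plane: arg f is Im F, and the radial path
  becomes a horizontal segment. The weight 1/(|f| |z|) is the scale invariant one: a square around z
  has side comparable to |z|, and d log f = df/f. The logarithmic area of the image is finite only
  over a band of moduli, whose width is itself unknown. This is not circular because |Df|/(|f| |z|)
  is split by Young's inequality with a free weight: the width then enters linearly, with a
  coefficient that can be made 1/2 when the width itself is estimated. Numerical constants are crude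
  throughout. Only their independence of p and f matters; whatever depends on f is of lower order
  than log^2 and is absorbed by shrinking the radius.\<close>

primrec ktimes_diff :: "nat \<Rightarrow> (real \<Rightarrow> real) \<Rightarrow> bool" where
  "ktimes_diff 0 b \<longleftrightarrow> continuous_on UNIV b"
| "ktimes_diff (Suc k) b \<longleftrightarrow> (\<exists>b'. (\<forall>x. (b has_real_derivative b' x) (at x)) \<and> ktimes_diff k b')"

definition smooth_real :: "(real \<Rightarrow> real) \<Rightarrow> bool" where
  "smooth_real b \<longleftrightarrow> (\<forall>k. ktimes_diff k b)"

lemma ktimes_diff_Suc_D: "ktimes_diff (Suc k) b \<Longrightarrow> ktimes_diff k b"
proof (induction k arbitrary: b)
  case 0
  then show ?case
    by (metis DERIV_isCont ktimes_diff.simps continuous_at_imp_continuous_on)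
next
  case (Suc k)
  then show ?case by (metis ktimes_diff.simps(2))
qed

lemma ktimes_diff_const: "ktimes_diff k (\<lambda>_. c)"
  by (induction k arbitrary: c) (auto intro!: derivative_eq_intros)

lemma ktimes_diff_add: "ktimes_diff k a \<Longrightarrow> ktimes_diff k b \<Longrightarrow> ktimes_diff k (\<lambda>x. a x + b x)"
proof (induction k arbitrary: a b)
  case 0
  then show ?case by (auto intro!: continuous_intros)
next
  case (Suc k)
  then obtain a' b' where "\<forall>x. (a has_real_derivative a' x) (at x)" "ktimes_diff k a'"
    "\<forall>x. (b has_real_derivative b' x) (at x)" "ktimes_diff k b'" by auto
  then show ?case using Suc.IH[of a' b']
    by (auto intro!: exI[of _ "\<lambda>x. a' x + b' x"] derivative_eq_intros)
qed

lemma ktimes_diff_mult: "ktimes_diff k a \<Longrightarrow> ktimes_diff k b \<Longrightarrow> ktimes_diff k (\<lambda>x. a x * b x)"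
proof (induction k arbitrary: a b)
  case 0
  then show ?case by (auto intro!: continuous_intros)
next
  case (Suc k)
  then obtain a' b' where *: "\<forall>x. (a has_real_derivative a' x) (at x)" "ktimes_diff k a'"
    "\<forall>x. (b has_real_derivative b' x) (at x)" "ktimes_diff k b'" by auto
  have "ktimes_diff k (\<lambda>x. a' x * b x + b' x * a x)"
    using Suc * by (intro ktimes_diff_add Suc.IH) (auto intro: ktimes_diff_Suc_D simp del: ktimes_diff.simps)
  moreover have "((\<lambda>x. a x * b x) has_real_derivative (a' x * b x + b' x * a x)) (at x)" for x
    using * by (intro DERIV_mult) auto
  ultimately show ?case by (auto intro!: exI[of _ "\<lambda>x. a' x * b x + b' x * a x"])
qed

lemma ktimes_diff_affine: "ktimes_diff k b \<Longrightarrow> ktimes_diff k (\<lambda>x. b (\<alpha> * x + \<beta>))"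
proof (induction k arbitrary: b)
  case 0
  then show ?case by (auto intro!: continuous_intros continuous_on_compose2[of UNIV b])
next
  case (Suc k)
  then obtain b' where *: "\<forall>x. (b has_real_derivative b' x) (at x)" "ktimes_diff k b'" by auto
  have "((\<lambda>x. b (\<alpha> * x + \<beta>)) has_real_derivative b' (\<alpha> * x + \<beta>) * \<alpha>) (at x)" for x
    by (rule DERIV_chain2[of b]) (auto intro!: derivative_eq_intros *(1)[rule_format])
  moreover have "ktimes_diff k (\<lambda>x. b' (\<alpha> * x + \<beta>) * \<alpha>)"
    using Suc.IH[OF *(2)] ktimes_diff_const by (rule ktimes_diff_mult)
  ultimately show ?case by (auto intro!: exI[of _ "\<lambda>x. b' (\<alpha> * x + \<beta>) * \<alpha>"])
qed

lemma smooth_real_deriv: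
  assumes "smooth_real b" "\<And>x. (b has_real_derivative b' x) (at x)"
  shows "smooth_real b'"
  unfolding smooth_real_def
proof
  fix k
  obtain c where c: "\<forall>x. (b has_real_derivative c x) (at x)" "ktimes_diff k c"
    using assms(1) unfolding smooth_real_def by (meson ktimes_diff.simps(2))
  have "b' = c" using c(1) assms(2) DERIV_unique by blast
  then show "ktimes_diff k b'" using c by simp
qed

text \<open>The step function below is only known as an integral, so its smoothness must come from
  that of its derivative.\<close>

lemma smooth_real_antideriv:
  assumes "smooth_real b'" "\<And>x. (b has_real_derivative b' x) (at x)"
  shows "smooth_real b"
  unfolding smooth_real_def
proof
  fix k
  show "ktimes_diff k b"
  proof (cases k)
    case 0
    have "ktimes_diff (Suc 0) b" using assms by (metis ktimes_diff.simps(2) smooth_real_def)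
    then show ?thesis using 0 ktimes_diff_Suc_D by blast
  next
    case (Suc n)
    then show ?thesis using assms by (auto simp: smooth_real_def intro!: exI[of _ b'])
  qed
qed

lemma smooth_real_has_deriv:
  assumes "smooth_real b" obtains b' where "\<And>x. (b has_real_derivative b' x) (at x)" "smooth_real b'"
proof -
  have "ktimes_diff (Suc 0) b" using assms unfolding smooth_real_def by blast
  then obtain b' where "\<forall>x. (b has_real_derivative b' x) (at x)" by auto
  then show ?thesis using smooth_real_deriv[OF assms] that by blast
qed

lemma smooth_real_continuous: "smooth_real b \<Longrightarrow> continuous_on UNIV b"
  unfolding smooth_real_def by (metis ktimes_diff.simps(1))

lemma smooth_real_mult: "smooth_real a \<Longrightarrow> smooth_real b \<Longrightarrow> smooth_real (\<lambda>x. a x * b x)"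
  and smooth_real_add: "smooth_real a \<Longrightarrow> smooth_real b \<Longrightarrow> smooth_real (\<lambda>x. a x + b x)"
  and smooth_real_const: "smooth_real (\<lambda>_. c)"
  and smooth_real_affine: "smooth_real b \<Longrightarrow> smooth_real (\<lambda>x. b (\<alpha> * x + \<beta>))"
  by (auto simp: smooth_real_def ktimes_diff_mult ktimes_diff_add ktimes_diff_const ktimes_diff_affine)

text \<open>The functions \<open>p(1/x) exp(-1/x)\<close>, with \<open>p\<close> ranging over all polynomials, form a class that is
  closed under differentiation.\<close>
definition flat :: "real poly \<Rightarrow> real \<Rightarrow> real" where
  "flat p x = (if x > 0 then poly p (1 / x) * exp (- (1 / x)) else 0)"

lemma poly_times_exp_tendsto_0: "((\<lambda>t. poly p t * exp (- t)) \<longlongrightarrow> 0) at_top" for p :: "real poly"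
proof -
  have "((\<lambda>t. \<Sum>i\<le>degree p. coeff p i * (t ^ i / exp t)) \<longlongrightarrow> (\<Sum>i\<le>degree p. coeff p i * 0)) at_top"
    by (intro tendsto_intros tendsto_power_div_exp_0)
  then show ?thesis
    by (simp add: poly_altdef sum_distrib_right exp_minus divide_inverse mult.assoc)
qed

lemma flat_tendsto_0: "(flat p \<longlongrightarrow> 0) (at 0)"
proof -
  have "((\<lambda>x. poly p (inverse x) * exp (- inverse x)) \<longlongrightarrow> 0) (at_right 0)"
    by (rule filterlim_compose[OF poly_times_exp_tendsto_0 filterlim_inverse_at_top_right])
  then have "(flat p \<longlongrightarrow> 0) (at_right 0)"
    by (rule Lim_transform_eventually) (auto simp: flat_def inverse_eq_divide eventually_at_filter)
  moreover have "(flat p \<longlongrightarrow> 0) (at_left 0)"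
    by (rule Lim_transform_eventually[OF tendsto_const]) (auto simp: flat_def eventually_at_filter)
  ultimately show ?thesis by (simp add: filterlim_at_split)
qed

text \<open>With t = 1/x one has dt/dx = -t^2, so p(t) exp(-t) has derivative t^2 (p - p')(t)
  exp(-t). The polynomial t^2 (p - p') is the one in the statement.\<close>

lemma flat_deriv: "(flat p has_real_derivative flat (monom 1 2 * (p - pderiv p)) x) (at x)"
proof -
  consider "x > 0" | "x < 0" | "x = 0" by linarith
  then show ?thesis
  proof cases
    case 1
    have "((\<lambda>x. poly p (1 / x) * exp (- (1 / x))) has_real_derivative
        flat (monom 1 2 * (p - pderiv p)) x) (at x)"
      using 1 by (auto intro!: derivative_eq_intros DERIV_chain2[OF poly_DERIV]
          simp: flat_def poly_monom power2_eq_square field_simps)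
    then show ?thesis
      by (rule has_field_derivative_transform_within_open[where S="{0<..}"])
        (use 1 in \<open>auto simp: flat_def\<close>)
  next
    case 2
    have "((\<lambda>x. 0) has_real_derivative flat (monom 1 2 * (p - pderiv p)) x) (at x)"
      using 2 by (auto simp: flat_def)
    then show ?thesis
      by (rule has_field_derivative_transform_within_open[where S="{..<0}"])
        (use 2 in \<open>auto simp: flat_def\<close>)
  next
    case 3
    \<comment> \<open>The difference quotient at 0 is \<open>flat\<close> of the polynomial t p(t),
      again a member of the class, so it tends to 0 as well.\<close>
    have "(flat (pCons 0 p) \<longlongrightarrow> 0) (at 0)" by (rule flat_tendsto_0)
    then have "((\<lambda>h. (flat p (0 + h) - flat p 0) / h) \<longlongrightarrow> 0) (at 0)"
      by (rule Lim_transform_eventually)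
        (auto simp: flat_def eventually_at_filter field_simps)
    then show ?thesis using 3 by (simp add: DERIV_def) (simp add: flat_def)
  qed
qed

lemma smooth_real_flat: "smooth_real (flat p)"
proof -
  have "ktimes_diff k (flat p)" for k
  proof (induction k arbitrary: p)
    case 0
    then show ?case using flat_deriv
      by (metis DERIV_isCont ktimes_diff.simps(1) continuous_at_imp_continuous_on)
  next
    case (Suc k)
    then show ?case using flat_deriv by (auto intro!: exI[of _ "flat (monom 1 2 * (p - pderiv p))"])
  qed
  then show ?thesis by (simp add: smooth_real_def)
qed

text \<open>\<open>S\<close> is the normalised primitive of a bump supported in [0,1], and \<eta> is
  the normalised bump. The pair is used twice: differences of rescaled copies of \<open>S\<close>
  are cutoffs tending to indicators of intervals, and the matching copies of \<eta> are approximate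
  point masses.\<close>

lemma smooth_step:
  obtains S \<eta> :: "real \<Rightarrow> real" where
    "smooth_real S" "\<And>x. (S has_real_derivative \<eta> x) (at x)" "smooth_real \<eta>"
    "\<And>x. x \<le> 0 \<Longrightarrow> S x = 0" "\<And>x. x \<ge> 1 \<Longrightarrow> S x = 1" "\<And>x. 0 \<le> S x" "\<And>x. S x \<le> 1"
    "\<And>x. 0 \<le> \<eta> x" "\<And>x. x \<le> 0 \<or> x \<ge> 1 \<Longrightarrow> \<eta> x = 0"
proof -
  define e where "e = (\<lambda>x. flat 1 x * flat 1 ((-1) * x + 1))"
  have sm: "smooth_real e" unfolding e_def by (intro smooth_real_mult smooth_real_flat smooth_real_affine[where b="flat 1"])
  have cont: "continuous_on A e" for A using smooth_real_continuous[OF sm] continuous_on_subset by blast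
  have pos: "e x \<ge> 0" for x by (simp add: e_def flat_def)
  have z: "e x = 0" if "x \<le> 0 \<or> x \<ge> 1" for x using that by (auto simp: e_def flat_def)
  have int: "e integrable_on {a..b}" for a b by (intro integrable_continuous_real cont)
  define I where "I = integral {0..1} e"
  have "I \<noteq> 0"
  proof
    assume "I = 0"
    then have "e x = 0" if "x \<in> {0..1}" for x
      using integral_eq_0_iff[of 0 1 e] cont pos that by (auto simp: I_def)
    from this[of "1/2"] show False by (simp add: e_def flat_def)
  qed
  moreover have "I \<ge> 0" unfolding I_def by (intro integral_nonneg int pos)
  ultimately have I: "I > 0" by simp
  \<comment> \<open>The lower limit -1 instead of 0 makes 0 an interior point of the interval of
    integration, so that the fundamental theorem yields a two-sided derivative there.\<close>
  define S where "S = (\<lambda>x. integral {-1..x} e / I)"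
  have Sz: "S x = 0" if "x \<le> 0" for x
  proof -
    have "integral {-1..x} e = integral {-1..x} (\<lambda>_. 0)"
      by (rule integral_cong) (use that z in auto)
    then show ?thesis by (simp add: S_def)
  qed
  have split: "S y = S x + integral {x..y} e / I" if "x \<le> y" "0 \<le> x" for x y
    using Henstock_Kurzweil_Integration.integral_combine[of "-1" x y e] that int I
    by (simp add: S_def field_simps)
  have S1: "S x = 1" if "x \<ge> 1" for x
  proof -
    have "integral {1..x} e = integral {1..x} (\<lambda>_. 0)"
      by (rule integral_cong) (use that z in auto)
    then show ?thesis using split[of 1 x] split[of 0 1] Sz[of 0] that I by (simp add: I_def)
  qed
  have mono: "S x \<le> S y" if "x \<le> y" for x y
  proof -
    consider "y \<le> 0" | "x \<le> 0" "0 \<le> y" | "0 \<le> x" by linarith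
    then show ?thesis
    proof cases
      case 1 then show ?thesis using that by (simp add: Sz)
    next
      case 2
      have "integral {0..y} e \<ge> 0" by (intro integral_nonneg int pos)
      then show ?thesis using 2 Sz[of x] Sz[of 0] split[of 0 y] I by simp
    next
      case 3
      have "integral {x..y} e \<ge> 0" by (intro integral_nonneg int pos)
      then show ?thesis using 3 that split[of x y] I by simp
    qed
  qed
  have d: "(S has_real_derivative e x / I) (at x)" for x
  proof (cases "x < 0")
    case True
    have "((\<lambda>x. 0) has_real_derivative e x / I) (at x)" using True z by auto
    then show ?thesis
      by (rule has_field_derivative_transform_within_open[where S="{..<0}"])
        (use True in \<open>auto simp: Sz\<close>)
  next
    case False
    have "((\<lambda>u. integral {-1..u} e) has_real_derivative e x) (at x within {-1..x+1})"
      by (rule integral_has_real_derivative[OF cont]) (use False in auto)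
    then have "((\<lambda>u. integral {-1..u} e) has_real_derivative e x) (at x)"
      using False at_within_interior[of x "{-1..x+1}"] by simp
    then show ?thesis unfolding S_def by (rule DERIV_cdivide)
  qed
  have se: "smooth_real (\<lambda>x. e x / I)"
    using smooth_real_mult[OF sm smooth_real_const[of "1/I"]] by simp
  show ?thesis
  proof (rule that)
    show "smooth_real S" by (rule smooth_real_antideriv[OF se d])
    show "0 \<le> S x" for x using mono[of "min x 0" x] Sz[of "min x 0"] by simp
    show "S x \<le> 1" for x using mono[of x "max x 1"] S1[of "max x 1"] by simp
    show "(S has_real_derivative e x / I) (at x)" for x by (rule d)
    show "smooth_real (\<lambda>x. e x / I)" by (rule se)
    show "0 \<le> e x / I" for x using pos I by simp
    show "e x / I = 0" if "x \<le> 0 \<or> x \<ge> 1" for x using z[OF that] by simp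
  qed (use Sz S1 in auto)
qed

section \<open>Test functions of product form in the plane\<close>

lemma k_times_cont_diff_add:
  "k_times_cont_diff k \<phi> \<Longrightarrow> k_times_cont_diff k \<psi> \<Longrightarrow> k_times_cont_diff k (\<lambda>z. \<phi> z + \<psi> z)"
proof (induction k arbitrary: \<phi> \<psi>)
  case 0
  then show ?case by (auto intro!: continuous_intros)
next
  case (Suc k)
  have "frechet_derivative (\<lambda>z. \<phi> z + \<psi> z) (at z) v =
      frechet_derivative \<phi> (at z) v + frechet_derivative \<psi> (at z) v" for z v
    using frechet_derivative_at[OF has_derivative_add[of \<phi> "frechet_derivative \<phi> (at z)" "at z"
      \<psi> "frechet_derivative \<psi> (at z)"]] Suc.prems
    by (auto simp: frechet_derivative_works dest: fun_cong[where x=v])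
  then show ?case using Suc by simp
qed

lemma has_derivative_tensor:
  assumes "\<And>x. (b has_real_derivative b' x) (at x)" "\<And>x. (c has_real_derivative c' x) (at x)"
  shows "((\<lambda>z. b (Re z) * c (Im z)) has_derivative
    (\<lambda>v. Re v * b' (Re z) * c (Im z) + b (Re z) * (Im v * c' (Im z)))) (at z)"
proof -
  have 1: "((\<lambda>z. b (Re z)) has_derivative (\<lambda>v. Re v * b' (Re z))) (at z)"
    using has_derivative_compose[OF bounded_linear_imp_has_derivative[OF bounded_linear_Re]
        assms(1)[of "Re z", unfolded has_field_derivative_def]]
    by (simp add: mult.commute)
  have 2: "((\<lambda>z. c (Im z)) has_derivative (\<lambda>v. Im v * c' (Im z))) (at z)"
    using has_derivative_compose[OF bounded_linear_imp_has_derivative[OF bounded_linear_Im]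
        assms(2)[of "Im z", unfolded has_field_derivative_def]]
    by (simp add: mult.commute)
  show ?thesis
    using has_derivative_mult[OF 1 2] by (simp add: add.commute)
qed

text \<open>The derivative of b(Re z) c(Im z) in a direction v is a sum of two products of the same
  form, with the coordinates of v absorbed as constant factors; hence the induction closes.\<close>

lemma k_times_cont_diff_tensor:
  assumes "smooth_real b" "smooth_real c"
  shows "k_times_cont_diff k (\<lambda>z. b (Re z) * c (Im z))"
  using assms
proof (induction k arbitrary: b c)
  case 0
  have "continuous_on UNIV (\<lambda>z. b (Re z))" "continuous_on UNIV (\<lambda>z. c (Im z))"
    using 0[THEN smooth_real_continuous]
    by (auto intro!: continuous_on_compose2[of UNIV b] continuous_on_compose2[of UNIV c] continuous_intros)
  then show ?case by (auto intro!: continuous_intros)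
next
  case (Suc k)
  obtain b' where b': "\<And>x. (b has_real_derivative b' x) (at x)" "smooth_real b'"
    using smooth_real_has_deriv Suc.prems by blast
  obtain c' where c': "\<And>x. (c has_real_derivative c' x) (at x)" "smooth_real c'"
    using smooth_real_has_deriv Suc.prems by blast
  note d = has_derivative_tensor[OF b'(1) c'(1)]
  have fd: "frechet_derivative (\<lambda>z. b (Re z) * c (Im z)) (at z) v =
    (Re v * b' (Re z)) * c (Im z) + b (Re z) * (Im v * c' (Im z))" for z v
    using frechet_derivative_at[OF d[of z], symmetric] by simp
  have "k_times_cont_diff k (\<lambda>z. (Re v * b' (Re z)) * c (Im z) + b (Re z) * (Im v * c' (Im z)))" for v
    by (intro k_times_cont_diff_add Suc.IH[of "\<lambda>x. Re v * b' x" c] Suc.IH[of b "\<lambda>x. Im v * c' x"]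
        smooth_real_mult smooth_real_const Suc.prems b' c')
  then show ?case using d by (auto simp: fd differentiable_def)
qed

lemma test_fun_tensor:
  assumes "smooth_real b" "smooth_real c" "\<And>x. x \<notin> {l..u} \<Longrightarrow> b x = 0" "\<And>x. x \<notin> {l'..u'} \<Longrightarrow> c x = 0"
  shows "test_fun UNIV (\<lambda>z. b (Re z) * c (Im z))"
proof -
  have "b (Re z) * c (Im z) = 0" if "z \<notin> cbox (Complex l l') (Complex u u')" for z
    using that assms(3)[of "Re z"] assms(4)[of "Im z"] by (auto simp: in_cbox_complex_iff)
  then show ?thesis unfolding test_fun_def
    using k_times_cont_diff_tensor[OF assms(1,2)] by (metis compact_cbox subset_UNIV)
qed

section \<open>Integration in the plane\<close>

lemma measurable_Complex[measurable]: "(\<lambda>p. Complex (fst p) (snd p)) \<in> borel_measurable (borel \<Otimes>\<^sub>M borel)"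
  unfolding Complex_eq by measurable

lemma measurable_Complex'[measurable (raw)]:
  assumes [measurable]: "f \<in> borel_measurable M" "g \<in> borel_measurable M"
  shows "(\<lambda>x. Complex (f x) (g x)) \<in> borel_measurable M"
  unfolding Complex_eq by measurable

text \<open>The complex plane is not literally a product type. Identifying its Lebesgue measure with
  an image of the product measure is what gives access to Fubini and Tonelli.\<close>

lemma lborel_complex: "(lborel :: complex measure) = distr (lborel \<Otimes>\<^sub>M lborel) borel (\<lambda>p. Complex (fst p) (snd p))"
proof (rule lborel_eqI)
  fix l u :: complex assume le: "\<And>b. b \<in> Basis \<Longrightarrow> l \<bullet> b \<le> u \<bullet> b"
  have 1: "(\<lambda>p. Complex (fst p) (snd p)) -` box l u \<inter> space (lborel \<Otimes>\<^sub>M lborel)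
     = {Re l<..<Re u} \<times> {Im l<..<Im u}"
    by (auto simp: in_box_complex_iff space_pair_measure)
  show "emeasure (distr (lborel \<Otimes>\<^sub>M lborel) borel (\<lambda>p. Complex (fst p) (snd p))) (box l u)
      = (\<Prod>b\<in>Basis. (u - l) \<bullet> b)"
    using le[of 1] le[of \<i>]
    by (subst emeasure_distr)
      (auto simp: 1 lborel.emeasure_pair_measure_Times Basis_complex_def ennreal_mult)
qed simp

lemma nn_integral_complex:
  assumes [measurable]: "f \<in> borel_measurable (borel :: complex measure)"
  shows "(\<integral>\<^sup>+z. f z \<partial>lborel) = (\<integral>\<^sup>+y. \<integral>\<^sup>+x. f (Complex x y) \<partial>lborel \<partial>lborel)"
    and "(\<integral>\<^sup>+z. f z \<partial>lborel) = (\<integral>\<^sup>+x. \<integral>\<^sup>+y. f (Complex x y) \<partial>lborel \<partial>lborel)"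
proof -
  have 1: "(\<integral>\<^sup>+z. f z \<partial>lborel) = (\<integral>\<^sup>+p. f (Complex (fst p) (snd p)) \<partial>(lborel \<Otimes>\<^sub>M lborel))"
    by (subst lborel_complex) (simp add: nn_integral_distr)
  show "(\<integral>\<^sup>+z. f z \<partial>lborel) = (\<integral>\<^sup>+x. \<integral>\<^sup>+y. f (Complex x y) \<partial>lborel \<partial>lborel)"
    unfolding 1 by (subst lborel.nn_integral_fst[symmetric]) auto
  show "(\<integral>\<^sup>+z. f z \<partial>lborel) = (\<integral>\<^sup>+y. \<integral>\<^sup>+x. f (Complex x y) \<partial>lborel \<partial>lborel)"
    unfolding 1 by (subst lborel_pair.nn_integral_snd[symmetric]) auto
qed

lemma integral_complex:
  fixes f :: "complex \<Rightarrow> 'b::{banach, second_countable_topology}"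
  assumes "integrable lborel f"
  shows "(LINT z|lborel. f z) = (LINT y|lborel. LINT x|lborel. f (Complex x y))"
    and "integrable lborel (\<lambda>y. LINT x|lborel. f (Complex x y))"
    and "AE y in lborel. integrable lborel (\<lambda>x. f (Complex x y))"
proof -
  have [measurable]: "f \<in> borel_measurable borel" using assms by auto
  have int: "integrable (lborel \<Otimes>\<^sub>M lborel) (\<lambda>(x,y). f (Complex x y))"
    using assms by (subst (asm) lborel_complex) (simp add: integrable_distr_eq case_prod_beta')
  have 1: "(LINT z|lborel. f z) = (LINT p|(lborel \<Otimes>\<^sub>M lborel). (case p of (x,y) \<Rightarrow> f (Complex x y)))"
    by (subst lborel_complex) (simp add: integral_distr case_prod_beta')
  show "(LINT z|lborel. f z) = (LINT y|lborel. LINT x|lborel. f (Complex x y))"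
    unfolding 1 using lborel_pair.integral_snd[OF int] by simp
  show "integrable lborel (\<lambda>y. LINT x|lborel. f (Complex x y))"
    using lborel_pair.integrable_snd[OF int] by simp
  show "AE y in lborel. integrable lborel (\<lambda>x. f (Complex x y))"
    using lborel_pair.AE_integrable_snd[OF int] by simp
qed

text \<open>Reflection in the diagonal. It preserves Lebesgue measure, so every fact about vertical
  lines and the derivative in direction \<i> is the horizontal fact for the reflected map.\<close>

definition flip :: "complex \<Rightarrow> complex" where "flip z = Complex (Im z) (Re z)"

lemma flip_simps[simp]: "Re (flip z) = Im z" "Im (flip z) = Re z" "flip (flip z) = z"
  "flip (Complex x y) = Complex y x"
  by (auto simp: flip_def complex_eq_iff)

lemma continuous_flip[continuous_intros]: "continuous_on A f \<Longrightarrow> continuous_on A (\<lambda>x. flip (f x))"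
  unfolding flip_def Complex_eq by (intro continuous_intros)

lemma measurable_flip[measurable]: "flip \<in> borel_measurable borel"
  by (intro borel_measurable_continuous_onI continuous_intros)

lemma distr_flip: "distr lborel borel flip = lborel"
proof (rule lborel_eqI[symmetric])
  fix l u :: complex assume le: "\<And>b. b \<in> Basis \<Longrightarrow> l \<bullet> b \<le> u \<bullet> b"
  have 1: "flip -` box l u \<inter> space lborel = box (flip l) (flip u)"
    by (auto simp: in_box_complex_iff)
  show "emeasure (distr lborel borel flip) (box l u) = (\<Prod>b\<in>Basis. (u - l) \<bullet> b)"
    using le[of 1] le[of \<i>]
    by (subst emeasure_distr, simp, simp, subst 1)
      (auto simp: emeasure_lborel_box_eq Basis_complex_def ennreal_mult mult.commute)
qed simp

lemma integral_flip:
  fixes f :: "complex \<Rightarrow> 'b::{banach, second_countable_topology}"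
  assumes [measurable]: "f \<in> borel_measurable borel"
  shows "(LINT z|lborel. f (flip z)) = (LINT z|lborel. f z)"
  by (subst (2) distr_flip[symmetric], subst integral_distr) auto

lemma integrable_flip:
  fixes f :: "complex \<Rightarrow> 'b::{banach, second_countable_topology}"
  assumes "integrable lborel f"
  shows "integrable lborel (\<lambda>z. f (flip z))"
proof -
  have "integrable (distr lborel borel flip) f" using assms by (simp add: distr_flip)
  then show ?thesis using assms by (subst (asm) integrable_distr_eq) auto
qed

text \<open>The weak derivative in direction 1 with a Borel representative, tested only against
  products b(Re z) c(Im z). Such products suffice because they approximate indicators of rectangles.
  The form is compatible with \<open>flip\<close>, so it also encodes the vertical
  derivative.\<close>

definition weak_x :: "(complex \<Rightarrow> complex) \<Rightarrow> (complex \<Rightarrow> complex) \<Rightarrow> bool" where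
  "weak_x f g \<longleftrightarrow> continuous_on UNIV f \<and> g \<in> borel_measurable borel \<and>
    (\<forall>a b. set_integrable lborel (cbox a b) g) \<and>
    (\<forall>b b' c l u l' u'. smooth_real b \<longrightarrow> smooth_real c \<longrightarrow> (\<forall>x. (b has_real_derivative b' x) (at x)) \<longrightarrow>
      (\<forall>x. x \<notin> {l..u} \<longrightarrow> b x = 0) \<longrightarrow> (\<forall>x. x \<notin> {l'..u'} \<longrightarrow> c x = 0) \<longrightarrow>
      (LINT z|lborel. (b' (Re z) * c (Im z)) *\<^sub>R f z) = - (LINT z|lborel. (b (Re z) * c (Im z)) *\<^sub>R g z))"

lemma smooth_real_measurable[measurable_dest]: "smooth_real b \<Longrightarrow> b \<in> borel_measurable borel"
  by (intro borel_measurable_continuous_onI smooth_real_continuous)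

text \<open>The substitution x = a + t/(n+1) turns the integral into an average of \<open>F\<close>
  over points slightly to the right of \<open>a\<close>. The second claim is the uniform bound
  needed for dominated convergence in the remaining variable.\<close>

lemma integral_approx_delta:
  fixes F :: "real \<Rightarrow> complex"
  assumes cont: "continuous_on UNIV F" and sm: "smooth_real \<eta>"
    and z: "\<And>x. x \<le> 0 \<or> x \<ge> 1 \<Longrightarrow> \<eta> x = 0" and nn: "\<And>x. 0 \<le> \<eta> x" and one: "(LINT x|lborel. \<eta> x) = 1"
  shows "(\<lambda>n. LINT x|lborel. (real (Suc n) * \<eta> (real (Suc n) * (x - a))) *\<^sub>R F x) \<longlonglongrightarrow> F a"
    and "\<And>n M. (\<And>x. x \<in> {a..a+1} \<Longrightarrow> norm (F x) \<le> M) \<Longrightarrow>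
      norm (LINT x|lborel. (real (Suc n) * \<eta> (real (Suc n) * (x - a))) *\<^sub>R F x) \<le> M"
proof -
  have [measurable]: "F \<in> borel_measurable borel" "\<eta> \<in> borel_measurable borel"
    using cont sm by (auto intro: borel_measurable_continuous_onI smooth_real_continuous)
  have int: "integrable lborel \<eta>" using one not_integrable_integral_eq by fastforce
  have eq: "(LINT x|lborel. (real (Suc n) * \<eta> (real (Suc n) * (x - a))) *\<^sub>R F x)
    = (LINT t|lborel. \<eta> t *\<^sub>R F (a + t / real (Suc n)))" for n
    by (subst lborel_integral_real_affine[where c="1 / real (Suc n)" and t=a])
      (auto simp: scaleR_scaleR[symmetric] simp del: scaleR_scaleR of_nat_Suc, simp)
  have mem: "a + t / real (Suc n) \<in> {a..a+1}" if "\<eta> t \<noteq> 0" for t n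
  proof -
    have "0 < t" "t < 1" using z[of t] that by linarith+
    moreover have "t / real (Suc n) \<le> t" using \<open>0 < t\<close> by (simp add: field_simps)
    ultimately show ?thesis by auto
  qed
  {
    fix M n assume M: "\<And>x. x \<in> {a..a+1} \<Longrightarrow> norm (F x) \<le> M"
    have le: "norm (\<eta> t *\<^sub>R F (a + t / real (Suc n))) \<le> M * \<eta> t" for t
      using M[OF mem[of t n]] nn[of t] by (cases "\<eta> t = 0") (auto simp: mult.commute intro: mult_left_mono)
    have "integrable lborel (\<lambda>t. \<eta> t *\<^sub>R F (a + t / real (Suc n)))"
      by (rule Bochner_Integration.integrable_bound[where f="\<lambda>t. M * \<eta> t"])
        (use int in \<open>auto intro!: AE_I2 order_trans[OF le[unfolded norm_scaleR]] simp del: of_nat_Suc\<close>)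
    then have "(LINT t|lborel. norm (\<eta> t *\<^sub>R F (a + t / real (Suc n)))) \<le> (LINT t|lborel. M * \<eta> t)"
      using int by (intro Bochner_Integration.integral_mono[OF integrable_norm _ le] integrable_mult_right)
    then have "norm (LINT t|lborel. \<eta> t *\<^sub>R F (a + t / real (Suc n))) \<le> (LINT t|lborel. M * \<eta> t)"
      by (rule order_trans[OF integral_norm_bound])
    then show "norm (LINT x|lborel. (real (Suc n) * \<eta> (real (Suc n) * (x - a))) *\<^sub>R F x) \<le> M"
      unfolding eq using one by simp
  }
  obtain M where M: "\<And>x. x \<in> {a..a+1} \<Longrightarrow> norm (F x) \<le> M"
    using compact_imp_bounded[OF compact_continuous_image[OF continuous_on_subset[OF cont] compact_Icc[of a "a+1"]]]
    by (force simp: bounded_iff)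
  have "(\<lambda>n. LINT t|lborel. \<eta> t *\<^sub>R F (a + t / real (Suc n))) \<longlonglongrightarrow> (LINT t|lborel. \<eta> t *\<^sub>R F a)"
  proof (rule integral_dominated_convergence[where w="\<lambda>t. M * \<eta> t"])
    show "AE t in lborel. (\<lambda>n. \<eta> t *\<^sub>R F (a + t / real (Suc n))) \<longlonglongrightarrow> \<eta> t *\<^sub>R F a"
    proof (intro AE_I2 tendsto_scaleR tendsto_const)
      fix t
      have "(\<lambda>n. a + t * inverse (real (Suc n))) \<longlonglongrightarrow> a + t * 0"
        by (intro tendsto_intros LIMSEQ_inverse_real_of_nat)
      then have "(\<lambda>n. a + t / real (Suc n)) \<longlonglongrightarrow> a" by (simp add: divide_inverse)
      then show "(\<lambda>n. F (a + t / real (Suc n))) \<longlonglongrightarrow> F a"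
        using cont by (intro isCont_tendsto_compose[of a F]) (auto simp: continuous_on_eq_continuous_at)
    qed
    show "AE t in lborel. norm (\<eta> t *\<^sub>R F (a + t / real (Suc n))) \<le> M * \<eta> t" for n
    proof (intro AE_I2)
      fix t show "norm (\<eta> t *\<^sub>R F (a + t / real (Suc n))) \<le> M * \<eta> t"
        using M[OF mem[of t n]] nn[of t] by (cases "\<eta> t = 0") (auto simp: mult.commute intro: mult_left_mono)
    qed
  qed (use int in auto)
  also have "(LINT t|lborel. \<eta> t *\<^sub>R F a) = F a" using one int by simp
  finally show "(\<lambda>n. LINT x|lborel. (real (Suc n) * \<eta> (real (Suc n) * (x - a))) *\<^sub>R F x) \<longlonglongrightarrow> F a"
    unfolding eq .
qed

section \<open>Absolute continuity on lines\<close>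

text \<open>Lebesgue differentiation: almost every value of \<open>D\<close> is a limit of averages
  over intervals starting at that point, and all of these vanish. Half-open intervals appear because
  they are the limits of the cutoffs used later; an endpoint is a null set.\<close>

lemma AE_zero_of_integrals_zero:
  fixes D :: "real \<Rightarrow> complex"
  assumes int: "\<And>a b. set_integrable lborel {a..b} D" and zero: "\<And>a b. a < b \<Longrightarrow> (LINT y:{a<..b}|lborel. D y) = 0"
  shows "AE y in lborel. D y = 0"
proof -
  have hk: "D integrable_on cbox a b" for a b :: real
    using set_borel_integral_eq_integral(1)[OF int[of a b]] by simp
  have I0: "integral (cbox a b) D = 0" if "a < b" for a b :: real
  proof -
    have "integral (cbox a b) D = (LINT y:{a..b}|lborel. D y)"
      using set_borel_integral_eq_integral(2)[OF int[of a b]] by simp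
    also have "\<dots> = (LINT y:{a<..b}|lborel. D y)"
      unfolding set_lebesgue_integral_def
    proof (rule integral_cong_AE)
      show "(\<lambda>y. indicator {a..b} y *\<^sub>R D y) \<in> borel_measurable lborel"
        using int[of a b] by (auto simp: set_integrable_def)
      have "set_integrable lborel {a<..b} D"
        by (rule set_integrable_subset[OF int[of a b]]) auto
      then show "(\<lambda>y. indicator {a<..b} y *\<^sub>R D y) \<in> borel_measurable lborel"
        by (auto simp: set_integrable_def)
      show "AE y in lborel. indicator {a..b} y *\<^sub>R D y = indicator {a<..b} y *\<^sub>R D y"
        using AE_lborel_singleton[of a] by eventually_elim (auto simp: indicator_def)
    qed
    finally show ?thesis using zero[OF that] by simp
  qed
  obtain N where N: "negligible N" "\<And>x e. \<lbrakk>x \<notin> N; 0 < e\<rbrakk> \<Longrightarrow>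
       \<exists>d>0. \<forall>h. 0 < h \<and> h < d \<longrightarrow> norm(integral (cbox x (x + h *\<^sub>R One)) D /\<^sub>R h ^ DIM(real) - D x) < e"
    using integrable_ccontinuous_explicit[of D] hk by blast
  have "D x = 0" if "x \<notin> N" for x
  proof (rule ccontr)
    assume "D x \<noteq> 0"
    with N(2)[OF that, of "norm (D x)"] obtain d where d: "d > 0" "\<forall>h. 0 < h \<and> h < d \<longrightarrow> norm(integral (cbox x (x + h *\<^sub>R One)) D /\<^sub>R h ^ DIM(real) - D x) < norm (D x)"
      by auto
    have "norm(integral (cbox x (x + (d/2) *\<^sub>R One)) D /\<^sub>R (d/2) ^ DIM(real) - D x) < norm (D x)"
      using d(1) by (intro d(2)[rule_format]) auto
    then show False using I0[of x "x + d/2"] d(1) by simp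
  qed
  then have "{x. D x \<noteq> 0} \<subseteq> N" by auto
  then have "negligible {x. D x \<noteq> 0}" using N(1) negligible_subset by blast
  then have "{x. D x \<noteq> 0} \<in> null_sets lebesgue" by (simp add: negligible_iff_null_sets)
  then have "AE x in lebesgue. D x = 0" by (auto dest: AE_not_in)
  then show ?thesis by (simp add: AE_completion_iff)
qed

text \<open>The weak derivative is tested with a product of two cutoffs. In the limit the
  x-derivative of the first becomes a unit mass at \<open>a\<close> minus one at \<open>b\<close>,
  while the product itself becomes the indicator of a rectangle. Here the null set of heights
  depends on \<open>a\<close> and \<open>b\<close>, so it can be made uniform only over countably
  many pairs.\<close>

lemma weak_x_lines_rat:
  assumes w: "weak_x f g" and ab: "a < b"
  shows "AE y in lborel. f (Complex b y) - f (Complex a y) = (LINT x:{a<..b}|lborel. g (Complex x y))"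
proof -
  have contf: "continuous_on UNIV f" and gm[measurable]: "g \<in> borel_measurable borel"
    and gi: "\<And>a b. set_integrable lborel (cbox a b) g" using w by (auto simp: weak_x_def)
  have fm[measurable]: "f \<in> borel_measurable borel" using contf by (rule borel_measurable_continuous_onI)
  obtain S \<eta> :: "real \<Rightarrow> real" where S:
    "smooth_real S" "\<And>x. (S has_real_derivative \<eta> x) (at x)" "smooth_real \<eta>"
    "\<And>x. x \<le> 0 \<Longrightarrow> S x = 0" "\<And>x. x \<ge> 1 \<Longrightarrow> S x = 1" "\<And>x. 0 \<le> S x" "\<And>x. S x \<le> 1"
    "\<And>x. 0 \<le> \<eta> x" "\<And>x. x \<le> 0 \<or> x \<ge> 1 \<Longrightarrow> \<eta> x = 0" by (rule smooth_step) blast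
  note [measurable] = smooth_real_measurable[OF S(1)] smooth_real_measurable[OF S(3)]
  have "(\<eta> has_integral (S 1 - S 0)) {0..1}"
    by (rule fundamental_theorem_of_calculus)
      (auto intro!: has_vector_derivative_at_within S(2)[unfolded has_real_derivative_iff_has_vector_derivative])
  then have hi: "integral {0..1} \<eta> = 1" using S(4)[of 0] S(5)[of 1] by (simp add: integral_unique)
  have one: "(LINT x|lborel. \<eta> x) = 1"
  proof -
    have "\<eta> x = indicator {0..1} x *\<^sub>R \<eta> x" for x using S(9)[of x] by (cases "x \<in> {0..1}") auto
    then have "(LINT x|lborel. \<eta> x) = (LINT x:{0..1}|lborel. \<eta> x)"
      unfolding set_lebesgue_integral_def by (intro Bochner_Integration.integral_cong) auto
    also have "\<dots> = 1"
      using hi set_borel_integral_eq_integral(2)[OF borel_integrable_atLeastAtMost'[of 0 1 \<eta>]]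
        continuous_on_subset[OF smooth_real_continuous[OF S(3)]] by simp
    finally show ?thesis .
  qed
  have cont\<eta>: "continuous_on A (\<lambda>x. \<eta> (k * (x - e)))" for A k e
    by (rule continuous_on_compose2[OF smooth_real_continuous[OF S(3)]]) (auto intro!: continuous_intros)
  \<comment> \<open>A ramp that rises just to the right of \<open>a\<close> and falls just to the
    right of \<open>b\<close>. For \<open>a < b\<close> its pointwise limit is the indicator of the
    half-open interval, and all supports lie in \<open>{a..b+1}\<close>.\<close>
  define bn where "bn = (\<lambda>a b n x. S (real (Suc n) * (x - a)) - S (real (Suc n) * (x - b)))"
  define bn' where "bn' = (\<lambda>a b n x. real (Suc n) * \<eta> (real (Suc n) * (x - a)) - real (Suc n) * \<eta> (real (Suc n) * (x - b)))"
  have smA: "smooth_real (\<lambda>x. S (real (Suc n) * (x - a)))" for n a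
    using smooth_real_affine[OF S(1), of "real (Suc n)" "- real (Suc n) * a"] by (simp add: algebra_simps)
  have smb: "smooth_real (bn a b n)" for a b n
    unfolding bn_def
    using smooth_real_add[OF smA[of n a] smooth_real_mult[OF smooth_real_const[of "-1"] smA[of n b]]] by simp
  have bn_m[measurable]: "bn a b n \<in> borel_measurable borel" for a b n
    using smb by (rule smooth_real_measurable)
  have bn'_m[measurable]: "bn' a b n \<in> borel_measurable borel" for a b n
    unfolding bn'_def by measurable
  have derb: "(bn a b n has_real_derivative bn' a b n x) (at x)" for a b n x
    unfolding bn_def bn'_def
    by (auto intro!: derivative_eq_intros DERIV_chain2[OF S(2)] simp del: of_nat_Suc)
  have bn_z: "bn a b n x = 0" if "a < b" "x \<notin> {a..b+1}" for a b n x
  proof (cases "x < a")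
    case True
    then show ?thesis using that S(4) by (simp add: bn_def mult_nonneg_nonpos del: of_nat_Suc)
  next
    case False
    then have x: "x > b + 1" using that by auto
    have "real (Suc n) * (x - b) \<ge> 1 * 1" "real (Suc n) * (x - a) \<ge> 1 * 1"
      using x that by (intro mult_mono; simp)+
    then show ?thesis using S(5) by (simp add: bn_def)
  qed
  have bn_le: "\<bar>bn a b n x\<bar> \<le> indicator {a..b+1} x" if "a < b" for a b n x
    using bn_z[OF that, of x n] S(6)[of "real (Suc n) * (x - a)"] S(6)[of "real (Suc n) * (x - b)"]
      S(7)[of "real (Suc n) * (x - a)"] S(7)[of "real (Suc n) * (x - b)"]
    by (auto simp: indicator_def bn_def)
  have Slim: "(\<lambda>n. S (real (Suc n) * (x - a))) \<longlonglongrightarrow> indicator {a<..} x" for x a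
  proof (cases "x > a")
    case True
    obtain N where N: "1 < real N * (x - a)" using True reals_Archimedean3[of "x - a"] by auto
    have "eventually (\<lambda>n. S (real (Suc n) * (x - a)) = 1) sequentially"
      unfolding eventually_sequentially
    proof (intro exI allI impI S(5))
      fix n assume "N \<le> n"
      then have "real N * (x - a) \<le> real (Suc n) * (x - a)" using True by (intro mult_right_mono) auto
      then show "1 \<le> real (Suc n) * (x - a)" using N by linarith
    qed
    then show ?thesis using True by (simp add: tendsto_eventually)
  next
    case False
    then show ?thesis using S(4) by (simp add: mult_nonneg_nonpos del: of_nat_Suc)
  qed
  have bn_lim: "(\<lambda>n. bn a b n x) \<longlonglongrightarrow> indicator {a<..b} x" if "a < b" for a b x
  proof -
    have "(\<lambda>n. bn a b n x) \<longlonglongrightarrow> indicator {a<..} x - indicator {b<..} x"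
      unfolding bn_def by (intro tendsto_diff Slim)
    also have "indicator {a<..} x - indicator {b<..} x = (indicator {a<..b} x :: real)"
      using that by (auto simp: indicator_def)
    finally show ?thesis .
  qed
  \<comment> \<open>The defect of the fundamental theorem of calculus on the line at height y. Its
    integral over every interval of heights will be shown to vanish.\<close>
  define D where "D = (\<lambda>y. f (Complex b y) - f (Complex a y) - (LINT x:{a<..b}|lborel. g (Complex x y)))"
  define R where "R = (\<lambda>c d z. indicator {a<..b} (Re z) * indicator {c<..d} (Im z) :: real)"
  have contline: "continuous_on A (\<lambda>y. f (Complex x y))" "continuous_on A (\<lambda>x. f (Complex x y))" for x y A
    unfolding Complex_eq by (intro continuous_on_compose2[OF contf] continuous_intros; simp)+
  have gR: "integrable lborel (\<lambda>z. R c d z *\<^sub>R g z)" for c d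
  proof (rule Bochner_Integration.integrable_bound)
    show "integrable lborel (\<lambda>z. indicator (cbox (Complex a c) (Complex b d)) z *\<^sub>R g z)"
      using gi[of "Complex a c" "Complex b d"] by (simp add: set_integrable_def)
  qed (auto simp: R_def indicator_def in_cbox_complex_iff)
  have inner: "(LINT x|lborel. R c d (Complex x y) *\<^sub>R g (Complex x y))
      = indicator {c<..d} y *\<^sub>R (LINT x:{a<..b}|lborel. g (Complex x y))" for c d y
    unfolding R_def set_lebesgue_integral_def
    by (cases "y \<in> {c<..d}") simp_all
  have Gint: "set_integrable lborel {c<..d} (\<lambda>y. LINT x:{a<..b}|lborel. g (Complex x y))" for c d
    using integral_complex(2)[OF gR[of c d]] by (simp add: inner set_integrable_def)
  have fint: "set_integrable lborel {c..d} (\<lambda>y. f (Complex b y) - f (Complex a y))" for c d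
    by (intro borel_integrable_atLeastAtMost' continuous_intros contline)
  have Dint: "set_integrable lborel {c..d} D" for c d
  proof -
    have "set_integrable lborel {c..d} (\<lambda>y. LINT x:{a<..b}|lborel. g (Complex x y))"
      by (rule set_integrable_subset[OF Gint[of "c-1" d]]) auto
    then show ?thesis unfolding D_def by (intro set_integral_diff fint)
  qed
  have "(LINT y:{c<..d}|lborel. D y) = 0" if cd: "c < d" for c d
  proof -
    let ?L = "\<lambda>n. (LINT z|lborel. (bn' a b n (Re z) * bn c d n (Im z)) *\<^sub>R f z)"
    let ?Rh = "\<lambda>n. (LINT z|lborel. (bn a b n (Re z) * bn c d n (Im z)) *\<^sub>R g z)"
    have LR: "?L n = - ?Rh n" for n
      using w smb derb bn_z[OF ab] bn_z[OF cd] unfolding weak_x_def by blast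
    have R: "?Rh \<longlonglongrightarrow> (LINT z|lborel. R c d z *\<^sub>R g z)"
    proof (rule integral_dominated_convergence[where
          w="\<lambda>z. norm (indicator (cbox (Complex a c) (Complex (b+1) (d+1))) z *\<^sub>R g z)"])
      show "integrable lborel (\<lambda>z. norm (indicator (cbox (Complex a c) (Complex (b+1) (d+1))) z *\<^sub>R g z))"
        by (rule integrable_norm[OF gi[unfolded set_integrable_def]])
      show "AE z in lborel. (\<lambda>n. (bn a b n (Re z) * bn c d n (Im z)) *\<^sub>R g z) \<longlonglongrightarrow> R c d z *\<^sub>R g z"
        unfolding R_def by (intro AE_I2 tendsto_intros bn_lim ab cd)
      show "AE z in lborel. norm ((bn a b n (Re z) * bn c d n (Im z)) *\<^sub>R g z)
         \<le> norm (indicator (cbox (Complex a c) (Complex (b+1) (d+1))) z *\<^sub>R g z)" for n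
      proof (intro AE_I2)
        fix z
        have "\<bar>bn a b n (Re z) * bn c d n (Im z)\<bar> \<le> indicator {a..b+1} (Re z) * indicator {c..d+1} (Im z)"
          unfolding abs_mult using bn_le[OF ab, of n "Re z"] bn_le[OF cd, of n "Im z"] by (intro mult_mono) auto
        also have "\<dots> = indicator (cbox (Complex a c) (Complex (b+1) (d+1))) z"
          by (auto simp: indicator_def in_cbox_complex_iff)
        finally show "norm ((bn a b n (Re z) * bn c d n (Im z)) *\<^sub>R g z)
         \<le> norm (indicator (cbox (Complex a c) (Complex (b+1) (d+1))) z *\<^sub>R g z)"
          by (auto intro: mult_right_mono)
      qed
    qed (auto simp: R_def)
    let ?K = "cbox (Complex a c) (Complex (b+1) (d+1))"
    obtain M where M: "\<And>z. z \<in> ?K \<Longrightarrow> norm (f z) \<le> M"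
      using compact_imp_bounded[OF compact_continuous_image[OF continuous_on_subset[OF contf] compact_cbox[of "Complex a c" "Complex (b+1) (d+1)"]]]
      by (auto simp: bounded_iff)
    let ?\<Phi> = "\<lambda>n y. LINT x|lborel. bn' a b n x *\<^sub>R f (Complex x y)"
    let ?d = "\<lambda>n a x. real (Suc n) * \<eta> (real (Suc n) * (x - a))"
    have dz: "?d n a x = 0" if "x \<notin> {a..a+1}" for n a x
    proof (cases "x < a")
      case True then show ?thesis using S(9) by (simp add: mult_nonneg_nonpos del: of_nat_Suc)
    next
      case False
      then have "real (Suc n) * (x - a) \<ge> 1 * 1" using that by (intro mult_mono) auto
      then show ?thesis using S(9) by simp
    qed
    have dint: "integrable lborel (\<lambda>x. ?d n a x *\<^sub>R F x)" if F: "continuous_on UNIV F" for n a and F :: "real \<Rightarrow> complex"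
    proof -
      have "set_integrable lborel {a..a+1} (\<lambda>x. ?d n a x *\<^sub>R F x)"
        by (intro borel_integrable_atLeastAtMost' continuous_intros continuous_on_subset[OF F] cont\<eta>) auto
      moreover have "indicator {a..a+1} x *\<^sub>R ?d n a x *\<^sub>R F x = ?d n a x *\<^sub>R F x" for x
        using dz[of x a n] by (cases "x \<in> {a..a+1}") auto
      ultimately show ?thesis unfolding set_integrable_def by (simp only:)
    qed
    have \<Phi>eq: "?\<Phi> n y = (LINT x|lborel. ?d n a x *\<^sub>R f (Complex x y)) - (LINT x|lborel. ?d n b x *\<^sub>R f (Complex x y))" for n y
      unfolding bn'_def scaleR_diff_left by (intro Bochner_Integration.integral_diff dint contline)
    have \<Phi>lim: "(\<lambda>n. ?\<Phi> n y) \<longlonglongrightarrow> f (Complex a y) - f (Complex b y)" for y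
      unfolding \<Phi>eq by (intro tendsto_diff integral_approx_delta(1)[where F="\<lambda>x. f (Complex x y)"] contline S one)
    have \<Phi>b: "norm (?\<Phi> n y) \<le> 2 * M" if "y \<in> {c..d+1}" for n y
    proof -
      have "norm (LINT x|lborel. ?d n a x *\<^sub>R f (Complex x y)) \<le> M"
        by (intro integral_approx_delta(2)[where F="\<lambda>x. f (Complex x y)"] contline S one M)
          (use that ab in \<open>auto simp: in_cbox_complex_iff\<close>)
      moreover have "norm (LINT x|lborel. ?d n b x *\<^sub>R f (Complex x y)) \<le> M"
        by (intro integral_approx_delta(2)[where F="\<lambda>x. f (Complex x y)"] contline S one M)
          (use that ab in \<open>auto simp: in_cbox_complex_iff\<close>)
      ultimately show ?thesis unfolding \<Phi>eq using that norm_triangle_ineq4 by (smt (verit))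
    qed
    have Lint: "integrable lborel (\<lambda>z. (bn' a b n (Re z) * bn c d n (Im z)) *\<^sub>R f z)" for n
    proof -
      have c1: "continuous_on UNIV (bn c d n)" by (rule smooth_real_continuous[OF smb])
      have c2: "continuous_on UNIV (bn' a b n)" unfolding bn'_def
        by (intro continuous_intros cont\<eta>)
      have "continuous_on ?K (\<lambda>z. bn' a b n (Re z))" "continuous_on ?K (\<lambda>z. bn c d n (Im z))"
        by (auto intro!: continuous_on_compose2[OF c1] continuous_on_compose2[OF c2] continuous_intros)
      then have "set_integrable lborel ?K (\<lambda>z. (bn' a b n (Re z) * bn c d n (Im z)) *\<^sub>R f z)"
        unfolding set_integrable_def
        by (intro borel_integrable_compact continuous_intros continuous_on_subset[OF contf]) auto
      moreover have "indicator ?K z *\<^sub>R (bn' a b n (Re z) * bn c d n (Im z)) *\<^sub>R f z =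
          (bn' a b n (Re z) * bn c d n (Im z)) *\<^sub>R f z" for z
      proof (cases "z \<in> ?K")
        case False
        then have "Re z \<notin> {a..b+1} \<or> Im z \<notin> {c..d+1}" by (auto simp: in_cbox_complex_iff)
        then show ?thesis
        proof
          assume "Re z \<notin> {a..b+1}"
          then have "bn' a b n (Re z) = 0" using dz[of "Re z" a n] dz[of "Re z" b n] ab unfolding bn'_def by auto
          then show ?thesis by simp
        qed (simp add: bn_z[OF cd])
      qed auto
      ultimately show ?thesis unfolding set_integrable_def by (simp only:)
    qed
    have Leq: "?L n = (LINT y|lborel. bn c d n y *\<^sub>R ?\<Phi> n y)" for n
    proof -
      have "(LINT x|lborel. (bn' a b n x * k) *\<^sub>R f (Complex x y)) = k *\<^sub>R ?\<Phi> n y" for k y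
        by (subst integral_scaleR_right[symmetric]) (simp add: mult.commute)
      then show ?thesis unfolding integral_complex(1)[OF Lint] by simp
    qed
    have L: "?L \<longlonglongrightarrow> (LINT y|lborel. indicator {c<..d} y *\<^sub>R (f (Complex a y) - f (Complex b y)))"
      unfolding Leq
    proof (rule integral_dominated_convergence[where w="\<lambda>y. indicator {c..d+1} y * (2 * M)"])
      show "integrable lborel (\<lambda>y. indicator {c..d + 1} y * (2 * M))" by (auto intro!: integrable_mult_left integrable_real_indicator simp: emeasure_lborel_Icc_eq)
      show "AE y in lborel. (\<lambda>n. bn c d n y *\<^sub>R ?\<Phi> n y) \<longlonglongrightarrow> indicator {c<..d} y *\<^sub>R (f (Complex a y) - f (Complex b y))"
        by (intro AE_I2 tendsto_scaleR bn_lim[OF cd] \<Phi>lim)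
      show "AE y in lborel. norm (bn c d n y *\<^sub>R ?\<Phi> n y) \<le> indicator {c..d + 1} y * (2 * M)" for n
      proof (intro AE_I2)
        fix y
        show "norm (bn c d n y *\<^sub>R ?\<Phi> n y) \<le> indicator {c..d + 1} y * (2 * M)"
        proof (cases "y \<in> {c..d+1}")
          case True
          have "\<bar>bn c d n y\<bar> * norm (?\<Phi> n y) \<le> 1 * (2 * M)"
            using \<Phi>b[OF True, of n] bn_le[OF cd, of n y] True ab by (intro mult_mono) auto
          then show ?thesis using True by simp
        qed (simp add: bn_z[OF cd])
      qed
      show "(\<lambda>y. indicator {c<..d} y *\<^sub>R (f (Complex a y) - f (Complex b y))) \<in> borel_measurable lborel" by measurable
      show "(\<lambda>y. bn c d n y *\<^sub>R ?\<Phi> n y) \<in> borel_measurable lborel" for n by measurable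
    qed
    have "(LINT y|lborel. indicator {c<..d} y *\<^sub>R (f (Complex a y) - f (Complex b y))) = - (LINT z|lborel. R c d z *\<^sub>R g z)"
      using LIMSEQ_unique[OF L] tendsto_minus[OF R] LR by simp
    also have "(LINT z|lborel. R c d z *\<^sub>R g z) = (LINT y|lborel. indicator {c<..d} y *\<^sub>R (LINT x:{a<..b}|lborel. g (Complex x y)))"
      by (subst integral_complex(1)[OF gR]) (simp add: inner)
    finally have *: "(LINT y|lborel. indicator {c<..d} y *\<^sub>R (f (Complex a y) - f (Complex b y))) =
       - (LINT y|lborel. indicator {c<..d} y *\<^sub>R (LINT x:{a<..b}|lborel. g (Complex x y)))" .
    have fint': "set_integrable lborel {c<..d} (\<lambda>y. f (Complex b y) - f (Complex a y))"
      by (rule set_integrable_subset[OF fint[of c d]]) auto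
    have "(LINT y:{c<..d}|lborel. D y) = (LINT y:{c<..d}|lborel. f (Complex b y) - f (Complex a y))
        - (LINT y:{c<..d}|lborel. (LINT x:{a<..b}|lborel. g (Complex x y)))"
      unfolding D_def by (intro set_integral_diff fint' Gint)
    also have "(LINT y:{c<..d}|lborel. f (Complex b y) - f (Complex a y)) =
       - (LINT y|lborel. indicator {c<..d} y *\<^sub>R (f (Complex a y) - f (Complex b y)))"
      unfolding set_lebesgue_integral_def
      by (subst integral_minus[symmetric]) (auto simp: algebra_simps intro!: Bochner_Integration.integral_cong)
    also have "\<dots> - (LINT y:{c<..d}|lborel. (LINT x:{a<..b}|lborel. g (Complex x y))) = 0"
      unfolding * by (simp add: set_lebesgue_integral_def)
    finally show ?thesis .
  qed
  then have "AE y in lborel. D y = 0" by (intro AE_zero_of_integrals_zero Dint)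
  then show ?thesis by eventually_elim (simp add: D_def)
qed

text \<open>One null set of heights serves all endpoints: rational endpoints are treated
  simultaneously, and continuity of \<open>f\<close> extends the bound to real ones. With \<gamma> =
  0 this is the usual bound of an increment; with \<gamma> the value of \<open>g\<close> at a
  Lebesgue point it measures the deviation from a linear map.\<close>

lemma weak_x_acl:
  assumes w: "weak_x f g"
  shows "AE y in lborel. \<forall>a b \<gamma>. a \<le> b \<longrightarrow>
    ennreal (norm (f (Complex b y) - f (Complex a y) - (b - a) *\<^sub>R \<gamma>))
      \<le> (\<integral>\<^sup>+x\<in>{a..b}. ennreal (norm (g (Complex x y) - \<gamma>)) \<partial>lborel)"
proof -
  have contf: "continuous_on UNIV f" and gm[measurable]: "g \<in> borel_measurable borel"
    and gi: "\<And>a b. set_integrable lborel (cbox a b) g" using w by (auto simp: weak_x_def)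
  have "AE y in lborel. \<forall>a\<in>\<rat>. \<forall>b\<in>\<rat>. a < b \<longrightarrow>
      f (Complex b y) - f (Complex a y) = (LINT x:{a<..b}|lborel. g (Complex x y))"
    using weak_x_lines_rat[OF w] by (auto simp: AE_ball_countable countable_rat)
  moreover have "AE y in lborel. \<forall>n::nat. integrable lborel
      (\<lambda>x. indicator (cbox (Complex (- real n) (- real n)) (Complex (real n) (real n))) (Complex x y) *\<^sub>R g (Complex x y))"
    using integral_complex(3)[OF gi[unfolded set_integrable_def]] by (subst AE_all_countable) blast
  ultimately show ?thesis
  proof eventually_elim
    case (elim y)
    have si: "set_integrable lborel {a<..b} (\<lambda>x. g (Complex x y))" for a b
    proof -
      obtain n :: nat where n: "real n \<ge> max \<bar>y\<bar> (max \<bar>a\<bar> \<bar>b\<bar>)" using real_arch_simple by blast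
      have "integrable lborel (\<lambda>x. indicator (cbox (Complex (- real n) (- real n)) (Complex (real n) (real n))) (Complex x y) *\<^sub>R g (Complex x y))"
        using elim(2) by blast
      then show ?thesis unfolding set_integrable_def
        by (rule Bochner_Integration.integrable_bound)
          (use n in \<open>auto simp: indicator_def in_cbox_complex_iff\<close>)
    qed
    have rat: "ennreal (norm (f (Complex b y) - f (Complex a y) - (b - a) *\<^sub>R \<gamma>))
      \<le> (\<integral>\<^sup>+x\<in>{a..b}. ennreal (norm (g (Complex x y) - \<gamma>)) \<partial>lborel)"
      if ab: "a \<in> \<rat>" "b \<in> \<rat>" "a < b" for a b \<gamma>
    proof -
      have ci: "set_integrable lborel {a<..b} (\<lambda>x. \<gamma>)" "(LINT x:{a<..b}|lborel. \<gamma>) = (b - a) *\<^sub>R \<gamma>"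
        using ab by (auto simp: set_integrable_def set_lebesgue_integral_def intro!: integrable_scaleR_left integrable_real_indicator)
      have "f (Complex b y) - f (Complex a y) - (b - a) *\<^sub>R \<gamma> = (LINT x:{a<..b}|lborel. g (Complex x y)) - (LINT x:{a<..b}|lborel. \<gamma>)"
        using elim(1) ab ci by auto
      also have "\<dots> = (LINT x:{a<..b}|lborel. g (Complex x y) - \<gamma>)"
        by (intro set_integral_diff(2)[symmetric] si ci)
      finally have eq: "f (Complex b y) - f (Complex a y) - (b - a) *\<^sub>R \<gamma> = (LINT x:{a<..b}|lborel. g (Complex x y) - \<gamma>)" .
      have "ennreal (norm (LINT x:{a<..b}|lborel. g (Complex x y) - \<gamma>))
         \<le> (\<integral>\<^sup>+x. ennreal (norm (indicator {a<..b} x *\<^sub>R (g (Complex x y) - \<gamma>))) \<partial>lborel)"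
        unfolding set_lebesgue_integral_def
        by (rule integral_norm_bound_ennreal) (use set_integral_diff(1)[OF si ci(1)] in \<open>simp add: set_integrable_def\<close>)
      also have "\<dots> \<le> (\<integral>\<^sup>+x\<in>{a..b}. ennreal (norm (g (Complex x y) - \<gamma>)) \<partial>lborel)"
        by (intro nn_integral_mono) (auto simp: indicator_def)
      finally show ?thesis unfolding eq .
    qed
    have contline: "continuous_on UNIV (\<lambda>x. f (Complex x y))"
      unfolding Complex_eq by (intro continuous_on_compose2[OF contf] continuous_intros; simp)
    show ?case
    proof (intro allI impI)
      fix a b :: real and \<gamma> assume "a \<le> b"
      show "ennreal (norm (f (Complex b y) - f (Complex a y) - (b - a) *\<^sub>R \<gamma>))
        \<le> (\<integral>\<^sup>+x\<in>{a..b}. ennreal (norm (g (Complex x y) - \<gamma>)) \<partial>lborel)"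
      proof (cases "a = b")
        case True then show ?thesis by simp
      next
        case False
        then have ab: "a < b" using \<open>a \<le> b\<close> by simp
        \<comment> \<open>Half the length, so that the rational points approaching \<open>a\<close>
          from the right and \<open>b\<close> from the left never cross. They stay inside
          \<open>{a..b}\<close>, hence their integrals are dominated by the one over the full
          interval.\<close>
        define h where "h = (b - a) / 2"
        have h: "h > 0" using ab by (simp add: h_def)
        have "\<forall>n. \<exists>q\<in>\<rat>. a < q \<and> q < a + h / real (Suc n)"
          using Rats_dense_in_real h by simp
        then obtain p where p: "\<And>n. p n \<in> \<rat>" "\<And>n. a < p n" "\<And>n. p n < a + h / real (Suc n)" by metis
        have "\<forall>n. \<exists>q\<in>\<rat>. b - h / real (Suc n) < q \<and> q < b"
          using Rats_dense_in_real h by simp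
        then obtain q where q: "\<And>n. q n \<in> \<rat>" "\<And>n. q n < b" "\<And>n. b - h / real (Suc n) < q n" by metis
        have l: "(\<lambda>n. h / real (Suc n)) \<longlonglongrightarrow> 0"
          using tendsto_mult[OF tendsto_const[of h] LIMSEQ_inverse_real_of_nat] by (simp add: divide_inverse)
        have pl: "p \<longlonglongrightarrow> a"
          by (rule tendsto_sandwich[OF _ _ tendsto_const[of a], where h="\<lambda>n. a + h / real (Suc n)"])
            (use p tendsto_add[OF tendsto_const[of a] l] in \<open>auto intro!: always_eventually less_imp_le simp del: of_nat_Suc\<close>)
        have ql: "q \<longlonglongrightarrow> b"
          by (rule tendsto_sandwich[OF _ _ _ tendsto_const[of b], where f="\<lambda>n. b - h / real (Suc n)"])
            (use q tendsto_diff[OF tendsto_const[of b] l] in \<open>auto intro!: always_eventually less_imp_le simp del: of_nat_Suc\<close>)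
        have pq: "p n < q n" for n
        proof -
          have "h / real (Suc n) \<le> h" using h by (simp add: field_simps)
          then have "p n < a + h" "b - h < q n" using p(3)[of n] q(3)[of n] by linarith+
          then show ?thesis by (simp add: h_def field_simps)
        qed
        have fl: "(\<lambda>n. f (Complex (u n) y)) \<longlonglongrightarrow> f (Complex v y)" if "u \<longlonglongrightarrow> v" for u v
          by (rule continuous_on_tendsto_compose[OF contline that]) auto
        have lim: "(\<lambda>n. ennreal (norm (f (Complex (q n) y) - f (Complex (p n) y) - (q n - p n) *\<^sub>R \<gamma>)))
          \<longlonglongrightarrow> ennreal (norm (f (Complex b y) - f (Complex a y) - (b - a) *\<^sub>R \<gamma>))"
          by (intro tendsto_ennrealI tendsto_intros fl pl ql)
        show ?thesis
        proof (rule LIMSEQ_le_const2[OF lim], intro exI allI impI)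
          fix n
          have "ennreal (norm (f (Complex (q n) y) - f (Complex (p n) y) - (q n - p n) *\<^sub>R \<gamma>))
             \<le> (\<integral>\<^sup>+x\<in>{p n..q n}. ennreal (norm (g (Complex x y) - \<gamma>)) \<partial>lborel)"
            by (rule rat[OF p(1) q(1) pq])
          also have "\<dots> \<le> (\<integral>\<^sup>+x\<in>{a..b}. ennreal (norm (g (Complex x y) - \<gamma>)) \<partial>lborel)"
          proof (intro nn_integral_mono mult_left_mono)
            fix x
            show "indicator {p n..q n} x \<le> (indicator {a..b} x :: ennreal)"
              using p(2)[of n] q(2)[of n] by (auto simp: indicator_def)
          qed simp
          finally show "ennreal (norm (f (Complex (q n) y) - f (Complex (p n) y) - (q n - p n) *\<^sub>R \<gamma>))
             \<le> (\<integral>\<^sup>+x\<in>{a..b}. ennreal (norm (g (Complex x y) - \<gamma>)) \<partial>lborel)" .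
        qed
      qed
    qed
  qed
qed

section \<open>Borel representatives of the weak derivatives\<close>

lemma locally_integrable_borel_measurable:
  assumes "locally_integrable UNIV g"
  shows "g \<in> borel_measurable lebesgue"
proof (rule borel_measurable_LIMSEQ_metric)
  fix n :: nat
  have "g absolutely_integrable_on cball 0 (real n)" using assms by (auto simp: locally_integrable_def)
  then show "(\<lambda>z. indicator (cball 0 (real n)) z *\<^sub>R g z) \<in> borel_measurable lebesgue"
    by (simp add: set_integrable_def borel_measurable_integrable)
next
  fix z :: complex
  obtain N :: nat where N: "norm z \<le> real N" using real_arch_simple by blast
  have "eventually (\<lambda>n. indicator (cball 0 (real n)) z *\<^sub>R g z = g z) sequentially"
    unfolding eventually_sequentially using N by (auto intro!: exI[of _ N] simp: indicator_def)
  then show "(\<lambda>n. indicator (cball 0 (real n)) z *\<^sub>R g z) \<longlonglongrightarrow> g z"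
    by (rule tendsto_eventually)
qed

lemma borel_representative:
  fixes g0 :: "complex \<Rightarrow> complex"
  assumes "g0 \<in> borel_measurable lebesgue"
  obtains g where "g \<in> borel_measurable borel" "AE z in lborel. g0 z = g z"
proof -
  have "(\<lambda>z. Re (g0 z)) \<in> borel_measurable lebesgue" "(\<lambda>z. Im (g0 z)) \<in> borel_measurable lebesgue"
    using assms by measurable
  then obtain u v where u: "u \<in> borel_measurable lborel" "AE z in lborel. Re (g0 z) = u z"
    and v: "v \<in> borel_measurable lborel" "AE z in lborel. Im (g0 z) = v z"
    using completion_ex_borel_measurable_real[of "\<lambda>z. Re (g0 z)" lborel]
      completion_ex_borel_measurable_real[of "\<lambda>z. Im (g0 z)" lborel] by blast
  have "AE z in lborel. g0 z = Complex (u z) (v z)"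
    using u(2) v(2) by eventually_elim (simp add: complex_eq_iff)
  then show ?thesis using u(1) v(1) by (intro that[of "\<lambda>z. Complex (u z) (v z)"]) auto
qed

text \<open>A weak derivative is only Lebesgue measurable, whereas slicing along lines calls for
  Borel functions. Replacing it by a Borel function equal almost everywhere changes none of the
  integrals, and the completed measure can then be traded for \<open>lborel\<close>.\<close>

lemma weak_deriv_borel:
  assumes contf: "continuous_on UNIV f" and w: "has_weak_deriv UNIV f v g0"
  obtains g where "g \<in> borel_measurable borel" "AE z in lborel. g0 z = g z"
    "\<And>a b. set_integrable lborel (cbox a b) g"
    "\<And>\<phi> \<phi>'. test_fun UNIV \<phi> \<Longrightarrow> (\<And>z. frechet_derivative \<phi> (at z) v = \<phi>' z) \<Longrightarrow> \<phi> \<in> borel_measurable borel \<Longrightarrow>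
      \<phi>' \<in> borel_measurable borel \<Longrightarrow> (LINT z|lborel. \<phi>' z *\<^sub>R f z) = - (LINT z|lborel. \<phi> z *\<^sub>R g z)"
proof -
  have [measurable]: "f \<in> borel_measurable borel" using contf by (rule borel_measurable_continuous_onI)
  have li: "locally_integrable UNIV g0" using w by (simp add: has_weak_deriv_def)
  have g0m[measurable]: "g0 \<in> borel_measurable lebesgue" by (rule locally_integrable_borel_measurable[OF li])
  obtain g where g[measurable]: "g \<in> borel_measurable borel" and gg0: "AE z in lborel. g0 z = g z"
    using borel_representative[OF g0m] .
  have gg0': "AE z in lebesgue. g0 z = g z" using gg0 by (rule AE_completion)
  have gl[measurable]: "g \<in> borel_measurable lebesgue" by (rule measurable_completion) simp
  show ?thesis
  proof (rule that[OF g gg0])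
    fix a b
    have "integrable lebesgue (\<lambda>z. indicator (cbox a b) z *\<^sub>R g0 z)"
      using li by (auto simp: locally_integrable_def set_integrable_def)
    then have "integrable lebesgue (\<lambda>z. indicator (cbox a b) z *\<^sub>R g z)"
    proof (rule integrable_cong_AE_imp)
      show "AE z in lebesgue. indicator (cbox a b) z *\<^sub>R g0 z = indicator (cbox a b) z *\<^sub>R g z"
        using gg0' by eventually_elim simp
      show "(\<lambda>z. indicator (cbox a b) z *\<^sub>R g z) \<in> borel_measurable lebesgue"
        by (intro borel_measurable_scaleR gl borel_measurable_indicator) simp
    qed
    then show "set_integrable lborel (cbox a b) g"
      unfolding set_integrable_def by (subst (asm) integrable_completion) auto
  next
    fix \<phi> \<phi>' assume t: "test_fun UNIV \<phi>" "\<And>z. frechet_derivative \<phi> (at z) v = \<phi>' z"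
      and [measurable]: "\<phi> \<in> borel_measurable borel" "\<phi>' \<in> borel_measurable borel"
    have "(LINT z|lborel. \<phi>' z *\<^sub>R f z) = (LINT z|lebesgue. \<phi>' z *\<^sub>R f z)"
      by (rule integral_completion[symmetric]) simp
    also have "\<dots> = - (LINT z|lebesgue. \<phi> z *\<^sub>R g0 z)"
    proof -
      have "(LINT z|lebesgue. frechet_derivative \<phi> (at z) v *\<^sub>R f z) = - (LINT z|lebesgue. \<phi> z *\<^sub>R g0 z)"
        using w t(1) unfolding has_weak_deriv_def by blast
      then show ?thesis unfolding t(2) .
    qed
    also have "(LINT z|lebesgue. \<phi> z *\<^sub>R g0 z) = (LINT z|lebesgue. \<phi> z *\<^sub>R g z)"
    proof (rule integral_cong_AE)
      have [measurable]: "\<phi> \<in> borel_measurable lebesgue" by (rule measurable_completion) simp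
      show "(\<lambda>z. \<phi> z *\<^sub>R g0 z) \<in> borel_measurable lebesgue" "(\<lambda>z. \<phi> z *\<^sub>R g z) \<in> borel_measurable lebesgue"
        by measurable
      show "AE z in lebesgue. \<phi> z *\<^sub>R g0 z = \<phi> z *\<^sub>R g z" using gg0' by eventually_elim simp
    qed
    also have "\<dots> = (LINT z|lborel. \<phi> z *\<^sub>R g z)"
      by (rule integral_completion) simp
    finally show "(LINT z|lborel. \<phi>' z *\<^sub>R f z) = - (LINT z|lborel. \<phi> z *\<^sub>R g z)" .
  qed
qed

lemma weak_x_of_weak_deriv:
  assumes contf: "continuous_on UNIV f" and w: "has_weak_deriv UNIV f 1 g0"
  obtains g where "weak_x f g" "AE z in lborel. g0 z = g z"
proof -
  obtain g where g: "g \<in> borel_measurable borel" "AE z in lborel. g0 z = g z"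
    "\<And>a b. set_integrable lborel (cbox a b) g"
    "\<And>\<phi> \<phi>'. test_fun UNIV \<phi> \<Longrightarrow> (\<And>z. frechet_derivative \<phi> (at z) 1 = \<phi>' z) \<Longrightarrow> \<phi> \<in> borel_measurable borel \<Longrightarrow>
      \<phi>' \<in> borel_measurable borel \<Longrightarrow> (LINT z|lborel. \<phi>' z *\<^sub>R f z) = - (LINT z|lborel. \<phi> z *\<^sub>R g z)"
    by (rule weak_deriv_borel[OF assms]) blast
  have "weak_x f g"
    unfolding weak_x_def
  proof (intro conjI allI impI contf g(1) g(3))
    fix b b' c :: "real \<Rightarrow> real" and l u l' u'
    assume sm: "smooth_real b" "smooth_real c" and d: "\<forall>x. (b has_real_derivative b' x) (at x)"
      and z: "\<forall>x. x \<notin> {l..u} \<longrightarrow> b x = 0" "\<forall>x. x \<notin> {l'..u'} \<longrightarrow> c x = 0"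
    obtain c' where c': "\<And>x. (c has_real_derivative c' x) (at x)" using smooth_real_has_deriv[OF sm(2)] by blast
    have sb': "smooth_real b'" using smooth_real_deriv[OF sm(1)] d by blast
    note [measurable] = sm[THEN smooth_real_measurable] smooth_real_measurable[OF sb']
    show "(LINT z|lborel. (b' (Re z) * c (Im z)) *\<^sub>R f z) = - (LINT z|lborel. (b (Re z) * c (Im z)) *\<^sub>R g z)"
    proof (rule g(4))
      show "test_fun UNIV (\<lambda>z. b (Re z) * c (Im z))"
        using test_fun_tensor[OF sm] z by blast
      show "frechet_derivative (\<lambda>z. b (Re z) * c (Im z)) (at z) 1 = b' (Re z) * c (Im z)" for z
        using frechet_derivative_at[OF has_derivative_tensor[OF d[rule_format] c', of z], symmetric] by simp
    qed measurable
  qed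
  then show ?thesis using that g(2) by blast
qed

text \<open>The factors of the test function exchange their roles under \<open>flip\<close>: the one
  that gets differentiated depends on Im z before the reflection and on Re z after it.\<close>

lemma weak_y_of_weak_deriv:
  assumes contf: "continuous_on UNIV f" and w: "has_weak_deriv UNIV f \<i> g0"
  obtains g where "weak_x (\<lambda>z. f (flip z)) (\<lambda>z. g (flip z))" "g \<in> borel_measurable borel"
    "AE z in lborel. g0 z = g z" "\<And>a b. set_integrable lborel (cbox a b) g"
proof -
  obtain g where g: "g \<in> borel_measurable borel" "AE z in lborel. g0 z = g z"
    "\<And>a b. set_integrable lborel (cbox a b) g"
    "\<And>\<phi> \<phi>'. test_fun UNIV \<phi> \<Longrightarrow> (\<And>z. frechet_derivative \<phi> (at z) \<i> = \<phi>' z) \<Longrightarrow> \<phi> \<in> borel_measurable borel \<Longrightarrow>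
      \<phi>' \<in> borel_measurable borel \<Longrightarrow> (LINT z|lborel. \<phi>' z *\<^sub>R f z) = - (LINT z|lborel. \<phi> z *\<^sub>R g z)"
    by (rule weak_deriv_borel[OF assms]) blast
  note [measurable] = g(1) borel_measurable_continuous_onI[OF contf]
  have "weak_x (\<lambda>z. f (flip z)) (\<lambda>z. g (flip z))"
    unfolding weak_x_def
  proof (intro conjI allI impI)
    show "continuous_on UNIV (\<lambda>z. f (flip z))"
      by (intro continuous_on_compose2[OF contf] continuous_intros) auto
    show "(\<lambda>z. g (flip z)) \<in> borel_measurable borel" by measurable
    show "set_integrable lborel (cbox a b) (\<lambda>z. g (flip z))" for a b
    proof -
      have "indicator (cbox (flip a) (flip b)) (flip z) *\<^sub>R g (flip z) = indicator (cbox a b) z *\<^sub>R g (flip z)" for z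
        by (auto simp: indicator_def in_cbox_complex_iff)
      then show ?thesis
        using integrable_flip[OF g(3)[unfolded set_integrable_def, of "flip a" "flip b"]]
        unfolding set_integrable_def by (simp only:)
    qed
    fix b b' c :: "real \<Rightarrow> real" and l u l' u'
    assume sm: "smooth_real b" "smooth_real c" and d: "\<forall>x. (b has_real_derivative b' x) (at x)"
      and z: "\<forall>x. x \<notin> {l..u} \<longrightarrow> b x = 0" "\<forall>x. x \<notin> {l'..u'} \<longrightarrow> c x = 0"
    obtain c' where c': "\<And>x. (c has_real_derivative c' x) (at x)" using smooth_real_has_deriv[OF sm(2)] by blast
    have sb': "smooth_real b'" using smooth_real_deriv[OF sm(1)] d by blast
    note [measurable] = sm[THEN smooth_real_measurable] smooth_real_measurable[OF sb']
    have "(LINT z|lborel. (c (Re z) * b' (Im z)) *\<^sub>R f z) = - (LINT z|lborel. (c (Re z) * b (Im z)) *\<^sub>R g z)"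
    proof (rule g(4))
      show "test_fun UNIV (\<lambda>z. c (Re z) * b (Im z))"
        using test_fun_tensor[OF sm(2,1)] z by blast
      show "frechet_derivative (\<lambda>z. c (Re z) * b (Im z)) (at z) \<i> = c (Re z) * b' (Im z)" for z
        using frechet_derivative_at[OF has_derivative_tensor[OF c' d[rule_format], of z], symmetric] by simp
    qed measurable
    then have "(LINT z|lborel. (c (Re (flip z)) * b' (Im (flip z))) *\<^sub>R f (flip z)) = - (LINT z|lborel. (c (Re (flip z)) * b (Im (flip z))) *\<^sub>R g (flip z))"
      by (subst integral_flip, measurable, subst integral_flip, measurable)
    then show "(LINT z|lborel. (b' (Re z) * c (Im z)) *\<^sub>R f (flip z)) = - (LINT z|lborel. (b (Re z) * c (Im z)) *\<^sub>R g (flip z))"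
      by (simp add: mult.commute)
  qed
  then show ?thesis using that g by blast
qed

section \<open>Squares and the maximum principle\<close>

text \<open>Balls of the maximum norm, with half-side t. Squares rather than discs, because their
  boundaries consist of coordinate segments, to which absolute continuity on lines applies.\<close>

definition sq :: "complex \<Rightarrow> real \<Rightarrow> complex set" where
  "sq z t = {w. \<bar>Re w - Re z\<bar> \<le> t \<and> \<bar>Im w - Im z\<bar> \<le> t}"

definition sq_bd :: "complex \<Rightarrow> real \<Rightarrow> complex set" where
  "sq_bd z t = {w. \<bar>Re w - Re z\<bar> \<le> t \<and> \<bar>Im w - Im z\<bar> = t \<or> \<bar>Re w - Re z\<bar> = t \<and> \<bar>Im w - Im z\<bar> \<le> t}"

lemma sq_bd_subset: "sq_bd z t \<subseteq> sq z t"
  by (auto simp: sq_def sq_bd_def)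

lemma sq_eq_cbox: "sq z t = cbox (z - Complex t t) (z + Complex t t)"
  by (auto simp: sq_def in_cbox_complex_iff)

lemma compact_sq: "compact (sq z t)" by (simp add: sq_eq_cbox)

lemma sq_borel[measurable]: "sq z t \<in> sets borel" by (simp add: sq_eq_cbox)

text \<open>An upper gradient inequality on horizontal segments inside \<open>U\<close>, with a
  single null set of heights for all segments. The values in \<open>ennreal\<close> make
  integrability along a line unnecessary; the general codomain covers both the complex map and the
  real coordinates of its logarithm.\<close>

definition h_bound :: "complex set \<Rightarrow> (complex \<Rightarrow> 'a::real_normed_vector) \<Rightarrow> (complex \<Rightarrow> ennreal) \<Rightarrow> bool" where
  "h_bound U v h \<longleftrightarrow> h \<in> borel_measurable borel \<and>
    (AE y in lborel. \<forall>a b. a \<le> b \<longrightarrow> (\<forall>x\<in>{a..b}. Complex x y \<in> U) \<longrightarrow>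
       ennreal (norm (v (Complex b y) - v (Complex a y))) \<le> (\<integral>\<^sup>+x\<in>{a..b}. h (Complex x y) \<partial>lborel))"

definition acl_bound :: "complex set \<Rightarrow> (complex \<Rightarrow> 'a::real_normed_vector) \<Rightarrow> (complex \<Rightarrow> ennreal) \<Rightarrow> bool" where
  "acl_bound U v h \<longleftrightarrow> h_bound U v h \<and> h_bound (flip -` U) (\<lambda>z. v (flip z)) (\<lambda>z. h (flip z))"

lemma acl_bound_measurable: "acl_bound U v h \<Longrightarrow> h \<in> borel_measurable borel"
  by (simp add: acl_bound_def h_bound_def)

lemma h_bound_line:
  assumes "h_bound U v h"
  shows "AE y in lborel. \<forall>J\<ge>0. (\<forall>x\<in>{A..B}. Complex x y \<in> U) \<longrightarrow> (\<integral>\<^sup>+x\<in>{A..B}. h (Complex x y) \<partial>lborel) \<le> ennreal J \<longrightarrow>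
    (\<forall>a\<in>{A..B}. \<forall>b\<in>{A..B}. norm (v (Complex b y) - v (Complex a y)) \<le> J)"
  using assms[unfolded h_bound_def, THEN conjunct2]
proof eventually_elim
  case (elim y)
  show ?case
  proof (intro allI impI)
    fix J :: real assume J: "0 \<le> J" and U: "\<forall>x\<in>{A..B}. Complex x y \<in> U"
      and I: "(\<integral>\<^sup>+x\<in>{A..B}. h (Complex x y) \<partial>lborel) \<le> ennreal J"
    have "norm (v (Complex b y) - v (Complex a y)) \<le> J" if "a \<le> b" "a \<in> {A..B}" "b \<in> {A..B}" for a b
    proof -
      have "ennreal (norm (v (Complex b y) - v (Complex a y))) \<le> (\<integral>\<^sup>+x\<in>{a..b}. h (Complex x y) \<partial>lborel)"
        using elim that U by auto
      also have "\<dots> \<le> (\<integral>\<^sup>+x\<in>{A..B}. h (Complex x y) \<partial>lborel)"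
        by (intro nn_integral_mono mult_left_mono) (use that in \<open>auto simp: indicator_def\<close>)
      also note I
      finally show ?thesis using J by simp
    qed
    then show "\<forall>a\<in>{A..B}. \<forall>b\<in>{A..B}. norm (v (Complex b y) - v (Complex a y)) \<le> J"
      by (metis linear norm_minus_commute)
  qed
qed

lemma acl_bound_lines:
  assumes "acl_bound U v h"
  shows "AE y in lborel. \<forall>J\<ge>0. (\<forall>x\<in>{A..B}. Complex x y \<in> U) \<longrightarrow> (\<integral>\<^sup>+x\<in>{A..B}. h (Complex x y) \<partial>lborel) \<le> ennreal J \<longrightarrow>
      (\<forall>a\<in>{A..B}. \<forall>b\<in>{A..B}. norm (v (Complex b y) - v (Complex a y)) \<le> J)"
    and "AE x in lborel. \<forall>J\<ge>0. (\<forall>y\<in>{A..B}. Complex x y \<in> U) \<longrightarrow> (\<integral>\<^sup>+y\<in>{A..B}. h (Complex x y) \<partial>lborel) \<le> ennreal J \<longrightarrow>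
      (\<forall>a\<in>{A..B}. \<forall>b\<in>{A..B}. norm (v (Complex x b) - v (Complex x a)) \<le> J)"
  using h_bound_line[of U v h A B] h_bound_line[of "flip -` U" "\<lambda>z. v (flip z)" "\<lambda>z. h (flip z)" A B] assms
  by (simp_all add: acl_bound_def)

text \<open>\<open>P\<close> is arbitrary, so its exceptional set is first enclosed in a Borel null
  set, which may be pulled back by the affine map.\<close>

lemma AE_lborel_affine:
  fixes P :: "real \<Rightarrow> bool"
  assumes "AE x in lborel. P x" "c \<noteq> 0"
  shows "AE x in lborel. P (t + c * x)"
proof -
  obtain N where N: "\<And>x. x \<in> space lborel - N \<Longrightarrow> P x" "N \<in> null_sets lborel"
    by (rule AE_E3[OF assms(1)]) blast
  have "AE x in lborel. t + c * x \<notin> N"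
    by (rule AE_borel_affine[OF assms(2) _ AE_not_in[OF N(2)]]) (use N(2) in \<open>auto simp: null_sets_def\<close>)
  then show ?thesis by eventually_elim (use N(1) in auto)
qed

text \<open>Averaging: if \<open>S\<close> exceeded \<open>J\<close> at almost every point of the
  interval, its integral would be at least \<open>J * (\<beta> - \<alpha>)\<close>, which is more
  than \<open>I\<close>. Membership in a set of full measure can be demanded at the same
  time.\<close>

lemma ex_good_point:
  fixes S :: "real \<Rightarrow> ennreal"
  assumes [measurable]: "S \<in> borel_measurable borel" and P: "AE t in lborel. P t" and ab: "\<alpha> < \<beta>"
    and I: "(\<integral>\<^sup>+t\<in>{\<alpha>..\<beta>}. S t \<partial>lborel) \<le> ennreal I" and J: "I < J * (\<beta> - \<alpha>)" and I0: "0 \<le> I" and J0: "0 \<le> J"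
  obtains t where "\<alpha> < t" "t < \<beta>" "P t" "S t \<le> ennreal J"
proof -
  have "\<exists>t. \<alpha> < t \<and> t < \<beta> \<and> P t \<and> S t \<le> ennreal J"
  proof (rule ccontr)
  assume "\<not> ?thesis"
  then have n: "S t > ennreal J" if "\<alpha> < t" "t < \<beta>" "P t" for t using that by (meson not_le)
  have "ennreal (J * (\<beta> - \<alpha>)) = (\<integral>\<^sup>+t. ennreal J * indicator {\<alpha><..<\<beta>} t \<partial>lborel)"
    using ab J0 by (simp add: nn_integral_cmult_indicator ennreal_mult)
  also have "\<dots> \<le> (\<integral>\<^sup>+t\<in>{\<alpha>..\<beta>}. S t \<partial>lborel)"
  proof (rule nn_integral_mono_AE)
    show "AE t in lborel. ennreal J * indicator {\<alpha><..<\<beta>} t \<le> S t * indicator {\<alpha>..\<beta>} t"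
      using P by eventually_elim (auto simp: indicator_def intro: less_imp_le n)
  qed
  also have "\<dots> \<le> ennreal I" by (rule I)
  finally show False using J I0 by (simp add: ennreal_le_iff)
  qed
  then show ?thesis using that by blast
qed

lemma acl_bound_lines_measurable:
  assumes [measurable]: "h \<in> borel_measurable borel"
  shows "(\<lambda>y. \<integral>\<^sup>+x\<in>{a..b}. h (Complex x y) \<partial>lborel) \<in> borel_measurable borel"
    "(\<lambda>x. \<integral>\<^sup>+y\<in>{a..b}. h (Complex x y) \<partial>lborel) \<in> borel_measurable borel"
  by measurable

lemma nn_integral_box:
  assumes [measurable]: "h \<in> borel_measurable borel"
  shows "(\<integral>\<^sup>+y\<in>{c..d}. (\<integral>\<^sup>+x\<in>{a..b}. h (Complex x y) \<partial>lborel) \<partial>lborel) = (\<integral>\<^sup>+z\<in>cbox (Complex a c) (Complex b d). h z \<partial>lborel)"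
    "(\<integral>\<^sup>+x\<in>{a..b}. (\<integral>\<^sup>+y\<in>{c..d}. h (Complex x y) \<partial>lborel) \<partial>lborel) = (\<integral>\<^sup>+z\<in>cbox (Complex a c) (Complex b d). h z \<partial>lborel)"
proof -
  have i: "indicator (cbox (Complex a c) (Complex b d)) (Complex x y) = (indicator {a..b} x * indicator {c..d} y :: ennreal)" for x y
    by (auto simp: indicator_def in_cbox_complex_iff)
  have m: "(\<lambda>z. h z * indicator (cbox (Complex a c) (Complex b d)) z) \<in> borel_measurable borel" by measurable
  have c1: "(\<integral>\<^sup>+x. h (Complex x y) * (indicator {a..b} x * indicator {c..d} y) \<partial>lborel)
    = (\<integral>\<^sup>+x\<in>{a..b}. h (Complex x y) \<partial>lborel) * indicator {c..d} y" for y
    by (subst nn_integral_multc[symmetric]) (auto simp: mult.assoc)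
  have c2: "(\<integral>\<^sup>+y. h (Complex x y) * (indicator {a..b} x * indicator {c..d} y) \<partial>lborel)
    = (\<integral>\<^sup>+y\<in>{c..d}. h (Complex x y) \<partial>lborel) * indicator {a..b} x" for x
    by (subst nn_integral_multc[symmetric]) (auto simp: ac_simps)
  show "(\<integral>\<^sup>+y\<in>{c..d}. (\<integral>\<^sup>+x\<in>{a..b}. h (Complex x y) \<partial>lborel) \<partial>lborel) = (\<integral>\<^sup>+z\<in>cbox (Complex a c) (Complex b d). h z \<partial>lborel)"
    by (subst nn_integral_complex(1)[OF m]) (simp add: i c1)
  show "(\<integral>\<^sup>+x\<in>{a..b}. (\<integral>\<^sup>+y\<in>{c..d}. h (Complex x y) \<partial>lborel) \<partial>lborel) = (\<integral>\<^sup>+z\<in>cbox (Complex a c) (Complex b d). h z \<partial>lborel)"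
    by (subst nn_integral_complex(2)[OF m]) (simp add: i c2)
qed

lemma nn_integral_shift_le:
  fixes S :: "real \<Rightarrow> ennreal"
  assumes [measurable]: "S \<in> borel_measurable borel" and c: "c = 1 \<or> c = -1" and q: "0 \<le> q"
  shows "(\<integral>\<^sup>+t\<in>{q..2*q}. S (y + c * t) \<partial>lborel) \<le> (\<integral>\<^sup>+t\<in>{y-2*q..y+2*q}. S t \<partial>lborel)"
proof -
  have "(\<integral>\<^sup>+t\<in>{y-2*q..y+2*q}. S t \<partial>lborel) = (\<integral>\<^sup>+t. S (y + c * t) * indicator {y-2*q..y+2*q} (y + c * t) \<partial>lborel)"
    using c by (subst nn_integral_real_affine[where c=c and t=y]) auto
  also have "\<dots> \<ge> (\<integral>\<^sup>+t\<in>{q..2*q}. S (y + c * t) \<partial>lborel)"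
    by (intro nn_integral_mono mult_left_mono) (use c q in \<open>auto simp: indicator_def\<close>)
  finally show ?thesis .
qed

text \<open>As t runs through (q,2q), the lines carrying the four sides sweep parts of the large
  square, so the integral over t of the four line integrals together is at most 4 I. Some t
  therefore has all four at most \<open>J\<close>. Every boundary point reaches the lower left
  corner along at most two sides, which gives 2 J, and 4 J for two points.\<close>

lemma ex_good_square:
  fixes v :: "complex \<Rightarrow> 'a::real_normed_vector"
  assumes acl: "acl_bound U v h" and U: "sq z (2 * q) \<subseteq> U" and q: "q > 0"
    and I: "(\<integral>\<^sup>+w\<in>sq z (2 * q). h w \<partial>lborel) \<le> ennreal I" and J: "4 * I < J * q" and J0: "0 \<le> J" and I0: "0 \<le> I"
  obtains t where "q < t" "t < 2 * q" "\<And>w w'. w \<in> sq_bd z t \<Longrightarrow> w' \<in> sq_bd z t \<Longrightarrow> norm (v w - v w') \<le> 4 * J"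
proof -
  have hm[measurable]: "h \<in> borel_measurable borel" by (rule acl_bound_measurable[OF acl])
  define x0 y0 where "x0 = Re z" "y0 = Im z"
  note xy = x0_y0_def
  define X Y where "X = {x0-2*q..x0+2*q}" "Y = {y0-2*q..y0+2*q}"
  define H where "H = (\<lambda>y. \<integral>\<^sup>+x\<in>X. h (Complex x y) \<partial>lborel)"
  define V where "V = (\<lambda>x. \<integral>\<^sup>+y\<in>Y. h (Complex x y) \<partial>lborel)"
  have [measurable]: "H \<in> borel_measurable borel" "V \<in> borel_measurable borel"
    unfolding H_def V_def X_Y_def by (intro acl_bound_lines_measurable hm)+
  define PH where "PH = (\<lambda>y. \<forall>J\<ge>0. (\<forall>x\<in>X. Complex x y \<in> U) \<longrightarrow> H y \<le> ennreal J \<longrightarrow>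
    (\<forall>a\<in>X. \<forall>b\<in>X. norm (v (Complex b y) - v (Complex a y)) \<le> J))"
  define PV where "PV = (\<lambda>x. \<forall>J\<ge>0. (\<forall>y\<in>Y. Complex x y \<in> U) \<longrightarrow> V x \<le> ennreal J \<longrightarrow>
    (\<forall>a\<in>Y. \<forall>b\<in>Y. norm (v (Complex x b) - v (Complex x a)) \<le> J))"
  have AEH: "AE y in lborel. PH y" and AEV: "AE x in lborel. PV x"
    unfolding PH_def PV_def H_def V_def X_Y_def by (rule acl_bound_lines[OF acl])+
  have sqe: "cbox (Complex (x0-2*q) (y0-2*q)) (Complex (x0+2*q) (y0+2*q)) = sq z (2*q)"
    by (auto simp: sq_def in_cbox_complex_iff xy)
  have box: "(\<integral>\<^sup>+t\<in>Y. H t \<partial>lborel) \<le> ennreal I" "(\<integral>\<^sup>+t\<in>X. V t \<partial>lborel) \<le> ennreal I"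
    unfolding H_def V_def X_Y_def nn_integral_box[OF hm] sqe by (rule I)+
  have IH: "(\<integral>\<^sup>+t\<in>{q..2*q}. H (y0 + c * t) \<partial>lborel) \<le> ennreal I"
    and IV: "(\<integral>\<^sup>+t\<in>{q..2*q}. V (x0 + c * t) \<partial>lborel) \<le> ennreal I" if "c = 1 \<or> c = -1" for c
    using nn_integral_shift_le[of H c q y0] nn_integral_shift_le[of V c q x0] that q box
    unfolding X_Y_def by (auto intro: order_trans)
  \<comment> \<open>Adding the four line integrals makes one and the same t good for all four
    sides.\<close>
  define \<sigma> where "\<sigma> = (\<lambda>t. H (y0 + 1 * t) + H (y0 + (-1) * t) + V (x0 + 1 * t) + V (x0 + (-1) * t))"
  have [measurable]: "\<sigma> \<in> borel_measurable borel" unfolding \<sigma>_def by measurable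
  have I\<sigma>: "(\<integral>\<^sup>+t\<in>{q..2*q}. \<sigma> t \<partial>lborel) \<le> ennreal (4 * I)"
  proof -
    have "(\<integral>\<^sup>+t\<in>{q..2*q}. \<sigma> t \<partial>lborel) = (\<integral>\<^sup>+t\<in>{q..2*q}. H (y0 + 1 * t) \<partial>lborel) + (\<integral>\<^sup>+t\<in>{q..2*q}. H (y0 + (-1) * t) \<partial>lborel)
      + (\<integral>\<^sup>+t\<in>{q..2*q}. V (x0 + 1 * t) \<partial>lborel) + (\<integral>\<^sup>+t\<in>{q..2*q}. V (x0 + (-1) * t) \<partial>lborel)"
      unfolding \<sigma>_def by (simp add: nn_integral_add distrib_right)
    also have "\<dots> \<le> ennreal I + ennreal I + ennreal I + ennreal I"
      by (intro add_mono IH IV) auto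
    also have "\<dots> = ennreal (4 * I)" using I0 by (simp add: ennreal_plus[symmetric] del: ennreal_plus)
    finally show ?thesis .
  qed
  have "AE t in lborel. PH (y0 + 1 * t) \<and> PH (y0 + (-1) * t) \<and> PV (x0 + 1 * t) \<and> PV (x0 + (-1) * t)"
    by (intro AE_conjI AE_lborel_affine AEH AEV) auto
  then obtain t where t: "q < t" "t < 2 * q" and good: "PH (y0 + t)" "PH (y0 - t)" "PV (x0 + t)" "PV (x0 - t)"
    and st: "\<sigma> t \<le> ennreal J"
    by (rule ex_good_point[OF \<open>\<sigma> \<in> _\<close> _ _ I\<sigma>, of _ J]) (use q J J0 I0 in \<open>auto simp: algebra_simps\<close>)
  have HJ: "H (y0 + t) \<le> J" "H (y0 - t) \<le> J" "V (x0 + t) \<le> J" "V (x0 - t) \<le> J"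
    using st by (auto simp: \<sigma>_def intro: order_trans[rotated] add_increasing add_increasing2)
  have inU: "Complex x y \<in> U" if "x \<in> X" "y \<in> Y" for x y
  proof -
    have "Complex x y \<in> sq z (2 * q)" using that by (auto simp: sq_def xy X_Y_def)
    then show ?thesis using U by blast
  qed
  have tXY: "x0 + t \<in> X" "x0 - t \<in> X" "y0 + t \<in> Y" "y0 - t \<in> Y" using t q by (auto simp: X_Y_def)
  have hor: "norm (v (Complex b y) - v (Complex a y)) \<le> J"
    if "y = y0 + t \<or> y = y0 - t" "a \<in> {x0-t..x0+t}" "b \<in> {x0-t..x0+t}" for a b y
  proof -
    have "a \<in> X" "b \<in> X" using that t by (auto simp: X_Y_def)
    then show ?thesis using that(1) good HJ J0 inU tXY unfolding PH_def by blast
  qed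
  have ver: "norm (v (Complex x b) - v (Complex x a)) \<le> J"
    if "x = x0 + t \<or> x = x0 - t" "a \<in> {y0-t..y0+t}" "b \<in> {y0-t..y0+t}" for a b x
  proof -
    have "a \<in> Y" "b \<in> Y" using that t by (auto simp: X_Y_def)
    then show ?thesis using that(1) good HJ J0 inU tXY unfolding PV_def by blast
  qed
  have corner: "norm (v w - v (Complex (x0 - t) (y0 - t))) \<le> 2 * J" if w: "w \<in> sq_bd z t" for w
  proof -
    have wc: "w = Complex (Re w) (Im w)" by simp
    have range: "Re w \<in> {x0-t..x0+t}" "Im w \<in> {y0-t..y0+t}" using w by (auto simp: sq_bd_def xy)
    have cr: "x0 - t \<in> {x0-t..x0+t}" "y0 - t \<in> {y0-t..y0+t}" using t q by auto
    consider "Im w = y0 + t \<or> Im w = y0 - t" | "Re w = x0 + t \<or> Re w = x0 - t"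
      using w by (auto simp: sq_bd_def xy abs_if split: if_splits)
    then show ?thesis
    proof cases
      case 1
      have "norm (v w - v (Complex (x0 - t) (Im w))) \<le> J"
        using hor[OF 1 cr(1) range(1)] by simp
      moreover have "norm (v (Complex (x0 - t) (Im w)) - v (Complex (x0 - t) (y0 - t))) \<le> J"
        using ver[OF _ cr(2) range(2), of "x0 - t"] by simp
      ultimately show ?thesis using norm_diff_triangle_le by fastforce
    next
      case 2
      have "norm (v w - v (Complex (Re w) (y0 - t))) \<le> J"
        using ver[OF 2 cr(2) range(2)] by simp
      moreover have "norm (v (Complex (Re w) (y0 - t)) - v (Complex (x0 - t) (y0 - t))) \<le> J"
        using hor[OF _ cr(1) range(1), of "y0 - t"] by simp
      ultimately show ?thesis using norm_diff_triangle_le by fastforce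
    qed
  qed
  show ?thesis
  proof (rule that[OF t])
    fix w w' assume "w \<in> sq_bd z t" "w' \<in> sq_bd z t"
    then show "norm (v w - v w') \<le> 4 * J"
      using corner[of w] corner[of w'] norm_triangle_ineq4[of "v w - v (Complex (x0 - t) (y0 - t))" "v w' - v (Complex (x0 - t) (y0 - t))"]
      by simp
  qed
qed

lemma ex_good_line_h:
  fixes v :: "complex \<Rightarrow> 'a::real_normed_vector"
  assumes acl: "acl_bound UNIV v h" and ab: "\<alpha> < \<beta>"
    and I: "(\<integral>\<^sup>+w\<in>cbox (Complex A \<alpha>) (Complex B \<beta>). h w \<partial>lborel) \<le> ennreal I"
    and J: "I < J * (\<beta> - \<alpha>)" and J0: "0 \<le> J" and I0: "0 \<le> I"
  obtains y where "\<alpha> < y" "y < \<beta>"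
    "\<And>a b. a \<in> {A..B} \<Longrightarrow> b \<in> {A..B} \<Longrightarrow> norm (v (Complex b y) - v (Complex a y)) \<le> J"
proof (rule ex_good_point[OF acl_bound_lines_measurable(1) acl_bound_lines(1)[OF acl] ab _ J I0 J0, of h A B A B])
  show "h \<in> borel_measurable borel" by (rule acl_bound_measurable[OF acl])
  then show "(\<integral>\<^sup>+y\<in>{\<alpha>..\<beta>}. (\<integral>\<^sup>+x\<in>{A..B}. h (Complex x y) \<partial>lborel) \<partial>lborel) \<le> ennreal I"
    using I by (simp add: nn_integral_box)
qed (use that J0 in auto)

lemma ex_good_line_v:
  fixes v :: "complex \<Rightarrow> 'a::real_normed_vector"
  assumes acl: "acl_bound UNIV v h" and ab: "\<alpha> < \<beta>"
    and I: "(\<integral>\<^sup>+w\<in>cbox (Complex \<alpha> A) (Complex \<beta> B). h w \<partial>lborel) \<le> ennreal I"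
    and J: "I < J * (\<beta> - \<alpha>)" and J0: "0 \<le> J" and I0: "0 \<le> I"
  obtains x where "\<alpha> < x" "x < \<beta>"
    "\<And>a b. a \<in> {A..B} \<Longrightarrow> b \<in> {A..B} \<Longrightarrow> norm (v (Complex x b) - v (Complex x a)) \<le> J"
proof (rule ex_good_point[OF acl_bound_lines_measurable(2) acl_bound_lines(2)[OF acl] ab _ J I0 J0, of h A B A B])
  show "h \<in> borel_measurable borel" by (rule acl_bound_measurable[OF acl])
  then show "(\<integral>\<^sup>+x\<in>{\<alpha>..\<beta>}. (\<integral>\<^sup>+y\<in>{A..B}. h (Complex x y) \<partial>lborel) \<partial>lborel) \<le> ennreal I"
    using I by (simp add: nn_integral_box)
qed (use that J0 in auto)

text \<open>Monotonicity in the sense of Lebesgue, restricted to squares: values inside lie between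
  boundary values.\<close>

definition square_monotone :: "complex set \<Rightarrow> (complex \<Rightarrow> real) \<Rightarrow> bool" where
  "square_monotone U v \<longleftrightarrow> (\<forall>z t. 0 < t \<longrightarrow> sq z t \<subseteq> U \<longrightarrow>
     (\<forall>w\<in>sq z t. \<exists>w1\<in>sq_bd z t. \<exists>w2\<in>sq_bd z t. v w1 \<le> v w \<and> v w \<le> v w2))"

text \<open>The oscillation on the inner square is bounded by that on the boundary of a good square
  of half-side between q and 2 q. This is where monotonicity turns an estimate on almost all lines
  into one for arbitrary points.\<close>

lemma square_monotone_osc:
  fixes v :: "complex \<Rightarrow> real"
  assumes acl: "acl_bound (sq z (2 * q)) v h" and mono: "square_monotone (sq z (2 * q)) v" and q: "q > 0"
    and w: "w \<in> sq z q" "w' \<in> sq z q"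
  shows "ennreal (q * \<bar>v w - v w'\<bar>) \<le> 16 * (\<integral>\<^sup>+w\<in>sq z (2 * q). h w \<partial>lborel)"
proof (cases "(\<integral>\<^sup>+w\<in>sq z (2 * q). h w \<partial>lborel)")
  case (real I)
  have "q * \<bar>v w - v w'\<bar> \<le> 16 * I + e" if e: "e > 0" for e
  proof -
    \<comment> \<open>The selection of a good square needs the strict inequality 4 I < J q; the term
      e / 4 pays for it and contributes exactly e to 4 J q.\<close>
    define J where "J = (4 * I + e / 4) / q"
    have "4 * I < J * q" "0 \<le> J" using real e q by (auto simp: J_def field_simps)
    then obtain t where t: "q < t" "t < 2 * q"
      and osc: "\<And>w w'. w \<in> sq_bd z t \<Longrightarrow> w' \<in> sq_bd z t \<Longrightarrow> norm (v w - v w') \<le> 4 * J"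
      using ex_good_square[OF acl order_refl q, of I J] real by auto
    have "sq z t \<subseteq> sq z (2 * q)" "w \<in> sq z t" "w' \<in> sq z t" using t w by (auto simp: sq_def)
    then obtain a1 a2 b1 b2 where "a1 \<in> sq_bd z t" "a2 \<in> sq_bd z t" "v a1 \<le> v w" "v w \<le> v a2"
      "b1 \<in> sq_bd z t" "b2 \<in> sq_bd z t" "v b1 \<le> v w'" "v w' \<le> v b2"
      using mono t q unfolding square_monotone_def by (meson less_trans)
    then have "\<bar>v w - v w'\<bar> \<le> 4 * J" using osc[of a1 b2] osc[of a2 b1] by simp
    then have "q * \<bar>v w - v w'\<bar> \<le> q * (4 * J)" using q by simp
    also have "\<dots> = 16 * I + e" using q by (simp add: J_def)
    finally show ?thesis .
  qed
  then have "q * \<bar>v w - v w'\<bar> \<le> 16 * I" by (rule field_le_epsilon)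
  then have "ennreal (q * \<bar>v w - v w'\<bar>) \<le> ennreal (16 * I)" by (rule ennreal_leI)
  then show ?thesis using real by (simp add: ennreal_mult)
next
  case top
  then show ?thesis by (simp add: ennreal_mult_top)
qed

text \<open>An injective continuous map of a planar open set is open by invariance of domain. Were
  the maximum of Re(c \<Phi>) attained inside, the image would contain a disc around that value, and
  hence points where the functional is larger.\<close>

lemma injective_max_principle:
  fixes \<Phi> :: "complex \<Rightarrow> complex"
  assumes cont: "continuous_on (sq z t) \<Phi>" and inj: "inj_on \<Phi> (sq z t)" and t: "t > 0" and c: "c \<noteq> 0"
    and w: "w \<in> sq z t"
  obtains w2 where "w2 \<in> sq_bd z t" "Re (c * \<Phi> w) \<le> Re (c * \<Phi> w2)"
proof -
  have "continuous_on (sq z t) (\<lambda>w. Re (c * \<Phi> w))" by (intro continuous_intros cont)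
  then obtain w0 where w0: "w0 \<in> sq z t" "\<And>w. w \<in> sq z t \<Longrightarrow> Re (c * \<Phi> w) \<le> Re (c * \<Phi> w0)"
    using continuous_attains_sup[OF compact_sq] w by blast
  have "w0 \<in> sq_bd z t"
  proof (rule ccontr)
    assume n: "w0 \<notin> sq_bd z t"
    define B where "B = box (z - Complex t t) (z + Complex t t)"
    have wB: "w0 \<in> B" using n w0(1) by (auto simp: B_def sq_def sq_bd_def in_box_complex_iff)
    have BS: "B \<subseteq> sq z t" by (auto simp: B_def sq_def in_box_complex_iff)
    have "open (\<Phi> ` B)"
      by (rule invariance_of_domain)
        (use cont inj BS in \<open>auto simp: B_def open_box intro: continuous_on_subset inj_on_subset\<close>)
    then obtain e where e: "e > 0" "ball (\<Phi> w0) e \<subseteq> \<Phi> ` B"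
      using wB by (meson image_eqI open_contains_ball)
    \<comment> \<open>The direction conjugate to c: then c d is a positive real number, so moving by
      d strictly increases the functional.\<close>
    define d where "d = of_real (e / (2 * norm c)) * cnj c"
    have "norm d = \<bar>e / (2 * norm c)\<bar> * norm c" unfolding d_def norm_mult norm_of_real by simp
    then have "norm d < e" using e c by simp
    then have "\<Phi> w0 + d \<in> \<Phi> ` B" using e(2) by (auto simp: dist_norm)
    then obtain u where u: "u \<in> B" "\<Phi> u = \<Phi> w0 + d" by auto
    have "c * d = of_real (e / (2 * norm c) * (norm c)\<^sup>2)"
      by (simp add: d_def complex_norm_square mult_ac del: of_real_power)
    then have "Re (c * d) > 0" using e c by simp
    moreover have "Re (c * \<Phi> u) \<le> Re (c * \<Phi> w0)" using w0(2) u(1) BS by blast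
    ultimately show False unfolding u(2) by (simp add: algebra_simps)
  qed
  then show ?thesis using that w0(2)[OF w] by blast
qed

text \<open>The maximum principle for c and for -c bounds from above and below. The choices c = 1
  and c = -\<i> give the real and the imaginary part; composing with a nondecreasing \<kappa> keeps
  the inequalities, which is what admits truncation.\<close>

lemma square_monotone_injective:
  fixes \<Phi> :: "complex \<Rightarrow> complex"
  assumes cont: "continuous_on U \<Phi>" and inj: "inj_on \<Phi> U" and c: "c \<noteq> 0" and \<kappa>: "mono \<kappa>"
  shows "square_monotone U (\<lambda>z. \<kappa> (Re (c * \<Phi> z)))"
  unfolding square_monotone_def
proof (intro allI impI ballI)
  fix z t w assume t: "0 < t" and U: "sq z t \<subseteq> U" and w: "w \<in> sq z t"
  have cont': "continuous_on (sq z t) \<Phi>" using cont U continuous_on_subset by blast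
  have inj': "inj_on \<Phi> (sq z t)" using inj U inj_on_subset by blast
  obtain w2 where "w2 \<in> sq_bd z t" "Re (c * \<Phi> w) \<le> Re (c * \<Phi> w2)"
    using injective_max_principle[OF cont' inj' t c w] .
  moreover obtain w1 where "w1 \<in> sq_bd z t" "Re ((-c) * \<Phi> w) \<le> Re ((-c) * \<Phi> w1)"
    using injective_max_principle[OF cont' inj' t _ w, of "-c"] c by auto
  ultimately show "\<exists>w1\<in>sq_bd z t. \<exists>w2\<in>sq_bd z t. \<kappa> (Re (c * \<Phi> w1)) \<le> \<kappa> (Re (c * \<Phi> w)) \<and> \<kappa> (Re (c * \<Phi> w)) \<le> \<kappa> (Re (c * \<Phi> w2))"
    using \<kappa> by (intro bexI[of _ w1] bexI[of _ w2]) (auto intro!: monoD[OF \<kappa>])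
qed

section \<open>Differentiability almost everywhere\<close>

lemma h_bound_of_weak:
  assumes w: "weak_x f g" and [measurable]: "k \<in> borel_measurable borel" and k: "\<And>z. 0 \<le> k z"
    and L: "\<And>a b y. L (Complex b y) - L (Complex a y) = (b - a) *\<^sub>R \<gamma>"
  shows "h_bound UNIV (\<lambda>z. f z - L z) (\<lambda>z. ennreal (norm (g z - \<gamma>) + k z))"
proof -
  have [measurable]: "g \<in> borel_measurable borel" using w by (simp add: weak_x_def)
  show ?thesis
    unfolding h_bound_def
  proof
    show "AE y in lborel. \<forall>a b. a \<le> b \<longrightarrow> (\<forall>x\<in>{a..b}. Complex x y \<in> UNIV) \<longrightarrow>
       ennreal (norm (f (Complex b y) - L (Complex b y) - (f (Complex a y) - L (Complex a y))))
        \<le> (\<integral>\<^sup>+x\<in>{a..b}. ennreal (norm (g (Complex x y) - \<gamma>) + k (Complex x y)) \<partial>lborel)"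
      using weak_x_acl[OF w]
    proof eventually_elim
      case (elim y)
      show ?case
      proof (intro allI impI)
        fix a b :: real assume ab: "a \<le> b"
        have eq: "f (Complex b y) - L (Complex b y) - (f (Complex a y) - L (Complex a y)) =
          f (Complex b y) - f (Complex a y) - (b - a) *\<^sub>R \<gamma>" using L[of b y a] by (simp add: algebra_simps)
        note elim[rule_format, OF ab, of \<gamma>, folded eq]
        also have "(\<integral>\<^sup>+x\<in>{a..b}. ennreal (norm (g (Complex x y) - \<gamma>)) \<partial>lborel)
          \<le> (\<integral>\<^sup>+x\<in>{a..b}. ennreal (norm (g (Complex x y) - \<gamma>) + k (Complex x y)) \<partial>lborel)"
          using k by (intro nn_integral_mono mult_right_mono ennreal_leI) auto
        finally show "ennreal (norm (f (Complex b y) - L (Complex b y) - (f (Complex a y) - L (Complex a y))))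
          \<le> (\<integral>\<^sup>+x\<in>{a..b}. ennreal (norm (g (Complex x y) - \<gamma>) + k (Complex x y)) \<partial>lborel)" .
      qed
    qed
  qed measurable
qed

text \<open>Summing the deviations of both columns gives one function that works in both coordinate
  directions. It is used with zero constants for the map itself, and with the values at a Lebesgue
  point for the difference from the linear part.\<close>

lemma acl_bound_of_weak:
  assumes w1: "weak_x f g1" and w2: "weak_x (\<lambda>z. f (flip z)) (\<lambda>z. g2 (flip z))" and g2[measurable]: "g2 \<in> borel_measurable borel"
  shows "acl_bound UNIV (\<lambda>z. f z - (Re z *\<^sub>R \<gamma>1 + Im z *\<^sub>R \<gamma>2)) (\<lambda>z. ennreal (norm (g1 z - \<gamma>1) + norm (g2 z - \<gamma>2)))"
proof -
  have [measurable]: "g1 \<in> borel_measurable borel" using w1 by (simp add: weak_x_def)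
  have "h_bound UNIV (\<lambda>z. f (flip z) - (Im z *\<^sub>R \<gamma>1 + Re z *\<^sub>R \<gamma>2)) (\<lambda>z. ennreal (norm (g2 (flip z) - \<gamma>2) + norm (g1 (flip z) - \<gamma>1)))"
    by (rule h_bound_of_weak[OF w2]) (auto simp: algebra_simps)
  then show ?thesis
    unfolding acl_bound_def using h_bound_of_weak[OF w1, of "\<lambda>z. norm (g2 z - \<gamma>2)" "\<lambda>z. Re z *\<^sub>R \<gamma>1 + Im z *\<^sub>R \<gamma>2"]
    by (simp add: add.commute algebra_simps)
qed

text \<open>By Fubini, \<open>f\<close> is close to its linear part on most boundaries of small squares around the two
  points to be compared and on most lines between them; by the maximum principle, \<open>f\<close> inside a
  square is controlled by \<open>f\<close> on its boundary.\<close>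
lemma injective_differentiable_at_Lebesgue_point:
  fixes f :: "complex \<Rightarrow> complex" and h :: "complex \<Rightarrow> ennreal"
  defines "L \<equiv> \<lambda>(\<gamma>1::complex) \<gamma>2 z. Re z *\<^sub>R \<gamma>1 + Im z *\<^sub>R \<gamma>2"
  assumes acl: "acl_bound UNIV (\<lambda>z. f z - L \<gamma>1 \<gamma>2 z) h"
    and contf: "continuous_on UNIV f" and inj: "inj f"
    and leb: "\<And>\<eta>. \<eta> > 0 \<Longrightarrow> \<forall>\<^sub>F r in at_right 0. (\<integral>\<^sup>+w\<in>sq x r. h w \<partial>lborel) \<le> ennreal (\<eta> * r\<^sup>2)"
  shows "(f has_derivative (L \<gamma>1 \<gamma>2)) (at x)"
proof -
  define M where "M = norm \<gamma>1 + norm \<gamma>2"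
  have M0: "M \<ge> 0" by (simp add: M_def)
  define e where "e = (\<lambda>z. f z - L \<gamma>1 \<gamma>2 z)"
  have acle: "acl_bound UNIV e h" using acl by (simp add: e_def)
  have hm[measurable]: "h \<in> borel_measurable borel" by (rule acl_bound_measurable[OF acl])
  have Ldiff: "L \<gamma>1 \<gamma>2 a - L \<gamma>1 \<gamma>2 b = L \<gamma>1 \<gamma>2 (a - b)" for a b by (simp add: L_def algebra_simps)
  have Lle: "norm (L \<gamma>1 \<gamma>2 z) \<le> M * r" if "\<bar>Re z\<bar> \<le> r" "\<bar>Im z\<bar> \<le> r" for z r
  proof -
    have "norm (L \<gamma>1 \<gamma>2 z) \<le> \<bar>Re z\<bar> * norm \<gamma>1 + \<bar>Im z\<bar> * norm \<gamma>2"
      unfolding L_def by (metis norm_scaleR norm_triangle_ineq)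
    also have "\<dots> \<le> r * norm \<gamma>1 + r * norm \<gamma>2" using that by (intro add_mono mult_right_mono) auto
    finally show ?thesis by (simp add: M_def algebra_simps)
  qed
  \<comment> \<open>The maximum principle holds for the coordinates of \<open>f\<close>, not for
    those of \<open>e\<close>. Passing from \<open>e\<close> to \<open>f\<close> and back costs a
    multiple of M q, which is harmless because q will be a small fraction of the distance between
    the two points.\<close>
  have small_square: "\<exists>t. q < t \<and> t < 2 * q \<and> (\<forall>w\<in>sq_bd z t. norm (e z - e w) \<le> 8 * J + 10 * M * q)"
    if q: "q > 0" and I: "(\<integral>\<^sup>+w\<in>sq z (2 * q). h w \<partial>lborel) \<le> ennreal I" "0 \<le> I" and J: "4 * I < J * q" "0 \<le> J" for q z I J
  proof -
    obtain t where t: "q < t" "t < 2 * q" and osc: "\<And>w w'. w \<in> sq_bd z t \<Longrightarrow> w' \<in> sq_bd z t \<Longrightarrow> norm (e w - e w') \<le> 4 * J"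
      using ex_good_square[OF acle subset_UNIV q I(1) J I(2)] by blast
    have oscf: "norm (f w - f w') \<le> 4 * J + 4 * M * q" if "w \<in> sq_bd z t" "w' \<in> sq_bd z t" for w w'
    proof -
      have "f w - f w' = (e w - e w') + L \<gamma>1 \<gamma>2 (w - w')" by (simp add: e_def Ldiff[symmetric])
      moreover have "norm (L \<gamma>1 \<gamma>2 (w - w')) \<le> M * (4 * q)"
      proof -
        have "w \<in> sq z t" "w' \<in> sq z t" using that sq_bd_subset by blast+
        then show ?thesis using t by (intro Lle) (auto simp: sq_def)
      qed
      ultimately show ?thesis using osc[OF that] norm_triangle_ineq[of "e w - e w'" "L \<gamma>1 \<gamma>2 (w - w')"] by simp
    qed
    have zt: "z \<in> sq z t" using t q by (auto simp: sq_def)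
    have part: "\<bar>Re (c * f z) - Re (c * f w)\<bar> \<le> 4 * J + 4 * M * q" if w: "w \<in> sq_bd z t" and c: "norm c = 1" for w c
    proof -
      have "square_monotone UNIV (\<lambda>z. id (Re (c * f z)))"
        by (rule square_monotone_injective[OF contf inj]) (use c in \<open>auto simp: mono_def\<close>)
      from this[unfolded square_monotone_def, rule_format, of t z z]
      obtain w1 w2 where w12: "w1 \<in> sq_bd z t" "w2 \<in> sq_bd z t" "Re (c * f w1) \<le> Re (c * f z)" "Re (c * f z) \<le> Re (c * f w2)"
        using zt t q by auto
      have "\<bar>Re (c * f u) - Re (c * f w)\<bar> \<le> 4 * J + 4 * M * q" if "u \<in> sq_bd z t" for u
      proof -
        have "\<bar>Re (c * f u) - Re (c * f w)\<bar> = \<bar>Re (c * (f u - f w))\<bar>" by (simp add: algebra_simps)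
        also have "\<dots> \<le> norm (c * (f u - f w))" by (rule abs_Re_le_cmod)
        also have "\<dots> = norm (f u - f w)" using c by (simp add: norm_mult)
        finally show ?thesis using oscf[OF that w] by simp
      qed
      from this[OF w12(1)] this[OF w12(2)] w12(3,4) show ?thesis by linarith
    qed
    have "norm (e z - e w) \<le> 8 * J + 10 * M * q" if w: "w \<in> sq_bd z t" for w
    proof -
      have "norm (f z - f w) \<le> \<bar>Re (f z - f w)\<bar> + \<bar>Im (f z - f w)\<bar>" by (rule cmod_le)
      also have "\<dots> \<le> (4 * J + 4 * M * q) + (4 * J + 4 * M * q)"
        using part[OF w, of 1] part[OF w, of "-\<i>"] by (intro add_mono) (auto simp: abs_minus_commute)
      finally have "norm (f z - f w) \<le> 8 * J + 8 * M * q" by simp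
      moreover have "norm (L \<gamma>1 \<gamma>2 (z - w)) \<le> M * (2 * q)"
        by (rule Lle) (use w t in \<open>auto simp: sq_bd_def\<close>)
      moreover have "e z - e w = (f z - f w) - L \<gamma>1 \<gamma>2 (z - w)" by (simp add: e_def Ldiff[symmetric])
      ultimately show ?thesis using norm_triangle_ineq4[of "f z - f w" "L \<gamma>1 \<gamma>2 (z - w)"] by simp
    qed
    then show ?thesis using t by blast
  qed
  show ?thesis
    unfolding has_derivative_at2
  proof (intro conjI)
    show "bounded_linear (L \<gamma>1 \<gamma>2)" unfolding L_def
      by (intro bounded_linear_add bounded_linear_scaleR_left[THEN bounded_linear_compose] bounded_linear_Re bounded_linear_Im)
    show "((\<lambda>y. (1 / norm (y - x)) *\<^sub>R (f y - (f x + L \<gamma>1 \<gamma>2 (y - x)))) \<longlongrightarrow> 0) (at x)"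
    proof (rule LIM_I)
      fix \<epsilon> :: real assume "0 < \<epsilon>"
      define \<epsilon>' where "\<epsilon>' = \<epsilon> / 2"
      have \<epsilon>': "\<epsilon>' > 0" "\<epsilon>' < \<epsilon>" using \<open>0 < \<epsilon>\<close> by (auto simp: \<epsilon>'_def)
      \<comment> \<open>Two error terms have to be halved against \<epsilon>': the cost 20 M q of
        the linear part, with q = \<delta> s, and the total 18 J s of the line integrals, whence J =
        \<epsilon>'/36. The value \<eta> = J \<delta>/40 then secures 4 I < J s q, as I = 9 \<eta>
        s^2.\<close>
      define \<delta> where "\<delta> = min (1/4) (\<epsilon>' / (40 * (M + 1)))"
      have \<delta>: "0 < \<delta>" "\<delta> \<le> 1/4" "20 * M * \<delta> \<le> \<epsilon>' / 2"
      proof -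
        show "0 < \<delta>" using \<epsilon>' M0 by (auto simp: \<delta>_def)
        show "\<delta> \<le> 1/4" unfolding \<delta>_def by (rule min.cobounded1)
        have "20 * M * \<delta> \<le> 20 * (M + 1) * (\<epsilon>' / (40 * (M + 1)))"
          using M0 \<epsilon>' by (intro mult_mono) (auto simp: \<delta>_def)
        also have "\<dots> = \<epsilon>' / 2" using M0 by (simp add: field_simps)
        finally show "20 * M * \<delta> \<le> \<epsilon>' / 2" .
      qed
      define J where "J = \<epsilon>' / 36"
      have J0: "J > 0" using \<epsilon>' by (simp add: J_def)
      define \<eta> where "\<eta> = J * \<delta> / 40"
      have \<eta>: "\<eta> > 0" using J0 \<delta> by (simp add: \<eta>_def)
      obtain d where d: "d > 0" "\<And>r. 0 < r \<Longrightarrow> r < d \<Longrightarrow> (\<integral>\<^sup>+w\<in>sq x r. h w \<partial>lborel) \<le> ennreal (\<eta> * r\<^sup>2)"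
        using leb[OF \<eta>] by (auto simp: eventually_at_right_field)
      have main: "norm (f y - f x - L \<gamma>1 \<gamma>2 (y - x)) \<le> \<epsilon>' * norm (y - x)" if y: "y \<noteq> x" "norm (y - x) < d / 3" for y
      proof -
        define s where "s = max \<bar>Re y - Re x\<bar> \<bar>Im y - Im x\<bar>"
        have s0: "s > 0" using y by (auto simp: s_def complex_eq_iff max_def)
        have sn: "s \<le> norm (y - x)" using abs_Re_le_cmod[of "y - x"] abs_Im_le_cmod[of "y - x"] by (simp add: s_def)
        have yx: "\<bar>Re y - Re x\<bar> \<le> s" "\<bar>Im y - Im x\<bar> \<le> s" by (auto simp: s_def)
        define q where "q = \<delta> * s"
        have q: "q > 0" "q \<le> s / 4" using \<delta> s0 by (auto simp: q_def field_simps)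
        define I where "I = \<eta> * (3 * s)\<^sup>2"
        have I0: "I \<ge> 0" using \<eta> by (simp add: I_def)
        have J': "4 * I < (J * s) * q"
          using J0 \<delta> s0 by (simp add: I_def \<eta>_def q_def power2_eq_square field_simps)
        then have J'': "I < (J * s) * q" using I0 by linarith
        have Js: "0 \<le> J * s" using J0 s0 by simp
        have II: "(\<integral>\<^sup>+w\<in>sq x (3 * s). h w \<partial>lborel) \<le> ennreal I"
          unfolding I_def by (rule d(2)) (use s0 sn y in auto)
        have sub: "(\<integral>\<^sup>+w\<in>S. h w \<partial>lborel) \<le> ennreal I" if "S \<subseteq> sq x (3 * s)" for S
          by (rule order_trans[OF _ II], intro nn_integral_mono mult_left_mono) (use that in \<open>auto simp: indicator_def\<close>)
        have subx: "sq x (2 * q) \<subseteq> sq x (3 * s)"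
        proof
          fix w assume "w \<in> sq x (2 * q)"
          then show "w \<in> sq x (3 * s)" using q by (auto simp: sq_def)
        qed
        obtain t1 where t1: "q < t1" "t1 < 2 * q" "\<And>w. w \<in> sq_bd x t1 \<Longrightarrow> norm (e x - e w) \<le> 8 * (J * s) + 10 * M * q"
          using small_square[OF q(1) sub[OF subx] I0 J' Js] by blast
        have suby: "sq y (2 * q) \<subseteq> sq x (3 * s)"
        proof
          fix w assume "w \<in> sq y (2 * q)"
          then show "w \<in> sq x (3 * s)" using yx q by (auto simp: sq_def)
        qed
        obtain t2 where t2: "q < t2" "t2 < 2 * q" "\<And>w. w \<in> sq_bd y t2 \<Longrightarrow> norm (e y - e w) \<le> 8 * (J * s) + 10 * M * q"
          using small_square[OF q(1) sub[OF suby] I0 J' Js] by blast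
        obtain \<tau> where \<tau>: "Im x < \<tau>" "\<tau> < Im x + q"
          "\<And>a b. a \<in> {Re x - 3 * s..Re x + 3 * s} \<Longrightarrow> b \<in> {Re x - 3 * s..Re x + 3 * s} \<Longrightarrow> norm (e (Complex b \<tau>) - e (Complex a \<tau>)) \<le> J * s"
        proof (rule ex_good_line_h[OF acle, of "Im x" "Im x + q" "Re x - 3 * s" "Re x + 3 * s" I "J * s"])
          show "(\<integral>\<^sup>+w\<in>cbox (Complex (Re x - 3 * s) (Im x)) (Complex (Re x + 3 * s) (Im x + q)). h w \<partial>lborel) \<le> ennreal I"
            by (rule sub) (use q in \<open>auto simp: sq_def in_cbox_complex_iff\<close>)
        qed (use q J'' Js I0 in auto)
        obtain \<tau>' where \<tau>': "Re y < \<tau>'" "\<tau>' < Re y + q"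
          "\<And>a b. a \<in> {Im x - 3 * s..Im x + 3 * s} \<Longrightarrow> b \<in> {Im x - 3 * s..Im x + 3 * s} \<Longrightarrow> norm (e (Complex \<tau>' b) - e (Complex \<tau>' a)) \<le> J * s"
        proof (rule ex_good_line_v[OF acle, of "Re y" "Re y + q" "Im x - 3 * s" "Im x + 3 * s" I "J * s"])
          show "(\<integral>\<^sup>+w\<in>cbox (Complex (Re y) (Im x - 3 * s)) (Complex (Re y + q) (Im x + 3 * s)). h w \<partial>lborel) \<le> ennreal I"
            by (rule sub) (use q yx in \<open>auto simp: sq_def in_cbox_complex_iff\<close>)
        qed (use q J'' Js I0 in auto)
        \<comment> \<open>The connecting path: from x to the right side of its small square, along a
          good horizontal line to the crossing \<open>c\<close>, along a good vertical line to the
          top side of the small square of y, and into y. The bounds on \<tau> and \<tau>' ensure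
          that the two lines meet these sides.\<close>
        define w1 c w2 where "w1 = Complex (Re x + t1) \<tau>" "c = Complex \<tau>' \<tau>" "w2 = Complex \<tau>' (Im y + t2)"
        note wcw = w1_c_w2_def
        have 1: "norm (e x - e w1) \<le> 8 * (J * s) + 10 * M * q"
          by (rule t1) (use \<tau> t1 q in \<open>auto simp: wcw sq_bd_def\<close>)
        have 2: "norm (e w1 - e c) \<le> J * s"
          unfolding wcw by (rule \<tau>(3)) (use \<tau>' t1 q yx in \<open>auto\<close>)
        have 3: "norm (e c - e w2) \<le> J * s"
          unfolding wcw by (rule \<tau>'(3)) (use \<tau> t2 q yx in \<open>auto\<close>)
        have 4: "norm (e y - e w2) \<le> 8 * (J * s) + 10 * M * q"
          by (rule t2) (use \<tau>' t2 q in \<open>auto simp: wcw sq_bd_def\<close>)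
        have "norm (e y - e x) \<le> norm (e y - e w2) + norm (e c - e w2) + norm (e w1 - e c) + norm (e x - e w1)"
        proof -
          have "e y - e x = (e y - e w2) - (e c - e w2) - (e w1 - e c) - (e x - e w1)" by simp
          then show ?thesis by (smt (verit) norm_triangle_ineq4)
        qed
        also have "\<dots> \<le> 18 * (J * s) + 20 * M * q" using 1 2 3 4 by linarith
        also have "\<dots> = (18 * J + 20 * M * \<delta>) * s" by (simp add: q_def algebra_simps)
        also have "\<dots> \<le> (\<epsilon>' / 2 + \<epsilon>' / 2) * s" using \<delta> s0 by (intro mult_right_mono add_mono) (auto simp: J_def)
        also have "\<dots> \<le> \<epsilon>' * norm (y - x)" using sn \<epsilon>' by simp
        finally show ?thesis by (simp add: e_def Ldiff[symmetric] algebra_simps)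
      qed
      show "\<exists>s>0. \<forall>y. y \<noteq> x \<and> norm (y - x) < s \<longrightarrow>
        norm ((1 / norm (y - x)) *\<^sub>R (f y - (f x + L \<gamma>1 \<gamma>2 (y - x))) - 0) < \<epsilon>"
      proof (intro exI[of _ "d / 3"] conjI allI impI)
        fix y assume y: "y \<noteq> x \<and> norm (y - x) < d / 3"
        then have "norm (f y - f x - L \<gamma>1 \<gamma>2 (y - x)) / norm (y - x) \<le> \<epsilon>'"
          using main[of y] by (simp add: divide_le_eq)
        then show "norm ((1 / norm (y - x)) *\<^sub>R (f y - (f x + L \<gamma>1 \<gamma>2 (y - x))) - 0) < \<epsilon>"
          using \<epsilon>' by (simp add: diff_diff_eq)
      qed (use d in auto)
    qed
  qed
qed

section \<open>Lebesgue points with respect to centred squares\<close>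

lemma measurable_cnj[measurable]: "cnj \<in> borel_measurable borel"
  by (intro borel_measurable_continuous_onI continuous_intros)

lemma distr_neg: "distr lborel borel uminus = (lborel :: complex measure)"
proof (rule lborel_eqI[symmetric])
  fix l u :: complex assume le: "\<And>b. b \<in> Basis \<Longrightarrow> l \<bullet> b \<le> u \<bullet> b"
  have 1: "uminus -` box l u \<inter> space lborel = box (- u) (- l)"
    by (auto simp: in_box_complex_iff)
  show "emeasure (distr lborel borel uminus) (box l u) = (\<Prod>b\<in>Basis. (u - l) \<bullet> b)"
    using le[of 1] le[of \<i>]
    by (subst emeasure_distr, simp, simp, subst 1)
      (auto simp: emeasure_lborel_box_eq Basis_complex_def ennreal_mult)
qed simp

lemma distr_cnj: "distr lborel borel cnj = lborel"
proof (rule lborel_eqI[symmetric])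
  fix l u :: complex assume le: "\<And>b. b \<in> Basis \<Longrightarrow> l \<bullet> b \<le> u \<bullet> b"
  have 1: "cnj -` box l u \<inter> space lborel = box (Complex (Re l) (- Im u)) (Complex (Re u) (- Im l))"
    by (auto simp: in_box_complex_iff)
  show "emeasure (distr lborel borel cnj) (box l u) = (\<Prod>b\<in>Basis. (u - l) \<bullet> b)"
    using le[of 1] le[of \<i>]
    by (subst emeasure_distr, simp, simp, subst 1)
      (auto simp: emeasure_lborel_box_eq Basis_complex_def ennreal_mult)
qed simp

text \<open>Here the point is the lower left corner of the shrinking squares. Only an upper bound
  for a nonnegative function is kept, since such bounds can be added over the four
  quadrants.\<close>

lemma Lebesgue_differentiation_quadrant:
  fixes F :: "complex \<Rightarrow> real"
  assumes [measurable]: "F \<in> borel_measurable borel" and nn: "\<And>z. F z \<ge> 0"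
    and int: "\<And>a b. set_integrable lborel (cbox a b) F"
  shows "AE x in lborel. \<forall>e>0. \<forall>\<^sub>F h in at_right 0.
    (\<integral>\<^sup>+z\<in>cbox x (x + Complex h h). ennreal (F z) \<partial>lborel) \<le> ennreal ((F x + e) * h\<^sup>2)"
proof -
  have hk: "F integrable_on cbox a b" for a b :: complex
    using set_borel_integral_eq_integral(1)[OF int[of a b]] by simp
  have nneq: "(\<integral>\<^sup>+z\<in>cbox a b. ennreal (F z) \<partial>lborel) = ennreal (integral (cbox a b) F)" for a b
  proof -
    have "(\<integral>\<^sup>+z\<in>cbox a b. ennreal (F z) \<partial>lborel) = (\<integral>\<^sup>+z. ennreal (indicator (cbox a b) z *\<^sub>R F z) \<partial>lborel)"
      by (intro nn_integral_cong) (auto simp: indicator_def)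
    also have "\<dots> = ennreal (LINT z:cbox a b|lborel. F z)"
      unfolding set_lebesgue_integral_def
      by (rule nn_integral_eq_integral) (use int[of a b] nn in \<open>auto simp: set_integrable_def\<close>)
    finally show ?thesis using set_borel_integral_eq_integral(2)[OF int[of a b]] by simp
  qed
  obtain N where N: "negligible N" "\<And>x e. \<lbrakk>x \<notin> N; 0 < e\<rbrakk> \<Longrightarrow>
       \<exists>d>0. \<forall>h. 0 < h \<and> h < d \<longrightarrow> norm(integral (cbox x (x + h *\<^sub>R One)) F /\<^sub>R h ^ DIM(complex) - F x) < e"
    using integrable_ccontinuous_explicit[of F] hk by blast
  have One: "(One::complex) = Complex 1 1" by (simp add: Basis_complex_def complex_eq_iff)
  have "N \<in> null_sets lebesgue" using N(1) by (simp add: negligible_iff_null_sets)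
  then have "AE x in lebesgue. x \<notin> N" by (rule AE_not_in)
  then have "AE x in lborel. x \<notin> N" by (simp add: AE_completion_iff)
  then show ?thesis
  proof eventually_elim
    case (elim x)
    show ?case
    proof (intro allI impI)
      fix e :: real assume "e > 0"
      from N(2)[OF elim this] obtain d where d: "d > 0"
        "\<And>h. 0 < h \<Longrightarrow> h < d \<Longrightarrow> norm(integral (cbox x (x + h *\<^sub>R One)) F /\<^sub>R h ^ DIM(complex) - F x) < e" by blast
      have "(\<integral>\<^sup>+z\<in>cbox x (x + Complex h h). ennreal (F z) \<partial>lborel) \<le> ennreal ((F x + e) * h\<^sup>2)" if h: "0 < h" "h < d" for h
      proof -
        have "h *\<^sub>R (One::complex) = Complex h h" unfolding One by (simp add: complex_eq_iff)
        then have "integral (cbox x (x + Complex h h)) F / h\<^sup>2 < F x + e"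
          using d(2)[OF h] by (simp add: divide_inverse mult.commute)
        then have "integral (cbox x (x + Complex h h)) F \<le> (F x + e) * h\<^sup>2"
          using h by (simp add: divide_less_eq)
        then show ?thesis unfolding nneq by (rule ennreal_leI)
      qed
      then show "\<forall>\<^sub>F h in at_right 0. (\<integral>\<^sup>+z\<in>cbox x (x + Complex h h). ennreal (F z) \<partial>lborel) \<le> ennreal ((F x + e) * h\<^sup>2)"
        using d(1) by (auto simp: eventually_at_right_field)
    qed
  qed
qed

text \<open>The corner version is applied to F composed with \<rho> and transported back. Since
  \<rho> is a measure preserving involution, this covers the quadrant into which \<rho> carries the
  original one.\<close>

lemma Lebesgue_differentiation_quadrant_image:
  fixes F :: "complex \<Rightarrow> real"
  assumes Fm[measurable]: "F \<in> borel_measurable borel" and nn: "\<And>z. F z \<ge> 0"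
    and int: "\<And>a b. set_integrable lborel (cbox a b) F"
    and pres: "distr lborel borel \<rho> = lborel" and [measurable]: "\<rho> \<in> borel_measurable borel"
    and inv: "\<And>z. \<rho> (\<rho> z) = z" and box: "\<And>a b. \<exists>a' b'. \<rho> -` cbox a b \<subseteq> cbox a' b'"
  shows "AE x in lborel. \<forall>e>0. \<forall>\<^sub>F h in at_right 0.
    (\<integral>\<^sup>+z\<in>\<rho> -` cbox (\<rho> x) (\<rho> x + Complex h h). ennreal (F z) \<partial>lborel) \<le> ennreal ((F x + e) * h\<^sup>2)"
proof -
  have "AE x in lborel. \<forall>e>0. \<forall>\<^sub>F h in at_right 0.
    (\<integral>\<^sup>+z\<in>cbox x (x + Complex h h). ennreal (F (\<rho> z)) \<partial>lborel) \<le> ennreal ((F (\<rho> x) + e) * h\<^sup>2)"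
  proof (rule Lebesgue_differentiation_quadrant)
    fix a b
    obtain a' b' where ab: "\<rho> -` cbox a b \<subseteq> cbox a' b'" using box by blast
    have "integrable (distr lborel borel \<rho>) (\<lambda>z. indicator (cbox a' b') z *\<^sub>R F z)"
      using int[of a' b'] by (simp add: pres set_integrable_def)
    then have "integrable lborel (\<lambda>z. indicator (cbox a' b') (\<rho> z) *\<^sub>R F (\<rho> z))"
      by (subst (asm) integrable_distr_eq) auto
    then have "integrable lborel (\<lambda>z. indicator (cbox a b) z *\<^sub>R F (\<rho> z))"
    proof (rule Bochner_Integration.integrable_bound)
      have "z \<in> cbox a b \<Longrightarrow> \<rho> z \<in> cbox a' b'" for z using ab inv by auto
      then show "AE z in lborel. norm (indicator (cbox a b) z *\<^sub>R F (\<rho> z)) \<le> norm (indicator (cbox a' b') (\<rho> z) *\<^sub>R F (\<rho> z))"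
        by (auto simp: indicator_def)
    qed measurable
    then show "set_integrable lborel (cbox a b) (\<lambda>z. F (\<rho> z))" by (simp add: set_integrable_def)
  qed (use nn in \<open>auto\<close>)
  then have "AE x in distr lborel borel \<rho>. \<forall>e>0. \<forall>\<^sub>F h in at_right 0.
    (\<integral>\<^sup>+z\<in>cbox x (x + Complex h h). ennreal (F (\<rho> z)) \<partial>lborel) \<le> ennreal ((F (\<rho> x) + e) * h\<^sup>2)"
    unfolding pres .
  then have "AE x in lborel. \<forall>e>0. \<forall>\<^sub>F h in at_right 0.
    (\<integral>\<^sup>+z\<in>cbox (\<rho> x) (\<rho> x + Complex h h). ennreal (F (\<rho> z)) \<partial>lborel) \<le> ennreal ((F (\<rho> (\<rho> x)) + e) * h\<^sup>2)"
    by (rule AE_distrD[rotated]) simp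
  moreover have "(\<integral>\<^sup>+z\<in>cbox u v. ennreal (F (\<rho> z)) \<partial>lborel) = (\<integral>\<^sup>+z\<in>\<rho> -` cbox u v. ennreal (F z) \<partial>lborel)" for u v
  proof -
    have "(\<integral>\<^sup>+z\<in>cbox u v. ennreal (F (\<rho> z)) \<partial>lborel) = (\<integral>\<^sup>+z. ennreal (F (\<rho> z)) * indicator (cbox u v) (\<rho> (\<rho> z)) \<partial>lborel)"
      by (simp add: inv)
    also have "\<dots> = (\<integral>\<^sup>+z. ennreal (F z) * indicator (cbox u v) (\<rho> z) \<partial>distr lborel borel \<rho>)"
      by (subst nn_integral_distr) auto
    also have "\<dots> = (\<integral>\<^sup>+z\<in>\<rho> -` cbox u v. ennreal (F z) \<partial>lborel)"
      unfolding pres by (intro nn_integral_cong) (auto simp: indicator_def)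
    finally show ?thesis .
  qed
  ultimately show ?thesis by (simp add: inv)
qed

text \<open>A centred square is the union of four quadrants, images of one another under the
  reflections in \<open>R\<close>; each contributes at most (F x + e) h^2, whence the factor
  4.\<close>

lemma Lebesgue_differentiation_square:
  fixes F :: "complex \<Rightarrow> real"
  assumes Fm[measurable]: "F \<in> borel_measurable borel" and nn: "\<And>z. F z \<ge> 0"
    and int: "\<And>a b. set_integrable lborel (cbox a b) F"
  shows "AE x in lborel. \<forall>e>0. \<forall>\<^sub>F h in at_right 0.
    (\<integral>\<^sup>+z\<in>sq x h. ennreal (F z) \<partial>lborel) \<le> ennreal (4 * (F x + e) * h\<^sup>2)"
proof -
  let ?P = "\<lambda>\<rho> x. \<forall>e>0. \<forall>\<^sub>F h in at_right 0.
    (\<integral>\<^sup>+z\<in>\<rho> -` cbox (\<rho> x) (\<rho> x + Complex h h). ennreal (F z) \<partial>lborel) \<le> ennreal ((F x + e) * h\<^sup>2)"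
  define R where "R = {\<lambda>z. z, uminus, cnj, \<lambda>z::complex. - cnj z}"
  have "AE x in lborel. ?P \<rho> x" if "\<rho> \<in> R" for \<rho>
  proof (rule Lebesgue_differentiation_quadrant_image[OF assms])
    show [measurable]: "\<rho> \<in> borel_measurable borel" using that by (auto simp: R_def)
    have "distr lborel borel (\<lambda>z. - cnj z) = distr (distr lborel borel cnj) borel uminus"
      by (subst distr_distr) (auto simp: comp_def)
    then show "distr lborel borel \<rho> = lborel"
      using that by (auto simp: R_def distr_cnj distr_neg distr_id2)
    show inv: "\<rho> (\<rho> z) = z" for z using that by (auto simp: R_def)
    fix a b
    have "bounded (\<rho> ` cbox a b)"
      by (rule compact_imp_bounded, rule compact_continuous_image)
        (use that in \<open>auto simp: R_def intro!: continuous_intros\<close>)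
    then obtain a' b' where "\<rho> ` cbox a b \<subseteq> cbox a' b'" using bounded_subset_cbox_symmetric by metis
    moreover have "\<rho> -` cbox a b \<subseteq> \<rho> ` cbox a b" using inv by (metis image_eqI subsetI vimageE)
    ultimately show "\<exists>a' b'. \<rho> -` cbox a b \<subseteq> cbox a' b'" by blast
  qed
  then have "AE x in lborel. \<forall>\<rho>\<in>R. ?P \<rho> x" by (subst AE_ball_countable) (auto simp: R_def)
  then show ?thesis
  proof eventually_elim
    case (elim x)
    show ?case
    proof (intro allI impI)
      fix e :: real assume e: "e > 0"
      let ?r1 = "\<lambda>z::complex. z" and ?r2 = "uminus :: complex \<Rightarrow> complex" and ?r4 = "\<lambda>z::complex. - cnj z"
      have "\<forall>\<^sub>F h in at_right 0. \<forall>\<rho>\<in>R. (\<integral>\<^sup>+z\<in>\<rho> -` cbox (\<rho> x) (\<rho> x + Complex h h). ennreal (F z) \<partial>lborel) \<le> ennreal ((F x + e) * h\<^sup>2)"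
        using elim e by (intro eventually_ball_finite) (auto simp: R_def)
      then show "\<forall>\<^sub>F h in at_right 0. (\<integral>\<^sup>+z\<in>sq x h. ennreal (F z) \<partial>lborel) \<le> ennreal (4 * (F x + e) * h\<^sup>2)"
      proof eventually_elim
        case (elim h)
        let ?Q = "\<lambda>\<rho>::complex \<Rightarrow> complex. \<rho> -` cbox (\<rho> x) (\<rho> x + Complex h h)"
        have meas: "?Q ?r1 \<in> sets borel" "?Q ?r2 \<in> sets borel" "?Q cnj \<in> sets borel" "?Q ?r4 \<in> sets borel"
          by (rule measurable_sets_borel[where M=borel]; simp)+
        have "sq x h \<subseteq> ?Q ?r1 \<union> ?Q ?r2 \<union> ?Q cnj \<union> ?Q ?r4"
          by (auto simp: sq_def in_cbox_complex_iff)
        then have "(\<integral>\<^sup>+z\<in>sq x h. ennreal (F z) \<partial>lborel) \<le> (\<integral>\<^sup>+z. ennreal (F z) * indicator (?Q ?r1) z +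
            ennreal (F z) * indicator (?Q ?r2) z + ennreal (F z) * indicator (?Q cnj) z + ennreal (F z) * indicator (?Q ?r4) z \<partial>lborel)"
          by (intro nn_integral_mono) (auto simp: indicator_def split: if_splits)
        also have "\<dots> = (\<integral>\<^sup>+z\<in>?Q ?r1. ennreal (F z) \<partial>lborel) + (\<integral>\<^sup>+z\<in>?Q ?r2. ennreal (F z) \<partial>lborel) +
           (\<integral>\<^sup>+z\<in>?Q cnj. ennreal (F z) \<partial>lborel) + (\<integral>\<^sup>+z\<in>?Q ?r4. ennreal (F z) \<partial>lborel)"
          using meas by (simp add: nn_integral_add)
        also have "\<dots> \<le> ennreal ((F x + e) * h\<^sup>2) + ennreal ((F x + e) * h\<^sup>2) + ennreal ((F x + e) * h\<^sup>2) + ennreal ((F x + e) * h\<^sup>2)"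
          using elim by (intro add_mono) (auto simp: R_def)
        also have "\<dots> = ennreal (4 * (F x + e) * h\<^sup>2)"
          using nn[of x] e by (simp add: ennreal_plus[symmetric] del: ennreal_plus)
        finally show ?case .
      qed
    qed
  qed
qed

text \<open>The constant g x varies with the point, so the differentiation theorem is applied to |g
  - c| for c in a countable dense set, off one common null set. With c closer than e/12 to g x, the
  total is at most 8 e/12 + e/3 = e times h^2.\<close>

lemma AE_Lebesgue_point:
  fixes g :: "complex \<Rightarrow> complex"
  assumes gm[measurable]: "g \<in> borel_measurable borel" and int: "\<And>a b. set_integrable lborel (cbox a b) g"
  shows "AE x in lborel. \<forall>e>0. \<forall>\<^sub>F h in at_right 0.
    (\<integral>\<^sup>+z\<in>sq x h. ennreal (norm (g z - g x)) \<partial>lborel) \<le> ennreal (e * h\<^sup>2)"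
proof -
  obtain D :: "complex set" where D: "countable D" "\<And>X. open X \<Longrightarrow> X \<noteq> {} \<Longrightarrow> \<exists>d\<in>D. d \<in> X"
    using countable_dense_setE by blast
  have "AE x in lborel. \<forall>c\<in>D. \<forall>e>0. \<forall>\<^sub>F h in at_right 0.
    (\<integral>\<^sup>+z\<in>sq x h. ennreal (norm (g z - c)) \<partial>lborel) \<le> ennreal (4 * (norm (g x - c) + e) * h\<^sup>2)"
    unfolding AE_ball_countable[OF D(1)]
  proof
    fix c assume "c \<in> D"
    have "set_integrable lborel (cbox a b) (\<lambda>z. c)" for a b :: complex
      unfolding set_integrable_def by (intro integrable_scaleR_left integrable_real_indicator) (auto simp: emeasure_lborel_cbox_eq)
    then have "set_integrable lborel (cbox a b) (\<lambda>z. norm (g z - c))" for a b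
      by (intro set_integrable_norm set_integral_diff int)
    then show "AE x in lborel. \<forall>e>0. \<forall>\<^sub>F h in at_right 0.
      (\<integral>\<^sup>+z\<in>sq x h. ennreal (norm (g z - c)) \<partial>lborel) \<le> ennreal (4 * (norm (g x - c) + e) * h\<^sup>2)"
      by (intro Lebesgue_differentiation_square) auto
  qed
  then show ?thesis
  proof eventually_elim
    case (elim x)
    show ?case
    proof (intro allI impI)
      fix e :: real assume e: "e > 0"
      obtain c where c: "c \<in> D" "norm (g x - c) < e / 12"
        using D(2)[of "ball (g x) (e/12)"] e by (auto simp: dist_norm)
      have "\<forall>\<^sub>F h in at_right 0. (\<integral>\<^sup>+z\<in>sq x h. ennreal (norm (g z - c)) \<partial>lborel) \<le> ennreal (4 * (norm (g x - c) + e/12) * h\<^sup>2)"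
        using elim[rule_format, OF c(1), of "e/12"] e by simp
      then show "\<forall>\<^sub>F h in at_right 0. (\<integral>\<^sup>+z\<in>sq x h. ennreal (norm (g z - g x)) \<partial>lborel) \<le> ennreal (e * h\<^sup>2)"
        using eventually_at_right_less[of 0]
      proof eventually_elim
        case (elim h)
        have tri: "norm (g z - g x) \<le> norm (g z - c) + norm (g x - c)" for z
          using norm_triangle_ineq4[of "g z - c" "g x - c"] by simp
        have "(\<integral>\<^sup>+z\<in>sq x h. ennreal (norm (g z - g x)) \<partial>lborel)
          \<le> (\<integral>\<^sup>+z. ennreal (norm (g z - c)) * indicator (sq x h) z + ennreal (norm (g x - c)) * indicator (sq x h) z \<partial>lborel)"
        proof (rule nn_integral_mono)
          fix z show "ennreal (norm (g z - g x)) * indicator (sq x h) z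
            \<le> ennreal (norm (g z - c)) * indicator (sq x h) z + ennreal (norm (g x - c)) * indicator (sq x h) z"
            using ennreal_leI[OF tri[of z]] by (cases "z \<in> sq x h") simp_all
        qed
        also have "\<dots> = (\<integral>\<^sup>+z\<in>sq x h. ennreal (norm (g z - c)) \<partial>lborel) + ennreal (norm (g x - c)) * emeasure lborel (sq x h)"
          by (simp add: nn_integral_add nn_integral_cmult_indicator)
        also have "emeasure lborel (sq x h) = ennreal (4 * h\<^sup>2)"
          using elim by (simp add: sq_eq_cbox emeasure_lborel_cbox_eq Basis_complex_def power2_eq_square algebra_simps)
        also have "(\<integral>\<^sup>+z\<in>sq x h. ennreal (norm (g z - c)) \<partial>lborel) + ennreal (norm (g x - c)) * ennreal (4 * h\<^sup>2)
          \<le> ennreal (4 * (norm (g x - c) + e/12) * h\<^sup>2) + ennreal (norm (g x - c)) * ennreal (4 * h\<^sup>2)"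
          by (intro add_right_mono elim)
        also have "\<dots> = ennreal (4 * (norm (g x - c) + e/12) * h\<^sup>2 + norm (g x - c) * (4 * h\<^sup>2))"
          using e by (simp add: ennreal_mult[symmetric] ennreal_plus[symmetric] del: ennreal_plus)
        also have "\<dots> \<le> ennreal (e * h\<^sup>2)"
        proof (rule ennreal_leI)
          have "4 * (norm (g x - c) + e/12) * h\<^sup>2 + norm (g x - c) * (4 * h\<^sup>2) = (8 * norm (g x - c) + e / 3) * h\<^sup>2"
            by (simp add: algebra_simps)
          also have "\<dots> \<le> e * h\<^sup>2" using c(2) by (intro mult_right_mono) auto
          finally show "4 * (norm (g x - c) + e/12) * h\<^sup>2 + norm (g x - c) * (4 * h\<^sup>2) \<le> e * h\<^sup>2" .
        qed
        finally show ?case .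
      qed
    qed
  qed
qed

section \<open>The area inequality\<close>

text \<open>The change of variables formula is phrased with determinants of matrices on
  \<open>real^2\<close>. These mutually inverse linear maps carry the plane there and preserve
  Lebesgue measure.\<close>

definition of_vec2 :: "real^2 \<Rightarrow> complex" where "of_vec2 v = Complex (v $ 1) (v $ 2)"
definition to_vec2 :: "complex \<Rightarrow> real^2" where "to_vec2 z = (\<chi> i. if i = 1 then Re z else Im z)"

lemma vec2_simps[simp]: "Re (of_vec2 v) = v $ 1" "Im (of_vec2 v) = v $ 2" "to_vec2 z $ 1 = Re z" "to_vec2 z $ 2 = Im z"
  "of_vec2 (to_vec2 z) = z" "to_vec2 (of_vec2 v) = v"
  by (auto simp: of_vec2_def to_vec2_def vec_eq_iff forall_2)

lemma linear_of_vec2: "linear of_vec2" and linear_to_vec2: "linear to_vec2"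
  by (rule linearI; simp add: of_vec2_def to_vec2_def complex_eq_iff vec_eq_iff forall_2)+

lemma bounded_linear_of_vec2: "bounded_linear of_vec2" and bounded_linear_to_vec2: "bounded_linear to_vec2"
  using linear_of_vec2 linear_to_vec2 by (auto simp: linear_conv_bounded_linear)

lemma measurable_vec2[measurable]: "of_vec2 \<in> borel_measurable borel" "to_vec2 \<in> borel_measurable borel"
  using bounded_linear_of_vec2 bounded_linear_to_vec2
  by (auto intro!: borel_measurable_continuous_onI linear_continuous_on)

lemma distr_of_vec2: "distr lborel borel of_vec2 = lborel"
proof (rule lborel_eqI[symmetric])
  fix l u :: complex assume le: "\<And>b. b \<in> Basis \<Longrightarrow> l \<bullet> b \<le> u \<bullet> b"
  have 1: "of_vec2 -` box l u \<inter> space lborel = box (to_vec2 l) (to_vec2 u)"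
    by (auto simp: in_box_complex_iff mem_box_cart forall_2)
  have B: "(Basis :: (real^2) set) = {axis 1 1, axis 2 1}"
    by (auto simp: Basis_vec_def) (metis exhaust_2)
  have ne: "axis 1 1 \<noteq> (axis 2 1 :: real^2)" by (simp add: axis_eq_axis)
  have "emeasure lborel (box (to_vec2 l) (to_vec2 u)) = ennreal (\<Prod>b\<in>Basis. (to_vec2 u - to_vec2 l) \<bullet> b)"
    using le[of 1] le[of \<i>] by (subst emeasure_lborel_box_eq) (auto simp: B ne inner_axis Basis_complex_def)
  then show "emeasure (distr lborel borel of_vec2) (box l u) = (\<Prod>b\<in>Basis. (u - l) \<bullet> b)"
    by (subst emeasure_distr, simp, simp, subst 1) (simp add: B ne inner_axis Basis_complex_def)
qed simp

text \<open>By invariance of domain the image of the plane is open and the inverse is continuous on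
  it, so an image under \<open>f\<close> is a preimage under the inverse.\<close>

lemma borel_injective_image:
  fixes f :: "complex \<Rightarrow> complex"
  assumes cont: "continuous_on UNIV f" and inj: "inj f" and S: "S \<in> sets borel"
  shows "f ` S \<in> sets borel"
proof -
  have op: "open (f ` UNIV)" by (rule invariance_of_domain[OF cont open_UNIV inj])
  have c: "continuous_on (f ` UNIV) (inv f)"
    by (rule continuous_on_inverse_open[OF open_UNIV cont]) (use inj in auto)
  have "inv f \<in> borel_measurable (restrict_space borel (f ` UNIV))"
    by (rule borel_measurable_continuous_on_restrict[OF c])
  then have "inv f -` S \<inter> space (restrict_space borel (f ` UNIV)) \<in> sets (restrict_space borel (f ` UNIV))"
    using S by (rule measurable_sets)
  moreover have "inv f -` S \<inter> space (restrict_space borel (f ` UNIV)) = f ` S"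
    using inj by (auto simp: space_restrict_space)
  ultimately show ?thesis
    using op by (subst (asm) sets_restrict_space_iff) auto
qed

lemma det_matrix_2:
  "det (matrix (\<lambda>v. to_vec2 (Re (of_vec2 v) *\<^sub>R \<gamma>1 + Im (of_vec2 v) *\<^sub>R \<gamma>2))) = Re \<gamma>1 * Im \<gamma>2 - Re \<gamma>2 * Im \<gamma>1"
  by (simp add: det_2 matrix_def axis_def)

lemma nn_integral_of_vec2:
  assumes [measurable]: "u \<in> borel_measurable borel"
  shows "(\<integral>\<^sup>+z. u z \<partial>lborel) = (\<integral>\<^sup>+v. u (of_vec2 v) \<partial>lborel)"
  by (subst distr_of_vec2[symmetric]) (simp add: nn_integral_distr)

lemma nn_integral_eq_HK_integral:
  fixes u :: "'a::euclidean_space \<Rightarrow> real"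
  assumes int: "u absolutely_integrable_on S" and nn: "\<And>x. 0 \<le> u x" and [measurable]: "u \<in> borel_measurable borel" "S \<in> sets borel"
  shows "(\<integral>\<^sup>+x\<in>S. ennreal (u x) \<partial>lborel) = ennreal (integral S u)"
proof -
  have "(\<integral>\<^sup>+x\<in>S. ennreal (u x) \<partial>lborel) = (\<integral>\<^sup>+x\<in>S. ennreal (u x) \<partial>lebesgue)"
    by (rule nn_integral_completion[symmetric]) measurable
  also have "\<dots> = (\<integral>\<^sup>+x. ennreal (indicator S x *\<^sub>R u x) \<partial>lebesgue)"
    by (intro nn_integral_cong) (auto simp: indicator_def)
  also have "\<dots> = ennreal (LINT x:S|lebesgue. u x)"
    unfolding set_lebesgue_integral_def
    by (rule nn_integral_eq_integral) (use int nn in \<open>auto simp: set_integrable_def\<close>)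
  finally show ?thesis using set_lebesgue_integral_eq_integral(2)[OF int] by simp
qed

lemma area_inequality:
  fixes f :: "complex \<Rightarrow> complex" and \<phi> :: "complex \<Rightarrow> real"
  assumes cont: "continuous_on UNIV f" and inj: "inj f" and S[measurable]: "S \<in> sets borel"
    and [measurable]: "g1 \<in> borel_measurable borel" "g2 \<in> borel_measurable borel" "\<phi> \<in> borel_measurable borel"
    and nn: "\<And>z. 0 \<le> \<phi> z"
    and der: "\<And>x. x \<in> S \<Longrightarrow> (f has_derivative (\<lambda>v. Re v *\<^sub>R g1 x + Im v *\<^sub>R g2 x)) (at x)"
  shows "(\<integral>\<^sup>+z\<in>S. ennreal (\<bar>Re (g1 z) * Im (g2 z) - Re (g2 z) * Im (g1 z)\<bar> * \<phi> (f z)) \<partial>lborel) \<le> (\<integral>\<^sup>+w. ennreal (\<phi> w) \<partial>lborel)"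
proof (cases "(\<integral>\<^sup>+w. ennreal (\<phi> w) \<partial>lborel) = \<infinity>")
  case False
  have [measurable]: "f \<in> borel_measurable borel" using cont by (rule borel_measurable_continuous_onI)
  define J where "J = (\<lambda>z. Re (g1 z) * Im (g2 z) - Re (g2 z) * Im (g1 z))"
  have [measurable]: "J \<in> borel_measurable borel" unfolding J_def by measurable
  define S' where "S' = of_vec2 -` S"
  have S'[measurable]: "S' \<in> sets borel" unfolding S'_def by (rule measurable_sets_borel[where M=borel]) auto
  define G where "G = (\<lambda>v. to_vec2 (f (of_vec2 v)))"
  define G' where "G' = (\<lambda>x v. to_vec2 (Re (of_vec2 v) *\<^sub>R g1 (of_vec2 x) + Im (of_vec2 v) *\<^sub>R g2 (of_vec2 x)))"
  have derG: "(G has_derivative G' x) (at x within S')" if "x \<in> S'" for x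
  proof -
    have "of_vec2 x \<in> S" using that by (simp add: S'_def)
    have "((\<lambda>v. f (of_vec2 v)) has_derivative (\<lambda>v. Re (of_vec2 v) *\<^sub>R g1 (of_vec2 x) + Im (of_vec2 v) *\<^sub>R g2 (of_vec2 x))) (at x)"
      by (rule has_derivative_compose[OF bounded_linear_imp_has_derivative[OF bounded_linear_of_vec2] der]) fact
    then have "(G has_derivative G' x) (at x)"
      unfolding G_def G'_def by (rule bounded_linear.has_derivative[OF bounded_linear_to_vec2])
    then show ?thesis by (rule has_derivative_at_withinI)
  qed
  have injG: "inj_on G S'"
  proof (rule inj_onI)
    fix a b assume "G a = G b"
    then have "of_vec2 (G a) = of_vec2 (G b)" by simp
    then have "of_vec2 a = of_vec2 b" using inj by (simp add: G_def inj_eq)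
    then have "to_vec2 (of_vec2 a) = to_vec2 (of_vec2 b)" by simp
    then show "a = b" by simp
  qed
  have GS: "G ` S' = of_vec2 -` (f ` S)"
  proof (intro set_eqI iffI)
    fix v assume "v \<in> G ` S'" then show "v \<in> of_vec2 -` (f ` S)" by (auto simp: G_def S'_def)
  next
    fix v assume "v \<in> of_vec2 -` (f ` S)"
    then obtain s where s: "s \<in> S" "of_vec2 v = f s" by auto
    then have "v = G (to_vec2 s)" by (simp add: G_def) (metis vec2_simps(6))
    then show "v \<in> G ` S'" using s by (auto simp: S'_def)
  qed
  have GSb[measurable]: "G ` S' \<in> sets borel"
    unfolding GS by (rule measurable_sets_borel[where M=borel]) (auto intro: borel_injective_image cont inj S)
  \<comment> \<open>The change of variables formula is applied to functions with values in a
    Cartesian power, so the scalar integrand is wrapped into \<open>real^1\<close> and unwrapped by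
    its only component.\<close>
  define F where "F = (\<lambda>v. vec (\<phi> (of_vec2 v)) :: real^1)"
  have detG: "\<bar>det (matrix (G' x))\<bar> = \<bar>J (of_vec2 x)\<bar>" for x
    unfolding G'_def J_def by (subst det_matrix_2) simp
  have "integrable lborel \<phi>"
    using False nn by (intro integrableI_nonneg) (auto simp: less_top)
  then have "integrable lborel (\<lambda>v. \<phi> (of_vec2 v))"
    by (subst (asm) distr_of_vec2[symmetric], subst (asm) integrable_distr_eq) auto
  then have il: "integrable lebesgue (\<lambda>v. \<phi> (of_vec2 v))"
    by (subst integrable_completion) auto
  have "(\<lambda>v. \<phi> (of_vec2 v)) absolutely_integrable_on (G ` S')"
    unfolding set_integrable_def
    by (intro integrable_mult_indicator[OF _ il]) simp
  then have absR: "(\<lambda>v. \<phi> (of_vec2 v)) absolutely_integrable_on (G ` S')" .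
  then have absF: "F absolutely_integrable_on (G ` S')"
    unfolding F_def by (simp add: absolutely_integrable_on_1_iff)
  have cv: "(\<lambda>x. \<bar>det (matrix (G' x))\<bar> *\<^sub>R F (G x)) absolutely_integrable_on S' \<and>
      integral S' (\<lambda>x. \<bar>det (matrix (G' x))\<bar> *\<^sub>R F (G x)) = integral (G ` S') F"
    using has_absolute_integral_change_of_variables[OF _ derG injG, of F "integral (G ` S') F"] absF S' by auto
  define u where "u = (\<lambda>x. \<bar>J (of_vec2 x)\<bar> * \<phi> (f (of_vec2 x)))"
  have um[measurable]: "u \<in> borel_measurable borel" unfolding u_def by measurable
  have uF: "\<bar>det (matrix (G' x))\<bar> *\<^sub>R F (G x) = vec (u x)" for x
    by (simp add: detG F_def G_def u_def vec_eq_iff)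
  have absu: "u absolutely_integrable_on S'"
    using cv unfolding uF by (simp add: absolutely_integrable_on_1_iff)
  have ieq: "integral S' u = integral (G ` S') (\<lambda>v. \<phi> (of_vec2 v))"
  proof -
    have "integral S' (\<lambda>x. (vec (u x) :: real^1) $ 1) = integral S' (\<lambda>x. vec (u x) :: real^1) $ 1"
      using cv unfolding uF by (intro integral_component_eq_cart) (auto simp: absolutely_integrable_on_def)
    also have "\<dots> = integral (G ` S') F $ 1" using cv unfolding uF by simp
    also have "\<dots> = integral (G ` S') (\<lambda>v. F v $ 1)"
      using absF by (intro integral_component_eq_cart[symmetric]) (auto simp: absolutely_integrable_on_def)
    finally show ?thesis by (simp add: F_def)
  qed
  have "(\<integral>\<^sup>+z\<in>S. ennreal (\<bar>J z\<bar> * \<phi> (f z)) \<partial>lborel) = (\<integral>\<^sup>+v\<in>S'. ennreal (u v) \<partial>lborel)"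
    by (subst nn_integral_of_vec2) (auto simp: u_def S'_def indicator_def intro!: nn_integral_cong)
  also have "\<dots> = ennreal (integral S' u)"
    by (rule nn_integral_eq_HK_integral[OF absu]) (auto simp: u_def nn)
  also have "\<dots> = (\<integral>\<^sup>+v\<in>G ` S'. ennreal (\<phi> (of_vec2 v)) \<partial>lborel)"
    unfolding ieq by (rule nn_integral_eq_HK_integral[OF absR, symmetric]) (auto simp: nn)
  also have "\<dots> \<le> (\<integral>\<^sup>+v. ennreal (\<phi> (of_vec2 v)) \<partial>lborel)"
    by (intro nn_integral_mono) (auto simp: indicator_def)
  also have "\<dots> = (\<integral>\<^sup>+w. ennreal (\<phi> w) \<partial>lborel)" by (subst nn_integral_of_vec2) auto
  finally show ?thesis unfolding J_def .
qed simp

section \<open>Logarithmic energy\<close>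

definition annulus :: "real \<Rightarrow> real \<Rightarrow> complex set" where
  "annulus a b = {z. exp a \<le> norm z \<and> norm z \<le> exp b}"

lemma annulus_borel[measurable]: "annulus a b \<in> sets borel"
proof -
  have "annulus a b = cball 0 (exp b) - ball 0 (exp a)" by (auto simp: annulus_def)
  then show ?thesis by simp
qed

text \<open>Its square is the density of the logarithmic area dA/|y|^2, cut off to an annulus with
  logarithmic radii \<open>a\<close> and \<open>b\<close>.\<close>

definition band_weight :: "real \<Rightarrow> real \<Rightarrow> complex \<Rightarrow> real" where
  "band_weight a b y = indicator (annulus a b) y / norm y"

lemma band_weight_measurable[measurable]: "band_weight a b \<in> borel_measurable borel"
  unfolding band_weight_def[abs_def] by measurable

lemma band_weight_nonneg[simp]: "0 \<le> band_weight a b y"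
  by (simp add: band_weight_def)

text \<open>The integrand is at most exp(-2a), and the annulus fits into a square of half-side
  exp(a+1); the product is 4 e^2, at most 36 by e \<le> 3.\<close>

lemma nn_integral_unit_annulus: "(\<integral>\<^sup>+z\<in>annulus a (a + 1). ennreal (1 / (norm z)\<^sup>2) \<partial>lborel) \<le> 36"
proof -
  have "(\<integral>\<^sup>+z\<in>annulus a (a + 1). ennreal (1 / (norm z)\<^sup>2) \<partial>lborel)
    \<le> (\<integral>\<^sup>+z. ennreal (1 / (exp a)\<^sup>2) * indicator (sq 0 (exp (a + 1))) z \<partial>lborel)"
  proof (rule nn_integral_mono)
    fix z :: complex
    show "ennreal (1 / (norm z)\<^sup>2) * indicator (annulus a (a + 1)) z \<le> ennreal (1 / (exp a)\<^sup>2) * indicator (sq 0 (exp (a + 1))) z"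
    proof (cases "z \<in> annulus a (a + 1)")
      case True
      then have z: "exp a \<le> norm z" "norm z \<le> exp (a + 1)" by (auto simp: annulus_def)
      then have "z \<in> sq 0 (exp (a + 1))"
        using abs_Re_le_cmod[of z] abs_Im_le_cmod[of z] by (auto simp: sq_def)
      moreover have "1 / (norm z)\<^sup>2 \<le> 1 / (exp a)\<^sup>2"
        using z by (intro divide_left_mono power_mono mult_pos_pos zero_less_power) (auto intro: less_le_trans[OF exp_gt_zero])
      ultimately show ?thesis using True by (simp add: ennreal_leI)
    qed simp
  qed
  also have "\<dots> = ennreal (1 / (exp a)\<^sup>2) * emeasure lborel (sq 0 (exp (a + 1)))"
    by (simp add: nn_integral_cmult_indicator)
  also have "emeasure lborel (sq 0 (exp (a + 1))) = ennreal (4 * (exp (a + 1))\<^sup>2)"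
    by (simp add: sq_eq_cbox emeasure_lborel_cbox_eq Basis_complex_def power2_eq_square)
  also have "ennreal (1 / (exp a)\<^sup>2) * ennreal (4 * (exp (a + 1))\<^sup>2) = ennreal (1 / (exp a)\<^sup>2 * (4 * (exp (a + 1))\<^sup>2))"
    by (rule ennreal_mult[symmetric]) auto
  also have "1 / (exp a)\<^sup>2 * (4 * (exp (a + 1))\<^sup>2) = 4 * (exp 1)\<^sup>2"
    by (simp add: exp_add power_mult_distrib)
  also have "ennreal (4 * (exp 1)\<^sup>2) \<le> 36"
  proof -
    have "(exp (1::real))\<^sup>2 \<le> 3\<^sup>2" using exp_le by (intro power_mono) auto
    then have "ennreal (4 * (exp 1)\<^sup>2) \<le> ennreal 36" by (intro ennreal_leI) auto
    then show ?thesis by simp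
  qed
  finally show ?thesis .
qed

text \<open>Logarithmic area is scale invariant, so it grows linearly with the logarithmic width: at
  most b - a + 1 annuli of unit width cover the given one.\<close>

lemma nn_integral_annulus:
  assumes "a \<le> b"
  shows "(\<integral>\<^sup>+z\<in>annulus a b. ennreal (1 / (norm z)\<^sup>2) \<partial>lborel) \<le> ennreal (36 * (b - a + 1))"
proof -
  define N where "N = nat \<lfloor>b - a\<rfloor> + 1"
  have N: "real N \<le> b - a + 1" "b - a < real N" using assms unfolding N_def by linarith+
  have "(\<integral>\<^sup>+z\<in>annulus a b. ennreal (1 / (norm z)\<^sup>2) \<partial>lborel)
    \<le> (\<integral>\<^sup>+z. (\<Sum>k<N. ennreal (1 / (norm z)\<^sup>2) * indicator (annulus (a + real k) (a + real k + 1)) z) \<partial>lborel)"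
  proof (rule nn_integral_mono)
    fix z :: complex
    show "ennreal (1 / (norm z)\<^sup>2) * indicator (annulus a b) z
      \<le> (\<Sum>k<N. ennreal (1 / (norm z)\<^sup>2) * indicator (annulus (a + real k) (a + real k + 1)) z)"
    proof (cases "z \<in> annulus a b")
      case True
      then have z: "norm z > 0" by (auto simp: annulus_def intro: less_le_trans[OF exp_gt_zero])
      define l where "l = ln (norm z)"
      have nz: "norm z = exp l" using z by (simp add: l_def)
      have l: "a \<le> l" "l \<le> b" using True by (auto simp: annulus_def nz)
      define k where "k = nat \<lfloor>l - a\<rfloor>"
      have k: "a + real k \<le> l" "l \<le> a + real k + 1" using l unfolding k_def by linarith+
      have "real k < real N" using k l N by linarith
      then have kN: "k \<in> {..<N}" by simp
      have "z \<in> annulus (a + real k) (a + real k + 1)" using k by (auto simp: annulus_def nz)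
      then have "ennreal (1 / (norm z)\<^sup>2) * indicator (annulus a b) z
        \<le> ennreal (1 / (norm z)\<^sup>2) * indicator (annulus (a + real k) (a + real k + 1)) z" using True by simp
      also have "\<dots> \<le> (\<Sum>k<N. ennreal (1 / (norm z)\<^sup>2) * indicator (annulus (a + real k) (a + real k + 1)) z)"
        by (rule member_le_sum[OF kN]) auto
      finally show ?thesis .
    qed simp
  qed
  also have "\<dots> = (\<Sum>k<N. \<integral>\<^sup>+z\<in>annulus (a + real k) (a + real k + 1). ennreal (1 / (norm z)\<^sup>2) \<partial>lborel)"
    by (rule nn_integral_sum) measurable
  also have "\<dots> \<le> (\<Sum>k<N. 36)" by (intro sum_mono nn_integral_unit_annulus)
  also have "\<dots> = ennreal (36 * real N)" by (simp add: ennreal_mult mult.commute ennreal_of_nat_eq_real_of_nat)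
  also have "\<dots> \<le> ennreal (36 * (b - a + 1))" using N by (intro ennreal_leI) auto
  finally show ?thesis .
qed

text \<open>Applies \<open>t \<le> exp t / a + ln a\<close> with \<open>t = p K(z)\<close> and \<open>a = 1/|z|\<^sup>2\<close>; this replaces Jensen's inequality on
  dyadic annuli.\<close>
lemma exp_weight_bound:
  fixes K :: "complex \<Rightarrow> real"
  assumes [measurable]: "K \<in> borel_measurable borel" and p: "p > 0" and T: "0 \<le> T"
    and E: "(\<integral>\<^sup>+z\<in>cball 0 (exp 1). ennreal (exp (p * K z)) \<partial>lborel) \<le> ennreal E" "0 \<le> E"
  shows "(\<integral>\<^sup>+z\<in>annulus (- T) 1. ennreal (K z / (norm z)\<^sup>2) \<partial>lborel) \<le> ennreal ((E + 72 * T * (T + 2)) / p)"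
proof -
  have [measurable]: "cball 0 (exp 1) \<in> sets (borel :: complex measure)" by simp
  have pt: "K z / (norm z)\<^sup>2 \<le> (exp (p * K z) + 2 * T * (1 / (norm z)\<^sup>2)) / p" if z: "z \<in> annulus (- T) 1" for z
  proof -
    have n: "norm z > 0" "exp (- T) \<le> norm z" using z by (auto simp: annulus_def intro: less_le_trans[OF exp_gt_zero])
    define a where "a = ln (norm z)"
    have na: "norm z = exp a" using n by (simp add: a_def)
    have aT: "- a \<le> T" using n(2) by (simp add: na)
    \<comment> \<open>The inequality x \<le> exp x at x = p K + 2 ln |z|. In this proof
      \<open>a\<close> denotes ln |z|, and -a \<le> T bounds the logarithmic correction; together
      with the logarithmic area 36 (T + 2) it produces the term 72 T (T + 2).\<close>
    have "p * K z + 2 * a \<le> exp (p * K z + 2 * a)" using exp_ge_add_one_self[of "p * K z + 2 * a"] by linarith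
    also have "\<dots> = exp (p * K z) * (norm z)\<^sup>2" by (simp add: na exp_add exp_double)
    finally have "p * K z \<le> exp (p * K z) * (norm z)\<^sup>2 + 2 * T" using aT by linarith
    then have "p * K z / (norm z)\<^sup>2 \<le> (exp (p * K z) * (norm z)\<^sup>2 + 2 * T) / (norm z)\<^sup>2"
      by (intro divide_right_mono) auto
    also have "\<dots> = exp (p * K z) + 2 * T * (1 / (norm z)\<^sup>2)" using n by (simp add: add_divide_distrib)
    finally show ?thesis using p by (simp add: field_simps)
  qed
  have "(\<integral>\<^sup>+z\<in>annulus (- T) 1. ennreal (K z / (norm z)\<^sup>2) \<partial>lborel)
    \<le> (\<integral>\<^sup>+z. ennreal (1 / p) * (ennreal (exp (p * K z)) * indicator (cball 0 (exp 1)) z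
       + ennreal (2 * T) * (ennreal (1 / (norm z)\<^sup>2) * indicator (annulus (- T) 1) z)) \<partial>lborel)"
  proof (rule nn_integral_mono)
    fix z
    show "ennreal (K z / (norm z)\<^sup>2) * indicator (annulus (- T) 1) z \<le> ennreal (1 / p) * (ennreal (exp (p * K z)) * indicator (cball 0 (exp 1)) z
       + ennreal (2 * T) * (ennreal (1 / (norm z)\<^sup>2) * indicator (annulus (- T) 1) z))"
    proof (cases "z \<in> annulus (- T) 1")
      case True
      then have c: "z \<in> cball 0 (exp 1)" by (auto simp: annulus_def)
      have "ennreal (1 / p) * (ennreal (exp (p * K z)) + ennreal (2 * T) * ennreal (1 / (norm z)\<^sup>2))
         = ennreal ((exp (p * K z) + 2 * T * (1 / (norm z)\<^sup>2)) / p)"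
        using p T by (simp add: ennreal_mult[symmetric] ennreal_plus[symmetric] del: ennreal_plus)
      then show ?thesis using True c ennreal_leI[OF pt[OF True]] by simp
    qed simp
  qed
  also have "\<dots> = ennreal (1 / p) * ((\<integral>\<^sup>+z\<in>cball 0 (exp 1). ennreal (exp (p * K z)) \<partial>lborel)
       + ennreal (2 * T) * (\<integral>\<^sup>+z\<in>annulus (- T) 1. ennreal (1 / (norm z)\<^sup>2) \<partial>lborel))"
    by (subst nn_integral_cmult, measurable, subst nn_integral_add, measurable, subst nn_integral_cmult, measurable)
  also have "\<dots> \<le> ennreal (1 / p) * (ennreal E + ennreal (2 * T) * ennreal (36 * (1 - (- T) + 1)))"
    using T by (intro mult_left_mono add_mono E nn_integral_annulus) auto
  also have "\<dots> = ennreal ((E + 72 * T * (T + 2)) / p)"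
    using p T E(2) by (simp add: ennreal_mult[symmetric] ennreal_plus[symmetric] add_divide_distrib algebra_simps del: ennreal_plus)
  finally show ?thesis .
qed

text \<open>The analytic content of the hypotheses in Borel terms. The sum of the two column norms
  is at most twice the operator norm, hence the factor 4 in front of J K.\<close>

locale finite_distortion_data =
  fixes f g1 g2 :: "complex \<Rightarrow> complex" and K :: "complex \<Rightarrow> real"
  assumes cont: "continuous_on UNIV f" and inj: "inj f"
    and weak1: "weak_x f g1" and weak2: "weak_x (\<lambda>z. f (flip z)) (\<lambda>z. g2 (flip z))"
    and g2_measurable[measurable]: "g2 \<in> borel_measurable borel"
    and g2_int: "\<And>a b. set_integrable lborel (cbox a b) g2"
    and K_measurable[measurable]: "K \<in> borel_measurable borel"
    and distortion: "AE z in lborel. 0 \<le> K z \<and>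
       (norm (g1 z) + norm (g2 z))\<^sup>2 \<le> 4 * (Re (g1 z) * Im (g2 z) - Re (g2 z) * Im (g1 z)) * K z"
begin

lemma g1_measurable[measurable]: "g1 \<in> borel_measurable borel"
  using weak1 by (simp add: weak_x_def)

lemma f_measurable[measurable]: "f \<in> borel_measurable borel"
  using cont by (rule borel_measurable_continuous_onI)

definition J where "J z = Re (g1 z) * Im (g2 z) - Re (g2 z) * Im (g1 z)"

definition h where "h z = norm (g1 z) + norm (g2 z)"

lemma h_measurable[measurable]: "h \<in> borel_measurable borel"
  unfolding h_def[abs_def] by measurable

lemma J_measurable[measurable]: "J \<in> borel_measurable borel"
  unfolding J_def[abs_def] by measurable

lemma acl_bound_f: "acl_bound UNIV f (\<lambda>z. ennreal (h z))"
  using acl_bound_of_weak[OF weak1 weak2 g2_measurable, of 0 0] by (simp add: h_def)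

text \<open>At a common Lebesgue point of both columns the averages of |g1 - g1 x| + |g2 - g2 x|
  over shrinking squares tend to 0, which is the condition under which an injective map is
  differentiable.\<close>

lemma AE_differentiable: "AE x in lborel. (f has_derivative (\<lambda>v. Re v *\<^sub>R g1 x + Im v *\<^sub>R g2 x)) (at x)"
proof -
  have g1_int: "set_integrable lborel (cbox a b) g1" for a b using weak1 by (simp add: weak_x_def)
  show ?thesis
    using AE_Lebesgue_point[OF g1_measurable g1_int] AE_Lebesgue_point[OF g2_measurable g2_int]
  proof eventually_elim
    case (elim x)
    show ?case
    proof (rule injective_differentiable_at_Lebesgue_point[OF acl_bound_of_weak[OF weak1 weak2 g2_measurable] cont inj])
      fix \<eta> :: real assume \<eta>: "\<eta> > 0"
      have "\<forall>\<^sub>F r in at_right 0. (\<integral>\<^sup>+z\<in>sq x r. ennreal (norm (g1 z - g1 x)) \<partial>lborel) \<le> ennreal (\<eta> / 2 * r\<^sup>2)"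
        "\<forall>\<^sub>F r in at_right 0. (\<integral>\<^sup>+z\<in>sq x r. ennreal (norm (g2 z - g2 x)) \<partial>lborel) \<le> ennreal (\<eta> / 2 * r\<^sup>2)"
        using elim(1)[rule_format, of "\<eta> / 2"] elim(2)[rule_format, of "\<eta> / 2"] \<eta> by auto
      then show "\<forall>\<^sub>F r in at_right 0. (\<integral>\<^sup>+w\<in>sq x r. ennreal (norm (g1 w - g1 x) + norm (g2 w - g2 x)) \<partial>lborel) \<le> ennreal (\<eta> * r\<^sup>2)"
      proof eventually_elim
        case (elim r)
        have "(\<integral>\<^sup>+w\<in>sq x r. ennreal (norm (g1 w - g1 x) + norm (g2 w - g2 x)) \<partial>lborel) =
          (\<integral>\<^sup>+z\<in>sq x r. ennreal (norm (g1 z - g1 x)) \<partial>lborel) + (\<integral>\<^sup>+z\<in>sq x r. ennreal (norm (g2 z - g2 x)) \<partial>lborel)"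
          by (simp add: distrib_right nn_integral_add)
        also have "\<dots> \<le> ennreal (\<eta> / 2 * r\<^sup>2) + ennreal (\<eta> / 2 * r\<^sup>2)"
          by (intro add_mono elim)
        also have "\<dots> = ennreal (\<eta> * r\<^sup>2)" using \<eta> by (simp add: ennreal_plus[symmetric] del: ennreal_plus)
        finally show ?case .
      qed
    qed
  qed
qed

text \<open>Removing a Borel null set outside which \<open>f\<close> is differentiable does not
  affect the left-hand integral. The right-hand side is the logarithmic area of the whole band,
  whatever part of it the image fills.\<close>

lemma area_band:
  assumes "a \<le> b"
  shows "(\<integral>\<^sup>+z. ennreal (\<bar>J z\<bar> * (band_weight a b (f z))\<^sup>2) \<partial>lborel) \<le> ennreal (36 * (b - a + 1))"
proof -
  obtain N where N: "\<And>x. x \<in> space lborel - N \<Longrightarrow> (f has_derivative (\<lambda>v. Re v *\<^sub>R g1 x + Im v *\<^sub>R g2 x)) (at x)" "N \<in> null_sets lborel"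
    by (rule AE_E3[OF AE_differentiable]) blast
  have "- N \<in> sets borel" using N(2) by (auto simp: null_sets_def)
  have "(\<integral>\<^sup>+z. ennreal (\<bar>J z\<bar> * (band_weight a b (f z))\<^sup>2) \<partial>lborel) = (\<integral>\<^sup>+z\<in>-N. ennreal (\<bar>J z\<bar> * (band_weight a b (f z))\<^sup>2) \<partial>lborel)"
    by (rule nn_integral_cong_AE, use AE_not_in[OF N(2)] in eventually_elim) simp
  also have "\<dots> \<le> (\<integral>\<^sup>+w. ennreal ((band_weight a b w)\<^sup>2) \<partial>lborel)"
    unfolding J_def
    by (rule area_inequality[OF cont inj \<open>- N \<in> sets borel\<close> g1_measurable g2_measurable, where \<phi>="\<lambda>w. (band_weight a b w)\<^sup>2"])
      (use N(1) in auto)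
  also have "\<dots> = (\<integral>\<^sup>+w\<in>annulus a b. ennreal (1 / (norm w)\<^sup>2) \<partial>lborel)"
    by (intro nn_integral_cong) (auto simp: band_weight_def indicator_def power_divide)
  also have "\<dots> \<le> ennreal (36 * (b - a + 1))" by (rule nn_integral_annulus[OF assms])
  finally show ?thesis .
qed

text \<open>Young's inequality with a free weight \<open>lm\<close> takes the place of
  Cauchy-Schwarz, so that the right-hand side stays linear in the width b - a and the width can
  later be absorbed. The area term does not depend on the set \<open>A\<close>.\<close>

lemma energy_bound:
  assumes ab: "a \<le> b" and lam: "lm > 0" and [measurable]: "A \<in> sets borel"
  shows "(\<integral>\<^sup>+z\<in>A. ennreal (h z * band_weight a b (f z) / norm z) \<partial>lborel)
    \<le> ennreal lm * (\<integral>\<^sup>+z\<in>A. ennreal (K z / (norm z)\<^sup>2) \<partial>lborel) + ennreal (36 * (b - a + 1) / lm)"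
proof -
  have pt: "AE z in lborel. ennreal (h z * band_weight a b (f z) / norm z) * indicator A z
     \<le> ennreal lm * (ennreal (K z / (norm z)\<^sup>2) * indicator A z) + ennreal (1 / lm) * ennreal (\<bar>J z\<bar> * (band_weight a b (f z))\<^sup>2)"
    using distortion
  proof eventually_elim
    case (elim z)
    define B where "B = band_weight a b (f z)"
    have B: "B \<ge> 0" by (simp add: B_def)
    have h2: "(h z)\<^sup>2 \<le> 4 * J z * K z" using elim by (simp add: h_def J_def)
    also have "\<dots> \<le> 4 * \<bar>J z\<bar> * K z" using elim by (intro mult_right_mono) auto
    finally have "(h z)\<^sup>2 \<le> (2 * sqrt (\<bar>J z\<bar> * K z))\<^sup>2" using elim by (simp add: power_mult_distrib)
    then have hz: "h z \<le> 2 * sqrt (\<bar>J z\<bar> * K z)" by (rule power2_le_imp_le) (use elim in auto)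
    \<comment> \<open>AM-GM: \<open>2 u v \<le> u\<^sup>2 + v\<^sup>2\<close>, with \<open>h\<^sup>2 \<le> 4 J K\<close> split as \<open>h \<le> 2 sqrt J sqrt K\<close>\<close>
    define u v where "u = sqrt lm * (sqrt (K z) / norm z)" "v = sqrt (\<bar>J z\<bar>) * B / sqrt lm"
    have "h z * B / norm z \<le> 2 * sqrt (\<bar>J z\<bar> * K z) * B / norm z"
      using hz B by (intro divide_right_mono mult_right_mono) auto
    also have "\<dots> = 2 * u * v" using lam by (simp add: u_v_def real_sqrt_mult)
    also have "\<dots> \<le> u\<^sup>2 + v\<^sup>2" by (rule sum_squares_bound)
    also have "\<dots> = lm * (K z / (norm z)\<^sup>2) + (1 / lm) * (\<bar>J z\<bar> * B\<^sup>2)"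
      using lam elim by (simp add: u_v_def power_mult_distrib power_divide)
    finally have le: "h z * B / norm z \<le> lm * (K z / (norm z)\<^sup>2) + (1 / lm) * (\<bar>J z\<bar> * B\<^sup>2)" .
    have eq: "ennreal (lm * (K z / (norm z)\<^sup>2) + (1 / lm) * (\<bar>J z\<bar> * B\<^sup>2)) =
      ennreal lm * ennreal (K z / (norm z)\<^sup>2) + ennreal (1 / lm) * ennreal (\<bar>J z\<bar> * B\<^sup>2)"
      using lam elim by (subst ennreal_plus) (auto simp: ennreal_mult'[symmetric])
    show ?case
    proof (cases "z \<in> A")
      case True
      then show ?thesis using ennreal_leI[OF le] unfolding eq by (simp add: B_def)
    qed simp
  qed
  have "(\<integral>\<^sup>+z\<in>A. ennreal (h z * band_weight a b (f z) / norm z) \<partial>lborel)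
    \<le> (\<integral>\<^sup>+z. ennreal lm * (ennreal (K z / (norm z)\<^sup>2) * indicator A z) + ennreal (1 / lm) * ennreal (\<bar>J z\<bar> * (band_weight a b (f z))\<^sup>2) \<partial>lborel)"
    by (rule nn_integral_mono_AE[OF pt])
  also have "\<dots> = ennreal lm * (\<integral>\<^sup>+z\<in>A. ennreal (K z / (norm z)\<^sup>2) \<partial>lborel)
      + ennreal (1 / lm) * (\<integral>\<^sup>+z. ennreal (\<bar>J z\<bar> * (band_weight a b (f z))\<^sup>2) \<partial>lborel)"
    by (simp add: nn_integral_add nn_integral_cmult)
  also have "\<dots> \<le> ennreal lm * (\<integral>\<^sup>+z\<in>A. ennreal (K z / (norm z)\<^sup>2) \<partial>lborel) + ennreal (1 / lm) * ennreal (36 * (b - a + 1))"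
    by (intro add_left_mono mult_left_mono area_band ab) auto
  also have "ennreal (1 / lm) * ennreal (36 * (b - a + 1)) = ennreal (36 * (b - a + 1) / lm)"
    using lam ab by (subst ennreal_mult'[symmetric]) (auto simp: divide_inverse mult.commute)
  finally show ?thesis .
qed

end

section \<open>Oscillation of the logarithm\<close>

text \<open>\<open>\<psi>\<close> is a coordinate of the logarithm that may be truncated to the band \<open>\<alpha> \<le> Re \<le> \<beta>\<close>. The weight lives on a
  slightly larger band so that it is locally comparable to \<open>1/|\<phi>|\<close> wherever \<open>\<psi>\<close> can vary.\<close>
lemma log_increment_line:
  fixes \<phi> \<Phi> :: "real \<Rightarrow> complex" and k :: "real \<Rightarrow> real" and \<psi> :: "complex \<Rightarrow> real"
  assumes ab: "a \<le> b" and cont\<phi>: "continuous_on {a..b} \<phi>" and cont\<Phi>: "continuous_on {a..b} \<Phi>"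
    and exp: "\<And>t. t \<in> {a..b} \<Longrightarrow> exp (\<Phi> t) = \<phi> t"
    and lip: "\<And>x y. \<bar>\<psi> x - \<psi> y\<bar> \<le> norm (x - y)"
    and inc: "\<And>s t. a \<le> s \<Longrightarrow> s \<le> t \<Longrightarrow> t \<le> b \<Longrightarrow> ennreal (norm (\<phi> t - \<phi> s)) \<le> (\<integral>\<^sup>+x\<in>{s..t}. ennreal (k x) \<partial>lborel)"
    and off: "\<And>t. t \<in> {a..b} \<Longrightarrow> \<not> (\<alpha> \<le> Re (\<Phi> t) \<and> Re (\<Phi> t) \<le> \<beta>) \<Longrightarrow> \<exists>d>0. \<forall>s\<in>{a..b}. \<bar>s - t\<bar> < d \<longrightarrow> \<psi> (\<Phi> s) = \<psi> (\<Phi> t)"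
    and k: "\<And>x. 0 \<le> k x" and [measurable]: "k \<in> borel_measurable borel" "\<phi> \<in> borel_measurable borel"
  shows "ennreal \<bar>\<psi> (\<Phi> b) - \<psi> (\<Phi> a)\<bar> \<le> (\<integral>\<^sup>+x\<in>{a..b}. ennreal (4 * (k x * band_weight (\<alpha> - 1) (\<beta> + 1) (\<phi> x))) \<partial>lborel)"
proof -
  define H where "H = (\<lambda>x. 4 * (k x * band_weight (\<alpha> - 1) (\<beta> + 1) (\<phi> x)))"
  have [measurable]: "H \<in> borel_measurable borel" unfolding H_def by measurable
  define P where "P = (\<lambda>s t. a \<le> s \<longrightarrow> s \<le> t \<longrightarrow> t \<le> b \<longrightarrow>
    ennreal \<bar>\<psi> (\<Phi> t) - \<psi> (\<Phi> s)\<bar> \<le> (\<integral>\<^sup>+x\<in>{s..t}. ennreal (H x) \<partial>lborel))"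
  \<comment> \<open>Bisection: \<open>P\<close> is additive under subdivision, so it need only be
    verified on short intervals around each point. Where \<open>Re (\<Phi> x)\<close> lies outside
    the band, \<psi> is locally constant and there is nothing to estimate.\<close>
  have "P a b"
    using ab
  proof (induct rule: Bolzano)
    case (trans s m t)
    show ?case
      unfolding P_def
    proof (intro impI)
      assume st: "a \<le> s" "s \<le> t" "t \<le> b"
      have 1: "ennreal \<bar>\<psi> (\<Phi> m) - \<psi> (\<Phi> s)\<bar> \<le> (\<integral>\<^sup>+x\<in>{s..m}. ennreal (H x) \<partial>lborel)"
        and 2: "ennreal \<bar>\<psi> (\<Phi> t) - \<psi> (\<Phi> m)\<bar> \<le> (\<integral>\<^sup>+x\<in>{m..t}. ennreal (H x) \<partial>lborel)"
        using trans st unfolding P_def by auto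
      have "ennreal \<bar>\<psi> (\<Phi> t) - \<psi> (\<Phi> s)\<bar> \<le> ennreal (\<bar>\<psi> (\<Phi> m) - \<psi> (\<Phi> s)\<bar> + \<bar>\<psi> (\<Phi> t) - \<psi> (\<Phi> m)\<bar>)"
        by (rule ennreal_leI) linarith
      also have "\<dots> = ennreal \<bar>\<psi> (\<Phi> m) - \<psi> (\<Phi> s)\<bar> + ennreal \<bar>\<psi> (\<Phi> t) - \<psi> (\<Phi> m)\<bar>" by (rule ennreal_plus) auto
      also have "\<dots> \<le> (\<integral>\<^sup>+x\<in>{s..m}. ennreal (H x) \<partial>lborel) + (\<integral>\<^sup>+x\<in>{m..t}. ennreal (H x) \<partial>lborel)"
        by (rule add_mono[OF 1 2])
      also have "\<dots> = (\<integral>\<^sup>+x. ennreal (H x) * indicator {s..m} x + ennreal (H x) * indicator {m..t} x \<partial>lborel)"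
        by (rule nn_integral_add[symmetric]) measurable
      also have "\<dots> = (\<integral>\<^sup>+x\<in>{s..t}. ennreal (H x) \<partial>lborel)"
        by (rule nn_integral_cong_AE, use AE_lborel_singleton[of m] in eventually_elim)
          (use trans in \<open>auto simp: indicator_def\<close>)
      finally show "ennreal \<bar>\<psi> (\<Phi> t) - \<psi> (\<Phi> s)\<bar> \<le> (\<integral>\<^sup>+x\<in>{s..t}. ennreal (H x) \<partial>lborel)" .
    qed
  next
    case (local x)
    then have x: "x \<in> {a..b}" by auto
    show ?case
    proof (cases "\<alpha> \<le> Re (\<Phi> x) \<and> Re (\<Phi> x) \<le> \<beta>")
      case False
      obtain d where d: "d > 0" "\<And>s. s \<in> {a..b} \<Longrightarrow> \<bar>s - x\<bar> < d \<Longrightarrow> \<psi> (\<Phi> s) = \<psi> (\<Phi> x)"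
        using off[OF x False] by blast
      have "P s t" if "s \<le> x" "x \<le> t" "t - s < d" for s t
        unfolding P_def using d(2)[of s] d(2)[of t] that by auto
      then show ?thesis using d(1) by blast
    next
      case True
      define r where "r = norm (\<phi> x)"
      have rexp: "r = exp (Re (\<Phi> x))" using exp[OF x] by (metis norm_exp_eq_Re r_def)
      have r: "r > 0" by (simp add: rexp)
      \<comment> \<open>The radius r/8 keeps the relative increment \<open>u\<close> below 1/2, so
        that |Ln(1+u)| \<le> 2 |u|. The second neighbourhood keeps Im of the increment of \<Phi>
        below \<pi>, so that this principal logarithm is the actual increment.\<close>
      obtain d1 where d1: "d1 > 0" "\<And>s. s \<in> {a..b} \<Longrightarrow> \<bar>s - x\<bar> < d1 \<Longrightarrow> norm (\<phi> s - \<phi> x) < r / 8"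
        using cont\<phi> x r unfolding continuous_on_iff by (metis dist_norm real_norm_def divide_pos_pos zero_less_numeral)
      obtain d2 where d2: "d2 > 0" "\<And>s. s \<in> {a..b} \<Longrightarrow> \<bar>s - x\<bar> < d2 \<Longrightarrow> norm (\<Phi> s - \<Phi> x) < 1"
        using cont\<Phi> x unfolding continuous_on_iff by (metis dist_norm real_norm_def zero_less_one)
      have "P s t" if st: "s \<le> x" "x \<le> t" "t - s < min d1 d2" for s t
        unfolding P_def
      proof (intro impI)
        assume st': "a \<le> s" "s \<le> t" "t \<le> b"
        have near: "norm (\<phi> y - \<phi> x) < r / 8" "norm (\<Phi> y - \<Phi> x) < 1" if "y \<in> {s..t}" for y
          using d1(2)[of y] d2(2)[of y] st st' that by auto
        have size: "7 / 8 * r \<le> norm (\<phi> y)" "norm (\<phi> y) \<le> 9 / 8 * r" if "y \<in> {s..t}" for y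
          using near(1)[OF that] norm_triangle_ineq3[of "\<phi> y" "\<phi> x"] by (auto simp: r_def)
        have smem: "s \<in> {s..t}" "t \<in> {s..t}" "s \<in> {a..b}" "t \<in> {a..b}" using st' by auto
        define u where "u = (\<phi> t - \<phi> s) / \<phi> s"
        have \<phi>s: "\<phi> s \<noteq> 0" using exp[OF smem(3)] by (metis exp_not_eq_zero)
        have diff: "norm (\<phi> t - \<phi> s) < r / 4"
          using near(1)[OF smem(1)] near(1)[OF smem(2)] norm_triangle_ineq4[of "\<phi> t - \<phi> x" "\<phi> s - \<phi> x"] by simp
        have un: "norm u \<le> norm (\<phi> t - \<phi> s) / (7 / 8 * r)"
          unfolding u_def norm_divide using size(1)[OF smem(1)] r \<phi>s by (intro divide_left_mono mult_pos_pos) auto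
        also have "\<dots> < (r / 4) / (7 / 8 * r)" using diff r by (intro divide_strict_right_mono) auto
        also have "\<dots> < 1 / 2" using r by simp
        finally have u2: "norm u < 1 / 2" .
        have "exp (\<Phi> t - \<Phi> s) = 1 + u"
          unfolding exp_diff exp[OF smem(3)] exp[OF smem(4)] u_def using \<phi>s by (simp add: diff_divide_distrib)
        moreover have "\<bar>Im (\<Phi> t - \<Phi> s)\<bar> < 2"
          using near(2)[OF smem(1)] near(2)[OF smem(2)] abs_Im_le_cmod[of "\<Phi> t - \<Phi> x"] abs_Im_le_cmod[of "\<Phi> s - \<Phi> x"] by auto
        then have "Ln (exp (\<Phi> t - \<Phi> s)) = \<Phi> t - \<Phi> s"
          using pi_gt3 by (intro Ln_exp) auto
        ultimately have "\<Phi> t - \<Phi> s = Ln (1 + u)" by simp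
        then have "norm (\<Phi> t - \<Phi> s) \<le> 2 * norm u" using norm_Ln_le[OF u2] by simp
        also have "\<dots> \<le> 16 / (7 * r) * norm (\<phi> t - \<phi> s)" using un r by (simp add: field_simps)
        finally have "\<bar>\<psi> (\<Phi> t) - \<psi> (\<Phi> s)\<bar> \<le> 16 / (7 * r) * norm (\<phi> t - \<phi> s)"
          using lip[of "\<Phi> t" "\<Phi> s"] by linarith
        then have "ennreal \<bar>\<psi> (\<Phi> t) - \<psi> (\<Phi> s)\<bar> \<le> ennreal (16 / (7 * r) * norm (\<phi> t - \<phi> s))" by (rule ennreal_leI)
        also have "\<dots> = ennreal (16 / (7 * r)) * ennreal (norm (\<phi> t - \<phi> s))" using r by (intro ennreal_mult) auto
        also have "\<dots> \<le> ennreal (16 / (7 * r)) * (\<integral>\<^sup>+x\<in>{s..t}. ennreal (k x) \<partial>lborel)"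
          using st' by (intro mult_left_mono inc) auto
        also have "\<dots> = (\<integral>\<^sup>+x. ennreal (16 / (7 * r)) * (ennreal (k x) * indicator {s..t} x) \<partial>lborel)"
          by (rule nn_integral_cmult[symmetric]) measurable
        also have "\<dots> \<le> (\<integral>\<^sup>+x\<in>{s..t}. ennreal (H x) \<partial>lborel)"
        proof (rule nn_integral_mono)
          fix y
          show "ennreal (16 / (7 * r)) * (ennreal (k y) * indicator {s..t} y) \<le> ennreal (H y) * indicator {s..t} y"
          proof (cases "y \<in> {s..t}")
            case yst: True
            have e2: "2 \<le> exp (1::real)" using exp_ge_add_one_self[of 1] by simp
            \<comment> \<open>The moduli near x lie between r/2 and 2 r, and e \<ge> 2; widening the
              band by 1 on either side in logarithmic scale therefore contains them.\<close>
            have "exp (\<alpha> - 1) \<le> r / exp 1" using True by (simp add: rexp exp_diff divide_right_mono)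
            also have "\<dots> \<le> r / 2" using e2 r by (intro divide_left_mono) auto
            also have "\<dots> \<le> norm (\<phi> y)" using size(1)[OF yst] r by simp
            finally have l: "exp (\<alpha> - 1) \<le> norm (\<phi> y)" .
            have "norm (\<phi> y) \<le> r * 2" using size(2)[OF yst] r by simp
            also have "\<dots> \<le> exp \<beta> * exp 1" using True e2 r by (intro mult_mono) (auto simp: rexp)
            finally have u: "norm (\<phi> y) \<le> exp (\<beta> + 1)" by (simp add: exp_add)
            have pos: "norm (\<phi> y) > 0" using size(1)[OF yst] r by linarith
            have bw: "band_weight (\<alpha> - 1) (\<beta> + 1) (\<phi> y) = 1 / norm (\<phi> y)"
              using l u by (simp add: band_weight_def annulus_def)
            \<comment> \<open>Both sides are multiples of 1/r, with 16/7 \<le> 32/9; this fixes the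
              factor 4 of the statement.\<close>
            have "16 / (7 * r) \<le> 4 * (1 / (9 / 8 * r))" using r by (simp add: field_simps)
            also have "\<dots> \<le> 4 * (1 / norm (\<phi> y))"
              using frac_le[OF _ order_refl pos size(2)[OF yst], of 1] by simp
            finally have "16 / (7 * r) \<le> 4 * (1 / norm (\<phi> y))" .
            then have "16 / (7 * r) * k y \<le> 4 * (1 / norm (\<phi> y)) * k y" using k by (intro mult_right_mono) auto
            then have "ennreal (16 / (7 * r) * k y) \<le> ennreal (H y)" by (intro ennreal_leI) (simp add: H_def bw mult_ac)
            moreover have "ennreal (16 / (7 * r)) * ennreal (k y) = ennreal (16 / (7 * r) * k y)"
              using r k by (intro ennreal_mult[symmetric]) auto
            ultimately show ?thesis using yst by simp
          qed simp
        qed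
        finally show "ennreal \<bar>\<psi> (\<Phi> t) - \<psi> (\<Phi> s)\<bar> \<le> (\<integral>\<^sup>+x\<in>{s..t}. ennreal (H x) \<partial>lborel)" .
      qed
      then show ?thesis using d1(1) d2(1) by (intro exI[of _ "min d1 d2"]) auto
    qed
  qed
  then show ?thesis using ab unfolding P_def H_def by blast
qed

lemma h_bound_log:
  fixes \<Phi> f :: "complex \<Rightarrow> complex" and h :: "complex \<Rightarrow> real" and \<psi> :: "complex \<Rightarrow> real"
  assumes hb: "h_bound UNIV f (\<lambda>z. ennreal (h z))" and cont: "continuous_on UNIV f" and cont\<Phi>: "continuous_on U \<Phi>"
    and exp: "\<And>z. z \<in> U \<Longrightarrow> exp (\<Phi> z) = f z"
    and lip: "\<And>x y. \<bar>\<psi> x - \<psi> y\<bar> \<le> norm (x - y)"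
    and off: "\<And>z. z \<in> U \<Longrightarrow> \<not> (\<alpha> \<le> Re (\<Phi> z) \<and> Re (\<Phi> z) \<le> \<beta>) \<Longrightarrow> \<exists>d>0. \<forall>s\<in>U. norm (s - z) < d \<longrightarrow> \<psi> (\<Phi> s) = \<psi> (\<Phi> z)"
    and h: "\<And>x. 0 \<le> h x" and [measurable]: "h \<in> borel_measurable borel"
  shows "h_bound U (\<lambda>z. \<psi> (\<Phi> z)) (\<lambda>z. ennreal (4 * (h z * band_weight (\<alpha> - 1) (\<beta> + 1) (f z))))"
proof -
  have [measurable]: "f \<in> borel_measurable borel" using cont by (rule borel_measurable_continuous_onI)
  show ?thesis
    unfolding h_bound_def real_norm_def
  proof
    show "AE y in lborel. \<forall>a b. a \<le> b \<longrightarrow> (\<forall>x\<in>{a..b}. Complex x y \<in> U) \<longrightarrow>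
       ennreal \<bar>\<psi> (\<Phi> (Complex b y)) - \<psi> (\<Phi> (Complex a y))\<bar>
        \<le> (\<integral>\<^sup>+x\<in>{a..b}. ennreal (4 * (h (Complex x y) * band_weight (\<alpha> - 1) (\<beta> + 1) (f (Complex x y)))) \<partial>lborel)"
      using hb[unfolded h_bound_def, THEN conjunct2]
    proof eventually_elim
      case (elim y)
      show ?case
      proof (intro allI impI)
        fix a b :: real assume ab: "a \<le> b" and U: "\<forall>x\<in>{a..b}. Complex x y \<in> U"
        show "ennreal \<bar>\<psi> (\<Phi> (Complex b y)) - \<psi> (\<Phi> (Complex a y))\<bar>
          \<le> (\<integral>\<^sup>+x\<in>{a..b}. ennreal (4 * (h (Complex x y) * band_weight (\<alpha> - 1) (\<beta> + 1) (f (Complex x y)))) \<partial>lborel)"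
        proof (rule log_increment_line[where \<Phi>="\<lambda>x. \<Phi> (Complex x y)" and \<phi>="\<lambda>x. f (Complex x y)" and k="\<lambda>x. h (Complex x y)", OF ab])
          have c: "continuous_on A (\<lambda>x. Complex x y)" for A unfolding Complex_eq by (intro continuous_intros)
          show "continuous_on {a..b} (\<lambda>x. f (Complex x y))" by (rule continuous_on_compose2[OF cont c]) simp
          show "continuous_on {a..b} (\<lambda>x. \<Phi> (Complex x y))" by (rule continuous_on_compose2[OF cont\<Phi> c]) (use U in auto)
          show "ennreal (norm (f (Complex t y) - f (Complex s y))) \<le> (\<integral>\<^sup>+x\<in>{s..t}. ennreal (h (Complex x y)) \<partial>lborel)"
            if "a \<le> s" "s \<le> t" "t \<le> b" for s t using elim that by auto
          fix t assume t: "t \<in> {a..b}" "\<not> (\<alpha> \<le> Re (\<Phi> (Complex t y)) \<and> Re (\<Phi> (Complex t y)) \<le> \<beta>)"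
          obtain d where d: "d > 0" "\<And>s. s \<in> U \<Longrightarrow> norm (s - Complex t y) < d \<Longrightarrow> \<psi> (\<Phi> s) = \<psi> (\<Phi> (Complex t y))"
            using off[of "Complex t y"] t U by blast
          have "norm (Complex s y - Complex t y) = \<bar>s - t\<bar>" for s by (simp add: cmod_def)
          then show "\<exists>d>0. \<forall>s\<in>{a..b}. \<bar>s - t\<bar> < d \<longrightarrow> \<psi> (\<Phi> (Complex s y)) = \<psi> (\<Phi> (Complex t y))"
            using d U by (intro exI[of _ d]) auto
        qed (use exp U lip h in auto)
      qed
    qed
  qed measurable
qed

lemma acl_bound_log:
  fixes \<Phi> f :: "complex \<Rightarrow> complex" and h :: "complex \<Rightarrow> real" and \<psi> :: "complex \<Rightarrow> real"
  assumes acl: "acl_bound UNIV f (\<lambda>z. ennreal (h z))" and cont: "continuous_on UNIV f" and cont\<Phi>: "continuous_on U \<Phi>"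
    and exp: "\<And>z. z \<in> U \<Longrightarrow> exp (\<Phi> z) = f z"
    and lip: "\<And>x y. \<bar>\<psi> x - \<psi> y\<bar> \<le> norm (x - y)"
    and off: "\<And>z. z \<in> U \<Longrightarrow> \<not> (\<alpha> \<le> Re (\<Phi> z) \<and> Re (\<Phi> z) \<le> \<beta>) \<Longrightarrow> \<exists>d>0. \<forall>s\<in>U. norm (s - z) < d \<longrightarrow> \<psi> (\<Phi> s) = \<psi> (\<Phi> z)"
    and h: "\<And>x. 0 \<le> h x" and [measurable]: "h \<in> borel_measurable borel"
  shows "acl_bound U (\<lambda>z. \<psi> (\<Phi> z)) (\<lambda>z. ennreal (4 * (h z * band_weight (\<alpha> - 1) (\<beta> + 1) (f z))))"
  unfolding acl_bound_def
proof
  show "h_bound U (\<lambda>z. \<psi> (\<Phi> z)) (\<lambda>z. ennreal (4 * (h z * band_weight (\<alpha> - 1) (\<beta> + 1) (f z))))"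
    using acl unfolding acl_bound_def by (intro h_bound_log cont cont\<Phi> exp lip off h) auto
  have nf: "norm (flip s - flip z) = norm (s - z)" for s z by (simp add: cmod_def add.commute)
  show "h_bound (flip -` U) (\<lambda>z. \<psi> (\<Phi> (flip z))) (\<lambda>z. ennreal (4 * (h (flip z) * band_weight (\<alpha> - 1) (\<beta> + 1) (f (flip z)))))"
  proof (rule h_bound_log)
    show "h_bound UNIV (\<lambda>z. f (flip z)) (\<lambda>z. ennreal (h (flip z)))" using acl by (simp add: acl_bound_def)
    show "continuous_on UNIV (\<lambda>z. f (flip z))" "continuous_on (flip -` U) (\<lambda>z. \<Phi> (flip z))"
      by (auto intro!: continuous_on_compose2[OF cont] continuous_on_compose2[OF cont\<Phi>] continuous_intros)
    fix z assume z: "z \<in> flip -` U" "\<not> (\<alpha> \<le> Re (\<Phi> (flip z)) \<and> Re (\<Phi> (flip z)) \<le> \<beta>)"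
    obtain d where "d > 0" "\<And>s. s \<in> U \<Longrightarrow> norm (s - flip z) < d \<Longrightarrow> \<psi> (\<Phi> s) = \<psi> (\<Phi> (flip z))"
      using off[of "flip z"] z by blast
    then show "\<exists>d>0. \<forall>s\<in>flip -` U. norm (s - z) < d \<longrightarrow> \<psi> (\<Phi> (flip s)) = \<psi> (\<Phi> (flip z))"
      by (intro exI[of _ d]) (auto simp: nf)
  qed (use exp lip h in auto)
qed

section \<open>Chaining squares along a path in logarithmic coordinates\<close>

context finite_distortion_data
begin

text \<open>The condition is met in two ways: by truncation, which makes \<psi> constant near any
  value outside the band, or vacuously, when F never leaves the band on the region
  considered.\<close>

definition locally_const_off :: "(complex \<Rightarrow> complex) \<Rightarrow> (complex \<Rightarrow> real) \<Rightarrow> real \<Rightarrow> real \<Rightarrow> complex \<Rightarrow> bool" where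
  "locally_const_off F \<psi> \<alpha> \<beta> w \<longleftrightarrow> \<not> (\<alpha> \<le> Re (F w) \<and> Re (F w) \<le> \<beta>) \<longrightarrow>
     (\<exists>d>0. \<forall>w'. norm (w' - w) < d \<longrightarrow> \<psi> (F w') = \<psi> (F w))"

text \<open>The size of d log f divided by |z|. Integrated over a square of side comparable to |z|,
  this bounds the oscillation of the logarithm without further scaling.\<close>

definition density :: "real \<Rightarrow> real \<Rightarrow> complex \<Rightarrow> real" where
  "density \<alpha> \<beta> z = h z * band_weight (\<alpha> - 1) (\<beta> + 1) (f z) / norm z"

lemma density_measurable[measurable]: "density \<alpha> \<beta> \<in> borel_measurable borel"
  unfolding density_def[abs_def] by measurable

lemma h_nonneg[simp]: "0 \<le> h z" by (simp add: h_def)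

lemma density_nonneg[simp]: "0 \<le> density \<alpha> \<beta> z" by (simp add: density_def)

text \<open>\<open>F\<close> is the logarithm of \<open>f\<close> in logarithmic coordinates. On a square around \<open>exp w0\<close> that avoids the
  origin it induces an injective branch of \<open>log f\<close>, to which the maximum principle applies.\<close>
lemma log_oscillation_step:
  fixes F :: "complex \<Rightarrow> complex" and \<kappa> :: "real \<Rightarrow> real"
  assumes contF: "continuous_on UNIV F" and expF: "\<And>w. exp (F w) = f (exp w)"
    and \<kappa>: "mono \<kappa>" "\<And>x y. \<bar>\<kappa> x - \<kappa> y\<bar> \<le> \<bar>x - y\<bar>" and c: "norm c = 1"
    and off: "\<And>w'. \<bar>Re w' - Re w0\<bar> \<le> 1 \<Longrightarrow> locally_const_off F (\<lambda>\<zeta>. \<kappa> (Re (c * \<zeta>))) \<alpha> \<beta> w'"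
    and w: "norm (w - w0) \<le> 1 / 16"
  shows "ennreal \<bar>\<kappa> (Re (c * F w)) - \<kappa> (Re (c * F w0))\<bar> \<le> 1536 * (\<integral>\<^sup>+z\<in>annulus (Re w0 - 1) (Re w0 + 1). ennreal (density \<alpha> \<beta> z) \<partial>lborel)"
proof -
  define \<psi> where "\<psi> = (\<lambda>\<zeta>. \<kappa> (Re (c * \<zeta>)))"
  define z0 where "z0 = exp w0"
  have z0: "norm z0 > 0" "z0 \<noteq> 0" and nz0: "norm z0 = exp (Re w0)" by (simp_all add: z0_def)
  \<comment> \<open>With half-side |z0|/4, the doubled square stays within |z0|/2 of z0. It avoids
    the origin, z/z0 has positive real part, so a branch of the logarithm exists, and the
    logarithmic radius changes by at most 1.\<close>
  define q where "q = norm z0 / 8"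
  have q: "q > 0" using z0 by (simp add: q_def)
  define U where "U = sq z0 (2 * q)"
  have near: "norm (z - z0) \<le> norm z0 / 2" if "z \<in> U" for z
    using cmod_le[of "z - z0"] that by (auto simp: U_def sq_def q_def)
  have ratio: "norm (z / z0 - 1) \<le> 1 / 2" if "z \<in> U" for z
  proof -
    have "z / z0 - 1 = (z - z0) / z0" using z0 by (simp add: diff_divide_distrib)
    then show ?thesis using near[OF that] z0 by (simp add: norm_divide divide_le_eq)
  qed
  have Re_pos: "Re (z / z0) > 0" if "z \<in> U" for z
    using ratio[OF that] abs_Re_le_cmod[of "z / z0 - 1"] by auto
  define l where "l = (\<lambda>z. w0 + Ln (z / z0))"
  have nz: "z \<noteq> 0" if "z \<in> U" for z using Re_pos[OF that] by auto
  have expl: "exp (l z) = z" if "z \<in> U" for z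
    using nz[OF that] z0 by (simp add: l_def exp_add z0_def[symmetric])
  have contl: "continuous_on U l"
    unfolding l_def
  proof (intro continuous_intros)
    show "z / z0 \<notin> \<real>\<^sub>\<le>\<^sub>0" if "z \<in> U" for z using Re_pos[OF that] by (auto simp: complex_nonpos_Reals_iff)
  qed (use z0 in auto)
  define \<Phi> where "\<Phi> = (\<lambda>z. F (l z))"
  have cont\<Phi>: "continuous_on U \<Phi>" unfolding \<Phi>_def by (rule continuous_on_compose2[OF contF contl]) simp
  have exp\<Phi>: "exp (\<Phi> z) = f z" if "z \<in> U" for z using expF[of "l z"] expl[OF that] by (simp add: \<Phi>_def)
  have inj\<Phi>: "inj_on \<Phi> U"
  proof (rule inj_onI)
    fix x y assume "x \<in> U" "y \<in> U" "\<Phi> x = \<Phi> y"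
    then have "f x = f y" using exp\<Phi> by metis
    then show "x = y" using inj by (simp add: inj_eq)
  qed
  have lip: "\<bar>\<psi> x - \<psi> y\<bar> \<le> norm (x - y)" for x y
  proof -
    have "\<bar>\<psi> x - \<psi> y\<bar> \<le> \<bar>Re (c * (x - y))\<bar>" using \<kappa>(2)[of "Re (c * x)" "Re (c * y)"] by (simp add: \<psi>_def algebra_simps)
    also have "\<dots> \<le> norm (c * (x - y))" by (rule abs_Re_le_cmod)
    finally show ?thesis using c by (simp add: norm_mult)
  qed
  have ann: "z \<in> annulus (Re w0 - 1) (Re w0 + 1)" if "z \<in> U" for z
  proof -
    have e2: "2 \<le> exp (1::real)" using exp_ge_add_one_self[of 1] by simp
    have "norm z \<ge> norm z0 / 2" "norm z \<le> norm z0 * 2" using near[OF that] norm_triangle_ineq3[of z z0] by linarith+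
    moreover have "exp (Re w0 - 1) \<le> norm z0 / 2" unfolding exp_diff nz0 using e2 by (intro divide_left_mono) auto
    moreover have "norm z0 * 2 \<le> exp (Re w0 + 1)" unfolding exp_add nz0 using e2 by (intro mult_left_mono) auto
    ultimately show ?thesis by (simp add: annulus_def)
  qed
  have Rel: "\<bar>Re (l z) - Re w0\<bar> \<le> 1" if "z \<in> U" for z
  proof -
    have "norm z = exp (Re (l z))" using expl[OF that] by (metis norm_exp_eq_Re)
    then have "exp (Re w0 - 1) \<le> exp (Re (l z))" "exp (Re (l z)) \<le> exp (Re w0 + 1)" using ann[OF that] by (auto simp: annulus_def)
    then show ?thesis by auto
  qed
  have acl: "acl_bound U (\<lambda>z. \<psi> (\<Phi> z)) (\<lambda>z. ennreal (4 * (h z * band_weight (\<alpha> - 1) (\<beta> + 1) (f z))))"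
  proof (rule acl_bound_log[OF acl_bound_f cont cont\<Phi> exp\<Phi> lip])
    fix z assume z: "z \<in> U" and "\<not> (\<alpha> \<le> Re (\<Phi> z) \<and> Re (\<Phi> z) \<le> \<beta>)"
    then obtain d where d: "d > 0" "\<And>w'. norm (w' - l z) < d \<Longrightarrow> \<psi> (F w') = \<psi> (F (l z))"
      using off[OF Rel[OF z]] unfolding locally_const_off_def \<Phi>_def \<psi>_def by blast
    obtain e where "e > 0" "\<And>s. s \<in> U \<Longrightarrow> norm (s - z) < e \<Longrightarrow> norm (l s - l z) < d"
      using contl z d(1) unfolding continuous_on_iff by (metis dist_norm)
    then show "\<exists>d>0. \<forall>s\<in>U. norm (s - z) < d \<longrightarrow> \<psi> (\<Phi> s) = \<psi> (\<Phi> z)"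
      using d(2) unfolding \<Phi>_def by blast
  qed auto
  have mono: "square_monotone U (\<lambda>z. \<psi> (\<Phi> z))"
    unfolding \<psi>_def by (rule square_monotone_injective[OF cont\<Phi> inj\<Phi> _ \<kappa>(1)]) (use c in auto)
  \<comment> \<open>A displacement of 1/16 in logarithmic coordinates moves the point by at most
    3/32 of |z0|, less than the half-side |z0|/8 of the inner square.\<close>
  have wq: "exp w \<in> sq z0 q"
  proof -
    have "exp w - z0 = z0 * (exp (w - w0) - 1)" by (simp add: z0_def exp_diff algebra_simps)
    then have "norm (exp w - z0) = norm z0 * norm (exp (w - w0) - 1)" by (simp add: norm_mult)
    also have "\<dots> \<le> norm z0 * (3 / 2 * norm (w - w0))" using w by (intro mult_left_mono norm_exp_bounds) auto
    also have "\<dots> \<le> norm z0 * (3 / 2 * (1 / 16))" using w by (intro mult_left_mono) auto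
    also have "\<dots> \<le> q" using z0 by (simp add: q_def)
    finally show ?thesis using abs_Re_le_cmod[of "exp w - z0"] abs_Im_le_cmod[of "exp w - z0"] by (auto simp: sq_def)
  qed
  have \<Phi>w: "\<Phi> (exp w) = F w"
  proof -
    have "\<bar>Im (w - w0)\<bar> \<le> 1 / 16" using w abs_Im_le_cmod[of "w - w0"] by linarith
    then have "Ln (exp (w - w0)) = w - w0" using pi_gt3 by (intro Ln_exp) linarith+
    moreover have "exp w / z0 = exp (w - w0)" by (simp add: z0_def exp_diff)
    ultimately show ?thesis by (simp add: \<Phi>_def l_def)
  qed
  have \<Phi>w0: "\<Phi> z0 = F w0" using z0 by (simp add: \<Phi>_def l_def)
  have z0q: "z0 \<in> sq z0 q" using q by (simp add: sq_def)
  define I where "I = (\<integral>\<^sup>+z\<in>annulus (Re w0 - 1) (Re w0 + 1). ennreal (density \<alpha> \<beta> z) \<partial>lborel)"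
  have "ennreal (q * \<bar>\<psi> (F w) - \<psi> (F w0)\<bar>) \<le> 16 * (\<integral>\<^sup>+z\<in>sq z0 (2 * q). ennreal (4 * (h z * band_weight (\<alpha> - 1) (\<beta> + 1) (f z))) \<partial>lborel)"
    using square_monotone_osc[OF acl[unfolded U_def] mono[unfolded U_def] q wq z0q] by (simp add: \<Phi>w \<Phi>w0)
  also have "(\<integral>\<^sup>+z\<in>sq z0 (2 * q). ennreal (4 * (h z * band_weight (\<alpha> - 1) (\<beta> + 1) (f z))) \<partial>lborel)
    \<le> (\<integral>\<^sup>+z. ennreal (12 * norm z0) * (ennreal (density \<alpha> \<beta> z) * indicator (annulus (Re w0 - 1) (Re w0 + 1)) z) \<partial>lborel)"
  proof (rule nn_integral_mono)
    fix z
    show "ennreal (4 * (h z * band_weight (\<alpha> - 1) (\<beta> + 1) (f z))) * indicator (sq z0 (2 * q)) z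
      \<le> ennreal (12 * norm z0) * (ennreal (density \<alpha> \<beta> z) * indicator (annulus (Re w0 - 1) (Re w0 + 1)) z)"
    proof (cases "z \<in> U")
      case True
      have "norm z \<le> 3 * norm z0" using near[OF True] norm_triangle_ineq3[of z z0] z0 by linarith
      then have "1 \<le> 3 * norm z0 / norm z" using nz[OF True] by (simp add: le_divide_eq)
      from mult_left_mono[OF this, of "4 * (h z * band_weight (\<alpha> - 1) (\<beta> + 1) (f z))"]
      have "4 * (h z * band_weight (\<alpha> - 1) (\<beta> + 1) (f z)) \<le> 4 * (h z * band_weight (\<alpha> - 1) (\<beta> + 1) (f z)) * (3 * norm z0 / norm z)"
        by simp
      also have "\<dots> = 12 * norm z0 * density \<alpha> \<beta> z" by (simp add: density_def)
      finally have "ennreal (4 * (h z * band_weight (\<alpha> - 1) (\<beta> + 1) (f z))) \<le> ennreal (12 * norm z0) * ennreal (density \<alpha> \<beta> z)"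
        by (subst ennreal_mult[symmetric]) (auto intro: ennreal_leI)
      then show ?thesis using True ann[OF True] by (simp add: U_def)
    qed (simp add: U_def)
  qed
  also have "\<dots> = ennreal (12 * norm z0) * I" unfolding I_def by (rule nn_integral_cmult) measurable
  finally have main: "ennreal (q * \<bar>\<psi> (F w) - \<psi> (F w0)\<bar>) \<le> 16 * (ennreal (12 * norm z0) * I)"
    by (simp add: mult_left_mono)
  have "ennreal \<bar>\<psi> (F w) - \<psi> (F w0)\<bar> = ennreal (1 / q) * ennreal (q * \<bar>\<psi> (F w) - \<psi> (F w0)\<bar>)"
    using q by (subst ennreal_mult[symmetric]) auto
  also have "\<dots> \<le> ennreal (1 / q) * (16 * (ennreal (12 * norm z0) * I))" by (intro mult_left_mono main) simp
  also have "\<dots> = (ennreal (1 / q) * (ennreal 16 * ennreal (12 * norm z0))) * I" by (simp add: mult_ac)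
  also have "\<dots> = ennreal (1 / q * (16 * (12 * norm z0))) * I"
    using q by (subst ennreal_mult[symmetric], simp, simp, subst ennreal_mult[symmetric]) auto
  \<comment> \<open>The factors are 8 from 1/q, 16 from the oscillation lemma, and 12 = 4 * 3: the 4
    of the line estimate and the comparison |z| \<le> 3 |z0|.\<close>
  also have "1 / q * (16 * (12 * norm z0)) = 1536" using z0 by (simp add: q_def)
  finally show ?thesis by (simp add: I_def \<psi>_def)
qed

lemma log_oscillation_strip:
  fixes F :: "complex \<Rightarrow> complex" and \<kappa> :: "real \<Rightarrow> real"
  assumes contF: "continuous_on UNIV F" and expF: "\<And>w. exp (F w) = f (exp w)"
    and \<kappa>: "mono \<kappa>" "\<And>x y. \<bar>\<kappa> x - \<kappa> y\<bar> \<le> \<bar>x - y\<bar>" and c: "norm c = 1"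
    and off: "\<And>w'. a - 2 \<le> Re w' \<Longrightarrow> Re w' \<le> a + 1 \<Longrightarrow> locally_const_off F (\<lambda>\<zeta>. \<kappa> (Re (c * \<zeta>))) \<alpha> \<beta> w'"
    and w0: "a - 1 \<le> Re w0" "Re w0 \<le> a" and w1: "a - 1 \<le> Re w1" "Re w1 \<le> a" and w: "norm (w1 - w0) \<le> 8"
  shows "ennreal \<bar>\<kappa> (Re (c * F w1)) - \<kappa> (Re (c * F w0))\<bar> \<le> 196608 * (\<integral>\<^sup>+z\<in>annulus (a - 2) (a + 1). ennreal (density \<alpha> \<beta> z) \<partial>lborel)"
proof -
  define v where "v = (\<lambda>w. \<kappa> (Re (c * F w)))"
  define I where "I = (\<integral>\<^sup>+z\<in>annulus (a - 2) (a + 1). ennreal (density \<alpha> \<beta> z) \<partial>lborel)"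
  \<comment> \<open>128 steps of length at most 1/16\<close>
  define p where "p = (\<lambda>j::nat. w0 + (real j / 128) *\<^sub>R (w1 - w0))"
  have Rep: "a - 1 \<le> Re (p j)" "Re (p j) \<le> a" if "j \<le> 128" for j
  proof -
    have t: "0 \<le> real j / 128" "real j / 128 \<le> 1" using that by auto
    have "Re (p j) = (1 - real j / 128) * Re w0 + (real j / 128) * Re w1" by (simp add: p_def algebra_simps)
    then show "a - 1 \<le> Re (p j)" "Re (p j) \<le> a"
      using convex_bound_le[of "Re w0" a "Re w1" "1 - real j / 128" "real j / 128"]
        convex_bound_le[of "- Re w0" "1 - a" "- Re w1" "1 - real j / 128" "real j / 128"] t w0 w1 by auto
  qed
  have step: "ennreal \<bar>v (p (Suc j)) - v (p j)\<bar> \<le> 1536 * I" if j: "j < 128" for j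
  proof -
    have "ennreal \<bar>v (p (Suc j)) - v (p j)\<bar> \<le> 1536 * (\<integral>\<^sup>+z\<in>annulus (Re (p j) - 1) (Re (p j) + 1). ennreal (density \<alpha> \<beta> z) \<partial>lborel)"
      unfolding v_def
    proof (rule log_oscillation_step[OF contF expF \<kappa> c])
      fix w' assume "\<bar>Re w' - Re (p j)\<bar> \<le> 1"
      then show "locally_const_off F (\<lambda>\<zeta>. \<kappa> (Re (c * \<zeta>))) \<alpha> \<beta> w'"
        using Rep[of j] j by (intro off) auto
    next
      have "p (Suc j) - p j = (1 / 128) *\<^sub>R (w1 - w0)" by (simp add: p_def scaleR_left_diff_distrib[symmetric] diff_divide_distrib[symmetric])
      then show "norm (p (Suc j) - p j) \<le> 1 / 16" using w by simp
    qed
    also have "\<dots> \<le> 1536 * I" unfolding I_def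
    proof (intro mult_left_mono nn_integral_mono)
      fix z
      have "annulus (Re (p j) - 1) (Re (p j) + 1) \<subseteq> annulus (a - 2) (a + 1)"
        using Rep[of j] j by (auto simp: annulus_def elim!: order_trans[rotated] order_trans)
      then show "indicator (annulus (Re (p j) - 1) (Re (p j) + 1)) z \<le> (indicator (annulus (a - 2) (a + 1)) z :: ennreal)"
        by (auto simp: indicator_def)
    qed auto
    finally show ?thesis .
  qed
  have "ennreal \<bar>v (p n) - v (p 0)\<bar> \<le> of_nat n * (1536 * I)" if "n \<le> 128" for n
    using that
  proof (induction n)
    case (Suc n)
    have "ennreal \<bar>v (p (Suc n)) - v (p 0)\<bar> \<le> ennreal (\<bar>v (p (Suc n)) - v (p n)\<bar> + \<bar>v (p n) - v (p 0)\<bar>)"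
      by (intro ennreal_leI) linarith
    also have "\<dots> = ennreal \<bar>v (p (Suc n)) - v (p n)\<bar> + ennreal \<bar>v (p n) - v (p 0)\<bar>" by (rule ennreal_plus) auto
    also have "\<dots> \<le> 1536 * I + of_nat n * (1536 * I)" using Suc by (intro add_mono step) auto
    also have "\<dots> = of_nat (Suc n) * (1536 * I)" by (simp add: distrib_right)
    finally show ?case .
  qed simp
  from this[of 128] have "ennreal \<bar>v (p 128) - v (p 0)\<bar> \<le> 128 * (1536 * I)" by simp
  also have "128 * (1536 * I) = 196608 * I" by (simp add: mult.assoc[symmetric])
  finally show ?thesis by (simp add: p_def v_def I_def)
qed

text \<open>The path goes vertically from 0 to \<i>\<theta> and then left in unit steps to -T +
  \<i>\<theta>. The annuli belonging to the steps overlap at most four times, so their integrals add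
  up to a multiple of a single one and no factor T is lost.\<close>

lemma log_oscillation:
  fixes F :: "complex \<Rightarrow> complex" and \<kappa> :: "real \<Rightarrow> real"
  assumes contF: "continuous_on UNIV F" and expF: "\<And>w. exp (F w) = f (exp w)"
    and \<kappa>: "mono \<kappa>" "\<And>x y. \<bar>\<kappa> x - \<kappa> y\<bar> \<le> \<bar>x - y\<bar>" and c: "norm c = 1"
    and off: "\<And>w'. - T - 3 \<le> Re w' \<Longrightarrow> Re w' \<le> 1 \<Longrightarrow> locally_const_off F (\<lambda>\<zeta>. \<kappa> (Re (c * \<zeta>))) \<alpha> \<beta> w'"
    and T: "0 \<le> T" and \<theta>: "\<bar>\<theta>\<bar> \<le> pi"
  shows "ennreal \<bar>\<kappa> (Re (c * F (Complex (- T) \<theta>))) - \<kappa> (Re (c * F 0))\<bar>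
    \<le> 1572864 * (\<integral>\<^sup>+z\<in>annulus (- T - 3) 1. ennreal (density \<alpha> \<beta> z) \<partial>lborel)"
proof -
  define v where "v = (\<lambda>w. \<kappa> (Re (c * F w)))"
  define I where "I = (\<lambda>j::nat. \<integral>\<^sup>+z\<in>annulus (- real j - 2) (- real j + 1). ennreal (density \<alpha> \<beta> z) \<partial>lborel)"
  define n where "n = Suc (nat \<lceil>T\<rceil>)"
  have n: "T \<le> real n" "real n \<le> T + 2" "n \<ge> 1" using T unfolding n_def by linarith+
  \<comment> \<open>The minimum stops the path at -T; later points coincide and contribute
    nothing.\<close>
  define p where "p = (\<lambda>j::nat. Complex (- min (real j) T) \<theta>)"
  have strip: "ennreal \<bar>v w1 - v w0\<bar> \<le> 196608 * I j"
    if "j < n" "- real j - 1 \<le> Re w0" "Re w0 \<le> - real j" "- real j - 1 \<le> Re w1" "Re w1 \<le> - real j" "norm (w1 - w0) \<le> 8" for j w0 w1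
    unfolding v_def I_def
  proof (rule log_oscillation_strip[OF contF expF \<kappa> c])
    fix w' assume "- real j - 2 \<le> Re w'" "Re w' \<le> - real j + 1"
    then show "locally_const_off F (\<lambda>\<zeta>. \<kappa> (Re (c * \<zeta>))) \<alpha> \<beta> w'" using that(1) n by (intro off) auto
  qed (use that in auto)
  have first: "ennreal \<bar>v (p 0) - v 0\<bar> \<le> 196608 * I 0"
    by (rule strip) (use n \<theta> T pi_less_4 in \<open>auto simp: p_def cmod_def\<close>)
  have step: "ennreal \<bar>v (p (Suc j)) - v (p j)\<bar> \<le> 196608 * I j" if j: "j < n" for j
  proof (cases "real j \<le> T")
    case True
    then show ?thesis by (intro strip j) (auto simp: p_def cmod_def)
  next
    case False
    then have "p (Suc j) = p j" by (simp add: p_def)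
    then show ?thesis by simp
  qed
  have sum: "ennreal \<bar>v (p m) - v 0\<bar> \<le> 196608 * I 0 + (\<Sum>j<m. 196608 * I j)" if "m \<le> n" for m
    using that
  proof (induction m)
    case 0 then show ?case using first by simp
  next
    case (Suc m)
    have "ennreal \<bar>v (p (Suc m)) - v 0\<bar> \<le> ennreal (\<bar>v (p m) - v 0\<bar> + \<bar>v (p (Suc m)) - v (p m)\<bar>)"
      by (intro ennreal_leI) linarith
    also have "\<dots> = ennreal \<bar>v (p m) - v 0\<bar> + ennreal \<bar>v (p (Suc m)) - v (p m)\<bar>" by (rule ennreal_plus) auto
    also have "\<dots> \<le> (196608 * I 0 + (\<Sum>j<m. 196608 * I j)) + 196608 * I m" using Suc by (intro add_mono step) auto
    finally show ?case by (simp add: add.assoc)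
  qed
  have pn: "p n = Complex (- T) \<theta>" using n by (simp add: p_def)
  \<comment> \<open>The additional \<open>I 0\<close> of the vertical segment is absorbed by
    doubling the sum; doubling and the overlap 4 give 2 * 4 * 196608 = 1572864.\<close>
  have "I 0 \<le> (\<Sum>j<n. I j)" using n by (intro member_le_sum) auto
  then have "196608 * I 0 \<le> 196608 * (\<Sum>j<n. I j)" by (rule mult_left_mono) simp
  moreover have "ennreal \<bar>v (Complex (- T) \<theta>) - v 0\<bar> \<le> 196608 * I 0 + 196608 * (\<Sum>j<n. I j)"
    using sum[of n] by (simp add: pn sum_distrib_left)
  ultimately have 1: "ennreal \<bar>v (Complex (- T) \<theta>) - v 0\<bar> \<le> 196608 * (\<Sum>j<n. I j) + 196608 * (\<Sum>j<n. I j)"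
    by (meson add_right_mono order_trans)
  also have "\<dots> = 393216 * (\<Sum>j<n. I j)" by (simp add: distrib_right[symmetric])
  also have "(\<Sum>j<n. I j) = (\<integral>\<^sup>+z. (\<Sum>j<n. ennreal (density \<alpha> \<beta> z) * indicator (annulus (- real j - 2) (- real j + 1)) z) \<partial>lborel)"
    unfolding I_def by (rule nn_integral_sum[symmetric]) measurable
  also have "\<dots> \<le> (\<integral>\<^sup>+z. 4 * (ennreal (density \<alpha> \<beta> z) * indicator (annulus (- T - 3) 1) z) \<partial>lborel)"
  proof (rule nn_integral_mono)
    fix z
    let ?S = "{j. j < n \<and> z \<in> annulus (- real j - 2) (- real j + 1)}"
    have cS: "card ?S \<le> 4"
    proof (cases "z = 0")
      case True
      then have "z \<notin> annulus a b" for a b by (simp add: annulus_def not_le)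
      then show ?thesis by simp
    next
      case False
      define l where "l = ln (norm z)"
      have nz: "norm z = exp l" using False by (simp add: l_def)
      \<comment> \<open>An index j counts only if -2 - l \<le> j \<le> 1 - l with l = ln |z|, an
        interval of length 3 containing at most four integers.\<close>
      define m where "m = \<lceil>- 2 - l\<rceil>"
      have "int ` ?S \<subseteq> {m..m+3}"
      proof
        fix i assume "i \<in> int ` ?S"
        then obtain j where j: "i = int j" "- real j - 2 \<le> l" "l \<le> - real j + 1" by (auto simp: annulus_def nz)
        then show "i \<in> {m..m+3}" unfolding m_def by (simp add: ceiling_le_iff) linarith
      qed
      then have "card (int ` ?S) \<le> card {m..m+3}" by (rule card_mono[rotated]) simp
      then show ?thesis by (simp add: card_image)
    qed
    have "(\<Sum>j<n. ennreal (density \<alpha> \<beta> z) * indicator (annulus (- real j - 2) (- real j + 1)) z)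
      = (\<Sum>j\<in>?S. ennreal (density \<alpha> \<beta> z) * indicator (annulus (- T - 3) 1) z)"
    proof (rule sum.mono_neutral_cong_right)
      show "\<forall>j\<in>{..<n} - ?S. ennreal (density \<alpha> \<beta> z) * indicator (annulus (- real j - 2) (- real j + 1)) z = 0" by auto
      fix j assume j: "j \<in> ?S"
      have "annulus (- real j - 2) (- real j + 1) \<subseteq> annulus (- T - 3) 1"
      proof
        fix y assume y: "y \<in> annulus (- real j - 2) (- real j + 1)"
        have "exp (- T - 3) \<le> exp (- real j - 2)" "exp (- real j + 1) \<le> exp 1" using j n by auto
        then show "y \<in> annulus (- T - 3) 1" using y unfolding annulus_def mem_Collect_eq by linarith
      qed
      then show "ennreal (density \<alpha> \<beta> z) * indicator (annulus (- real j - 2) (- real j + 1)) z = ennreal (density \<alpha> \<beta> z) * indicator (annulus (- T - 3) 1) z"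
        using j by auto
    qed auto
    also have "\<dots> = of_nat (card ?S) * (ennreal (density \<alpha> \<beta> z) * indicator (annulus (- T - 3) 1) z)" by simp
    also have "\<dots> \<le> of_nat 4 * (ennreal (density \<alpha> \<beta> z) * indicator (annulus (- T - 3) 1) z)"
      using cS by (intro mult_right_mono of_nat_mono) auto
    finally show "(\<Sum>j<n. ennreal (density \<alpha> \<beta> z) * indicator (annulus (- real j - 2) (- real j + 1)) z)
      \<le> 4 * (ennreal (density \<alpha> \<beta> z) * indicator (annulus (- T - 3) 1) z)" by simp
  qed
  also have "\<dots> = 4 * (\<integral>\<^sup>+z\<in>annulus (- T - 3) 1. ennreal (density \<alpha> \<beta> z) \<partial>lborel)"
    by (rule nn_integral_cmult) measurable
  finally have "ennreal \<bar>v (Complex (- T) \<theta>) - v 0\<bar> \<le> 393216 * (4 * (\<integral>\<^sup>+z\<in>annulus (- T - 3) 1. ennreal (density \<alpha> \<beta> z) \<partial>lborel))"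
    by (simp add: mult_left_mono)
  also have "\<dots> = 1572864 * (\<integral>\<^sup>+z\<in>annulus (- T - 3) 1. ennreal (density \<alpha> \<beta> z) \<partial>lborel)"
    by (simp add: mult.assoc[symmetric])
  finally show ?thesis by (simp add: v_def)
qed

end

section \<open>Modulus and argument of the mapping\<close>

context finite_distortion_data
begin

text \<open>The path estimate, Young's inequality and exponential integrability in one formula. T +
  3 comes from the annuli reaching beyond the end of the path, \<beta> - \<alpha> + 3 from the band
  widened by 1 at both ends plus the 1 of the logarithmic area bound.\<close>

lemma oscillation_bound:
  fixes F :: "complex \<Rightarrow> complex" and \<kappa> :: "real \<Rightarrow> real"
  assumes contF: "continuous_on UNIV F" and expF: "\<And>w. exp (F w) = f (exp w)"
    and \<kappa>: "mono \<kappa>" "\<And>x y. \<bar>\<kappa> x - \<kappa> y\<bar> \<le> \<bar>x - y\<bar>" and c: "norm c = 1"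
    and off: "\<And>w'. - T - 3 \<le> Re w' \<Longrightarrow> Re w' \<le> 1 \<Longrightarrow> locally_const_off F (\<lambda>\<zeta>. \<kappa> (Re (c * \<zeta>))) \<alpha> \<beta> w'"
    and T: "0 \<le> T" and \<theta>: "\<bar>\<theta>\<bar> \<le> pi" and ab: "\<alpha> \<le> \<beta>" and lm: "lm > 0"
    and p: "p > 0" and E: "(\<integral>\<^sup>+z\<in>cball 0 (exp 1). ennreal (exp (p * K z)) \<partial>lborel) \<le> ennreal E" "0 \<le> E"
  shows "\<bar>\<kappa> (Re (c * F (Complex (- T) \<theta>))) - \<kappa> (Re (c * F 0))\<bar>
    \<le> 1572864 * (lm * ((E + 72 * (T + 3) * (T + 5)) / p) + 36 * (\<beta> - \<alpha> + 3) / lm)"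
proof -
  have "(\<integral>\<^sup>+z\<in>annulus (- T - 3) 1. ennreal (density \<alpha> \<beta> z) \<partial>lborel) \<le>
    ennreal lm * (\<integral>\<^sup>+z\<in>annulus (- T - 3) 1. ennreal (K z / (norm z)\<^sup>2) \<partial>lborel) + ennreal (36 * (\<beta> + 1 - (\<alpha> - 1) + 1) / lm)"
    unfolding density_def by (rule energy_bound) (use ab lm in auto)
  also have "(\<integral>\<^sup>+z\<in>annulus (- T - 3) 1. ennreal (K z / (norm z)\<^sup>2) \<partial>lborel) \<le> ennreal ((E + 72 * (T + 3) * (T + 3 + 2)) / p)"
    using exp_weight_bound[OF K_measurable p _ E, of "T + 3"] T by simp
  also have "ennreal lm * ennreal ((E + 72 * (T + 3) * (T + 3 + 2)) / p) + ennreal (36 * (\<beta> + 1 - (\<alpha> - 1) + 1) / lm)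
     = ennreal (lm * ((E + 72 * (T + 3) * (T + 5)) / p) + 36 * (\<beta> - \<alpha> + 3) / lm)"
    using lm T p E(2) ab by (subst ennreal_mult[symmetric], simp, simp, subst ennreal_plus[symmetric]) (auto simp: algebra_simps)
  finally have I: "(\<integral>\<^sup>+z\<in>annulus (- T - 3) 1. ennreal (density \<alpha> \<beta> z) \<partial>lborel)
     \<le> ennreal (lm * ((E + 72 * (T + 3) * (T + 5)) / p) + 36 * (\<beta> - \<alpha> + 3) / lm)"
    by (simp add: mult_left_mono add_right_mono)
  have "ennreal \<bar>\<kappa> (Re (c * F (Complex (- T) \<theta>))) - \<kappa> (Re (c * F 0))\<bar>
    \<le> 1572864 * (\<integral>\<^sup>+z\<in>annulus (- T - 3) 1. ennreal (density \<alpha> \<beta> z) \<partial>lborel)"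
    by (rule log_oscillation[OF contF expF \<kappa> c off T \<theta>])
  also have "\<dots> \<le> ennreal 1572864 * ennreal (lm * ((E + 72 * (T + 3) * (T + 5)) / p) + 36 * (\<beta> - \<alpha> + 3) / lm)"
    using I by (simp add: mult_left_mono)
  also have "\<dots> = ennreal (1572864 * (lm * ((E + 72 * (T + 3) * (T + 5)) / p) + 36 * (\<beta> - \<alpha> + 3) / lm))"
    by (rule ennreal_mult'[symmetric]) simp
  finally show ?thesis
    by (subst (asm) ennreal_le_iff) (use lm T p E(2) ab in \<open>auto intro!: add_nonneg_nonneg divide_nonneg_pos mult_nonneg_nonneg\<close>)
qed

text \<open>The oscillation of \<open>log |f|\<close>, truncated to the band between \<open>log |f(z)|\<close> and \<open>0\<close>, controls the width of
  this band by its area, which is proportional to the width; a suitable choice of \<open>lm\<close> absorbs it.\<close>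
lemma modulus_lower_bound:
  assumes contF: "continuous_on UNIV F" and expF: "\<And>w. exp (F w) = f (exp w)" and F0: "F 0 = 0"
    and T: "0 \<le> T" and \<theta>: "\<bar>\<theta>\<bar> \<le> pi"
    and p: "p > 0" and E: "(\<integral>\<^sup>+z\<in>cball 0 (exp 1). ennreal (exp (p * K z)) \<partial>lborel) \<le> ennreal E" "0 \<le> E"
  shows "- Re (F (Complex (- T) \<theta>)) \<le> 144 * 1572864\<^sup>2 * ((E + 72 * (T + 3) * (T + 5)) / p) + 3"
proof -
  define w where "w = Complex (- T) \<theta>"
  define Q where "Q = (E + 72 * (T + 3) * (T + 5)) / p"
  have Q: "Q \<ge> 0" using E(2) T p by (simp add: Q_def)
  define C :: real where "C = 1572864"
  have C: "C > 0" by (simp add: C_def)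
  show ?thesis
  proof (cases "Re (F w) \<ge> 0")
    case True
    have "0 \<le> 144 * C\<^sup>2 * Q" using Q by simp
    then show ?thesis using True unfolding w_def Q_def C_def by linarith
  next
    case False
    define \<alpha> where "\<alpha> = Re (F w)"
    \<comment> \<open>Clamping to the band between Re(F w) and 0. Both endpoints of the path keep
      their values, so the oscillation of the truncated function is the full width of the
      band.\<close>
    define \<kappa> where "\<kappa> = (\<lambda>x. max \<alpha> (min 0 x))"
    \<comment> \<open>The weight 72 C makes the coefficient of the width C * 36 / (72 C) = 1/2, so
      half of the left-hand side can be moved over; the price is the factor C^2 in front of
      Q.\<close>
    have "\<bar>\<kappa> (Re (1 * F (Complex (- T) \<theta>))) - \<kappa> (Re (1 * F 0))\<bar>
      \<le> 1572864 * ((72 * C) * ((E + 72 * (T + 3) * (T + 5)) / p) + 36 * (0 - \<alpha> + 3) / (72 * C))"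
    proof (rule oscillation_bound[OF contF expF _ _ _ _ T \<theta> _ _ p E])
      show "mono \<kappa>" by (auto simp: mono_def \<kappa>_def)
      show "\<bar>\<kappa> x - \<kappa> y\<bar> \<le> \<bar>x - y\<bar>" for x y by (auto simp: \<kappa>_def)
      show "\<alpha> \<le> 0" using False by (simp add: \<alpha>_def)
      fix w'
      show "locally_const_off F (\<lambda>\<zeta>. \<kappa> (Re (1 * \<zeta>))) \<alpha> 0 w'"
        unfolding locally_const_off_def
      proof
        assume n: "\<not> (\<alpha> \<le> Re (F w') \<and> Re (F w') \<le> 0)"
        define e where "e = (if Re (F w') < \<alpha> then \<alpha> - Re (F w') else Re (F w'))"
        have e: "e > 0" using n by (auto simp: e_def)
        obtain d where d: "d > 0" "\<And>u. norm (u - w') < d \<Longrightarrow> norm (F u - F w') < e"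
          using contF e unfolding continuous_on_iff by (metis UNIV_I dist_norm)
        have "\<kappa> (Re (1 * F u)) = \<kappa> (Re (1 * F w'))" if "norm (u - w') < d" for u
        proof -
          have "\<bar>Re (F u) - Re (F w')\<bar> < e" using d(2)[OF that] abs_Re_le_cmod[of "F u - F w'"] by simp
          then show ?thesis using n False by (auto simp: \<kappa>_def e_def \<alpha>_def split: if_splits)
        qed
        then show "\<exists>d>0. \<forall>u. norm (u - w') < d \<longrightarrow> \<kappa> (Re (1 * F u)) = \<kappa> (Re (1 * F w'))" using d(1) by blast
      qed
    qed (use C in auto)
    moreover have "\<kappa> (Re (F w)) = \<alpha>" "\<kappa> (Re (F 0)) = 0" using False F0 by (auto simp: \<kappa>_def \<alpha>_def)
    ultimately have "\<bar>\<alpha>\<bar> \<le> C * ((72 * C) * Q + 36 * (3 - \<alpha>) / (72 * C))"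
      by (simp add: w_def[symmetric] C_def Q_def)
    also have "\<dots> = 72 * (C\<^sup>2 * Q) + (3 - \<alpha>) / 2" using C by (simp add: field_simps power2_eq_square)
    finally have "\<bar>\<alpha>\<bar> \<le> 72 * (C\<^sup>2 * Q) + (3 - \<alpha>) / 2" .
    then have "- \<alpha> \<le> 144 * X + 3" if "C\<^sup>2 * Q = X" for X unfolding that by argo
    then have "- \<alpha> \<le> 144 * (C\<^sup>2 * Q) + 3" by blast
    then have "- \<alpha> \<le> 144 * C\<^sup>2 * Q + 3" by simp
    then show ?thesis unfolding \<alpha>_def w_def Q_def C_def .
  qed
qed

text \<open>By the lower bound for the modulus, the image of the annulus lies in a band on which no truncation
  is needed.\<close>
lemma argument_bound:
  assumes contF: "continuous_on UNIV F" and expF: "\<And>w. exp (F w) = f (exp w)" and F0: "F 0 = 0"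
    and p: "p > 0" and E: "(\<integral>\<^sup>+z\<in>cball 0 (exp 1). ennreal (exp (p * K z)) \<partial>lborel) \<le> ennreal E" "0 \<le> E"
    and C: "C = 1572864"
  obtains B where "\<And>T \<theta>. 0 \<le> T \<Longrightarrow> \<bar>\<theta>\<bar> \<le> pi \<Longrightarrow>
    \<bar>Im (F (Complex (- T) \<theta>))\<bar> \<le> C * (1 + 5184 * C\<^sup>2) * ((E + 72 * (T + 6) * (T + 8)) / p) + B"
proof -
  have f0: "f (exp w) \<noteq> 0" for w using expF[of w] by (metis exp_not_eq_zero)
  have ReF: "exp (Re (F w)) = norm (f (exp w))" for w using expF[of w] by (metis norm_exp_eq_Re)
  have fn: "f z \<noteq> 0" if "z \<noteq> 0" for z using f0[of "Ln z"] that by simp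
  have "compact (f ` cball 0 (exp 1))" by (intro compact_continuous_image continuous_on_subset[OF cont]) auto
  then obtain M where M: "\<And>z. norm z \<le> exp 1 \<Longrightarrow> norm (f z) \<le> M" "M > 0"
    using compact_imp_bounded bounded_pos by (metis (no_types, lifting) image_eqI mem_cball_0)
  have cA: "compact (annulus 0 1)"
  proof -
    have "annulus 0 1 = cball 0 (exp 1) - ball 0 1" by (auto simp: annulus_def)
    then show ?thesis by (simp add: compact_diff)
  qed
  have "1 \<in> annulus 0 1" by (simp add: annulus_def)
  then obtain y where y: "y \<in> annulus 0 1" "\<And>z. z \<in> annulus 0 1 \<Longrightarrow> norm (f y) \<le> norm (f z)"
    using continuous_attains_inf[OF cA, of "\<lambda>z. norm (f z)"] continuous_on_subset[OF cont]
    by (metis continuous_on_norm empty_iff top_greatest)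
  have "y \<noteq> 0" using y(1) by (auto simp: annulus_def)
  then have fy: "norm (f y) > 0" using fn by simp
  \<comment> \<open>The annuli reach out to |z| = e, whereas the modulus lemma covers only |z| \<le>
    1. Compactness supplies an upper bound for |f| on the closed disc of radius e and a positive
    lower bound for 1 \<le> |z| \<le> e. These depend on f but not on T, and end up in
    \<open>B\<close>.\<close>
  define b where "b = max (ln M) (- ln (norm (f y)))"
  have up: "Re (F w) \<le> b" if "Re w \<le> 1" for w
  proof -
    have "exp (Re (F w)) \<le> M" unfolding ReF by (rule M(1)) (use that in simp)
    then have "Re (F w) \<le> ln M" using M(2) by (simp add: ln_ge_iff)
    then show ?thesis by (simp add: b_def)
  qed
  have low: "- b \<le> Re (F w)" if "0 \<le> Re w" "Re w \<le> 1" for w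
  proof -
    have "norm (f y) \<le> exp (Re (F w))" unfolding ReF by (rule y(2)) (use that in \<open>simp add: annulus_def\<close>)
    then have "ln (norm (f y)) \<le> Re (F w)" using fy by (metis exp_gt_zero ln_exp ln_le_cancel_iff)
    then show ?thesis by (auto simp: b_def)
  qed
  have b0: "0 \<le> b" using up[of 0] F0 by simp
  have Cpos: "C > 0" using C by simp
  show ?thesis
  proof (rule that[of "C * (36 * (2 * b + 6))"])
    fix T \<theta> :: real assume T: "0 \<le> T" and \<theta>: "\<bar>\<theta>\<bar> \<le> pi"
    \<comment> \<open>The modulus lemma is needed at depths up to T + 3, which shifts its T + 3 and
      T + 5 to T + 6 and T + 8.\<close>
    define Q where "Q = (E + 72 * (T + 6) * (T + 8)) / p"
    define Q0 where "Q0 = (E + 72 * (T + 3) * (T + 5)) / p"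
    have Q: "Q \<ge> 0" using E(2) T p by (simp add: Q_def)
    have QQ: "Q0 \<le> Q" unfolding Q_def Q0_def using T p by (intro divide_right_mono add_left_mono mult_mono) auto
    define \<alpha> where "\<alpha> = - (144 * C\<^sup>2 * Q + 3 + b)"
    have low': "\<alpha> \<le> Re (F w)" if w: "- T - 3 \<le> Re w" "Re w \<le> 1" for w
    proof (cases "Re w \<ge> 0")
      case True
      have "0 \<le> 144 * C\<^sup>2 * Q" using Q by simp
      then show ?thesis using low[OF True w(2)] unfolding \<alpha>_def by linarith
    next
      case False
      define t where "t = - Re w"
      have t: "0 \<le> t" "t \<le> T + 3" using False w by (auto simp: t_def)
      \<comment> \<open>Re(F w) depends only on exp w, so Im w may be replaced by the argument of
        exp w in the range from -\<pi> to \<pi>, as the modulus lemma demands.\<close>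
      define u where "u = Complex (- t) (Arg (exp w))"
      have "exp u = exp w"
      proof -
        have "exp u = rcis (norm (exp w)) (Arg (exp w))"
          by (simp add: u_def t_def exp_eq_polar rcis_def norm_mult)
        then show ?thesis by (simp only: rcis_cmod_Arg)
      qed
      then have "exp (Re (F u)) = exp (Re (F w))" unfolding ReF by simp
      then have eq: "Re (F u) = Re (F w)" by simp
      have "- Re (F u) \<le> 144 * C\<^sup>2 * ((E + 72 * (t + 3) * (t + 5)) / p) + 3"
        unfolding u_def C
        by (rule modulus_lower_bound[OF contF expF F0 t(1) _ p E]) (use mpi_less_Arg[of "exp w"] Arg_le_pi[of "exp w"] in auto)
      moreover have "(E + 72 * (t + 3) * (t + 5)) / p \<le> Q"
        unfolding Q_def using t p by (intro divide_right_mono add_left_mono mult_mono) auto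
      then have "144 * C\<^sup>2 * ((E + 72 * (t + 3) * (t + 5)) / p) \<le> 144 * C\<^sup>2 * Q" by (rule mult_left_mono) simp
      ultimately show ?thesis using b0 eq by (simp add: \<alpha>_def)
    qed
    \<comment> \<open>Re(-\<i> \<zeta>) = Im \<zeta>, so this is the argument. The band contains
      every value of Re F on the region, so \<kappa> is the identity. Both terms have order Q
      already, so weight 1 suffices, and 5184 = 36 * 144.\<close>
    have "\<bar>id (Re (- \<i> * F (Complex (- T) \<theta>))) - id (Re (- \<i> * F 0))\<bar>
      \<le> 1572864 * (1 * ((E + 72 * (T + 3) * (T + 5)) / p) + 36 * (b - \<alpha> + 3) / 1)"
    proof (rule oscillation_bound[OF contF expF _ _ _ _ T \<theta> _ _ p E])
      show "mono (id :: real \<Rightarrow> real)" by (simp add: mono_def)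
      show "\<alpha> \<le> b" using low'[of 0] up[of 0] T by simp
      fix w' assume "- T - 3 \<le> Re w'" "Re w' \<le> 1"
      then show "locally_const_off F (\<lambda>\<zeta>. id (Re (- \<i> * \<zeta>))) \<alpha> b w'"
        using low' up unfolding locally_const_off_def by blast
    qed auto
    then have "\<bar>Im (F (Complex (- T) \<theta>))\<bar> \<le> C * (Q0 + 36 * (b - \<alpha> + 3))"
      by (simp add: F0 C Q0_def)
    also have "\<dots> \<le> C * (Q + 36 * (b - \<alpha> + 3))" using QQ Cpos by (intro mult_left_mono add_right_mono) auto
    also have "\<dots> = C * (1 + 5184 * C\<^sup>2) * Q + C * (36 * (2 * b + 6))" by (simp add: \<alpha>_def algebra_simps)
    finally show "\<bar>Im (F (Complex (- T) \<theta>))\<bar> \<le> C * (1 + 5184 * C\<^sup>2) * ((E + 72 * (T + 6) * (T + 8)) / p) + C * (36 * (2 * b + 6))"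
      by (simp add: Q_def)
  qed
qed

end

text \<open>K is finite almost everywhere, so \<open>real_of_ereal\<close> alters it only on a null
  set. Each column norm is the length of the image of a unit vector and hence at most the operator
  norm. The disc of radius e is the one that contains all annuli used.\<close>

lemma finite_distortion_data_exists:
  assumes fd: "finite_distortion UNIV f" and K: "distortion_bound UNIV f K"
    and int: "locally_integrable UNIV (\<lambda>z. exp (p * real_of_ereal (K z)))"
  obtains g1 g2 K' E where "finite_distortion_data f g1 g2 K'"
    "(\<integral>\<^sup>+z\<in>cball 0 (exp 1). ennreal (exp (p * K' z)) \<partial>lborel) \<le> ennreal E" "0 \<le> E"
proof -
  obtain g where "homeomorphism UNIV (f ` UNIV) f g"
    using fd by (auto simp: finite_distortion_def sense_preserving_homeomorphism_def)
  then have cont: "continuous_on UNIV f" and inj: "inj f"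
    by (auto simp: homeomorphism_def intro: inj_on_inverseI)
  define G1 G2 where "G1 = weak_deriv UNIV f 1" "G2 = weak_deriv UNIV f \<i>"
  have ex: "\<exists>g. has_weak_deriv UNIV f 1 g" "\<exists>g. has_weak_deriv UNIV f \<i> g"
    using fd by (auto simp: finite_distortion_def W11_loc_def)
  have w1: "has_weak_deriv UNIV f 1 G1" unfolding G1_G2_def weak_deriv_def by (rule someI_ex[OF ex(1)])
  have w2: "has_weak_deriv UNIV f \<i> G2" unfolding G1_G2_def weak_deriv_def by (rule someI_ex[OF ex(2)])
  obtain g1 where g1: "weak_x f g1" "AE z in lborel. G1 z = g1 z" by (rule weak_x_of_weak_deriv[OF cont w1])
  obtain g2 where g2: "weak_x (\<lambda>z. f (flip z)) (\<lambda>z. g2 (flip z))" "g2 \<in> borel_measurable borel"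
    "AE z in lborel. G2 z = g2 z" "\<And>a b. set_integrable lborel (cbox a b) g2"
    by (rule weak_y_of_weak_deriv[OF cont w2]) blast
  have Km: "K \<in> borel_measurable lebesgue" and K1: "\<And>z. 1 \<le> K z"
    and Kfin: "AE z in lebesgue. K z < \<infinity>"
    and Kd: "AE z in lebesgue. ereal ((onorm (Df UNIV f z))\<^sup>2) \<le> ereal (Jac UNIV f z) * K z"
    using K unfolding distortion_bound_def lebesgue_on_UNIV_eq by auto
  have "(\<lambda>z. real_of_ereal (K z)) \<in> borel_measurable lebesgue" using Km by measurable
  then obtain K' where K': "K' \<in> borel_measurable lborel" "AE z in lborel. real_of_ereal (K z) = K' z"
    using completion_ex_borel_measurable_real by blast
  have K'm: "K' \<in> borel_measurable borel" using K'(1) by simp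
  have "AE z in lborel. K z < \<infinity>" "AE z in lborel. ereal ((onorm (Df UNIV f z))\<^sup>2) \<le> ereal (Jac UNIV f z) * K z"
    using Kfin Kd by (auto simp: AE_completion_iff)
  then have dist: "AE z in lborel. 0 \<le> K' z \<and>
       (norm (g1 z) + norm (g2 z))\<^sup>2 \<le> 4 * (Re (g1 z) * Im (g2 z) - Re (g2 z) * Im (g1 z)) * K' z"
    using K'(2) g1(2) g2(3)
  proof eventually_elim
    case (elim z)
    obtain k where k: "K z = ereal k" "1 \<le> k" using elim(1) K1[of z] by (cases "K z") auto
    have Df: "Df UNIV f z = (\<lambda>v. Re v *\<^sub>R g1 z + Im v *\<^sub>R g2 z)"
      using elim by (simp add: Df_def G1_G2_def)
    have bl: "bounded_linear (Df UNIV f z)" unfolding Df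
      by (intro bounded_linear_add bounded_linear_scaleR_left[THEN bounded_linear_compose] bounded_linear_Re bounded_linear_Im)
    have "norm (g1 z) \<le> onorm (Df UNIV f z)" using onorm[OF bl, of 1] by (simp add: Df)
    moreover have "norm (g2 z) \<le> onorm (Df UNIV f z)" using onorm[OF bl, of \<i>] by (simp add: Df)
    ultimately have "(norm (g1 z) + norm (g2 z))\<^sup>2 \<le> (2 * onorm (Df UNIV f z))\<^sup>2" by (intro power_mono) auto
    also have "\<dots> = 4 * (onorm (Df UNIV f z))\<^sup>2" by (simp add: power_mult_distrib)
    also have "\<dots> \<le> 4 * (Jac UNIV f z * k)" using elim(2) k by simp
    also have "Jac UNIV f z = Re (g1 z) * Im (g2 z) - Re (g2 z) * Im (g1 z)" by (simp add: Jac_def Df)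
    finally show ?case using k elim(3) by (simp add: algebra_simps)
  qed
  have data: "finite_distortion_data f g1 g2 K'"
    by unfold_locales (use cont inj g1 g2 K'm dist in auto)
  have "set_integrable lebesgue (cball 0 (exp 1)) (\<lambda>z. exp (p * real_of_ereal (K z)))"
    using int by (auto simp: locally_integrable_def)
  then have "(\<integral>\<^sup>+z. ennreal (norm (indicator (cball 0 (exp 1)) z *\<^sub>R exp (p * real_of_ereal (K z)))) \<partial>lebesgue) < \<infinity>"
    unfolding set_integrable_def by (simp add: integrable_iff_bounded)
  also have "(\<integral>\<^sup>+z. ennreal (norm (indicator (cball 0 (exp 1)) z *\<^sub>R exp (p * real_of_ereal (K z)))) \<partial>lebesgue)
     = (\<integral>\<^sup>+z. ennreal (exp (p * K' z)) * indicator (cball 0 (exp 1)) z \<partial>lebesgue)"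
    by (rule nn_integral_cong_AE, use AE_completion[OF K'(2)] in eventually_elim) (auto simp: indicator_def)
  also have "\<dots> = (\<integral>\<^sup>+z\<in>cball 0 (exp 1). ennreal (exp (p * K' z)) \<partial>lborel)"
  proof -
    note [measurable] = K'm
    have [measurable]: "cball 0 (exp 1) \<in> sets (borel :: complex measure)" by simp
    show ?thesis by (rule nn_integral_completion) measurable
  qed
  finally have "(\<integral>\<^sup>+z\<in>cball 0 (exp 1). ennreal (exp (p * K' z)) \<partial>lborel) \<le>
      ennreal (enn2real (\<integral>\<^sup>+z\<in>cball 0 (exp 1). ennreal (exp (p * K' z)) \<partial>lborel))" by simp
  then show ?thesis using that[OF data] by simp
qed

text \<open>\<open>polar_arg\<close> is a choice, so it must be shown that the lift satisfies the
  defining conditions and that they determine the function. Two solutions differ by 2 \<pi> times a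
  continuous integer valued function on a connected set, which vanishes at (1,0).\<close>

lemma polar_arg_eq:
  assumes contF: "continuous_on UNIV F" and expF: "\<And>w. exp (F w) = f (exp w)" and F0: "F 0 = 0" and r: "r > 0"
  shows "polar_arg f (r, \<theta>) = Im (F (Complex (ln r) \<theta>))"
proof -
  define S where "S = {0::real<..} \<times> (UNIV :: real set)"
  define P where "P = (\<lambda>A. continuous_on ({0<..} \<times> UNIV) A \<and>
     (\<forall>r>0. \<forall>\<theta>. f (rcis r \<theta>) = rcis (cmod (f (rcis r \<theta>))) (A (r, \<theta>))) \<and> A (1, 0) = 0)"
  define A0 where "A0 = (\<lambda>q. Im (F (Complex (ln (fst q)) (snd q))))"
  have e: "exp (Complex (ln r) \<theta>) = rcis r \<theta>" if "r > 0" for r \<theta>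
    using that by (simp add: exp_eq_polar rcis_def)
  have c0: "continuous_on S A0"
    unfolding A0_def S_def Complex_eq
    by (intro continuous_intros continuous_on_compose2[OF contF]) auto
  have "P A0"
    unfolding P_def
  proof (intro conjI allI impI)
    show "continuous_on ({0<..} \<times> UNIV) A0" using c0 by (simp add: S_def)
    show "A0 (1, 0) = 0" using F0 by (simp add: A0_def Complex_eq)
    fix r \<theta> :: real assume r: "r > 0"
    have "f (rcis r \<theta>) = exp (F (Complex (ln r) \<theta>))" using expF[of "Complex (ln r) \<theta>"] e[OF r] by simp
    then show "f (rcis r \<theta>) = rcis (cmod (f (rcis r \<theta>))) (A0 (r, \<theta>))"
      by (simp add: A0_def exp_eq_polar[of "F _"] rcis_def norm_mult)
  qed
  then have PA: "P (polar_arg f)"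
    using someI[of P A0] unfolding polar_arg_def P_def by simp
  define D where "D = (\<lambda>q. (polar_arg f q - A0 q) / (2 * pi))"
  have cD: "continuous_on S D" unfolding D_def
    using PA c0 by (intro continuous_intros) (auto simp: P_def S_def)
  have int: "D q \<in> \<int>" if "q \<in> S" for q
  proof -
    obtain r \<theta> where q: "q = (r, \<theta>)" "r > 0" using \<open>q \<in> S\<close> by (cases q) (auto simp: S_def)
    define \<rho> where "\<rho> = cmod (f (rcis r \<theta>))"
    have \<rho>: "\<rho> \<noteq> 0" using expF[of "Complex (ln r) \<theta>"] e[OF q(2)] unfolding \<rho>_def by (metis exp_not_eq_zero norm_eq_zero)
    have "rcis \<rho> (polar_arg f q) = rcis \<rho> (A0 q)"
      using PA \<open>P A0\<close> q unfolding P_def \<rho>_def by metis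
    then have "cis (polar_arg f q) = cis (A0 q)" using \<rho> by (simp add: rcis_def)
    then have "cis (polar_arg f q - A0 q) = 1" by (simp add: cis_divide[symmetric])
    then have "cos (polar_arg f q - A0 q) = 1" by (metis cis.simps(1) one_complex.simps(1))
    then obtain n where "polar_arg f q - A0 q = real_of_int n * 2 * pi" using cos_one_2pi_int by auto
    then show ?thesis by (simp add: D_def)
  qed
  have "D constant_on S"
  proof (rule continuous_discrete_range_constant[OF _ cD])
    show "connected S" unfolding S_def by (intro connected_Times) auto
    fix x assume x: "x \<in> S"
    have "1 \<le> norm (D y - D x)" if "y \<in> S" "D y \<noteq> D x" for y
      using int[OF x] int[OF that(1)] that(2) by (metis Ints_diff Ints_nonzero_abs_ge1 eq_iff_diff_eq_0 real_norm_def)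
    then show "\<exists>e>0. \<forall>y. y \<in> S \<and> D y \<noteq> D x \<longrightarrow> e \<le> norm (D y - D x)" by (intro exI[of _ 1]) auto
  qed
  moreover have "(1, 0) \<in> S" "(r, \<theta>) \<in> S" using r by (auto simp: S_def)
  moreover have "D (1, 0) = 0" using PA \<open>P A0\<close> by (simp add: D_def P_def)
  ultimately have "D (r, \<theta>) = 0" unfolding constant_on_def by metis
  then show ?thesis by (simp add: D_def A0_def)
qed

theorem theorem1p1:
  shows "\<exists>c::real. c > 0 \<and>
    (\<forall>(p::real) (f :: complex \<Rightarrow> complex) (K :: complex \<Rightarrow> ereal).
       p > 0 \<longrightarrow>
       finite_distortion UNIV f \<longrightarrow>
       is_distortion_function UNIV f K \<longrightarrow>
       locally_integrable UNIV (\<lambda>z. exp (p * real_of_ereal (K z))) \<longrightarrow>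
       f 0 = 0 \<longrightarrow> f 1 = 1 \<longrightarrow>
       (\<exists>\<epsilon>>0. \<forall>z. 0 < cmod z \<and> cmod z < \<epsilon> \<longrightarrow>
          \<bar>principal_arg f z\<bar> \<le> c / p * (ln (1 / cmod z))\<^sup>2))"
proof -
  define C :: real where "C = 1572864"
  define C2 where "C2 = C * (1 + 5184 * C\<^sup>2)"
  have C2: "C2 > 0" by (simp add: C2_def C_def)
  show ?thesis
  proof (rule exI[of _ "4536 * C2 + 1"], intro conjI allI impI)
    show "4536 * C2 + 1 > 0" using C2 by simp
    fix p :: real and f and K :: "complex \<Rightarrow> ereal"
    assume p: "p > 0" and fd: "finite_distortion UNIV f" and K: "is_distortion_function UNIV f K"
      and int: "locally_integrable UNIV (\<lambda>z. exp (p * real_of_ereal (K z)))" and f0: "f 0 = 0" and f1: "f 1 = 1"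
    have "distortion_bound UNIV f K" using K by (simp add: is_distortion_function_def)
    then obtain g1 g2 K' E where data: "finite_distortion_data f g1 g2 K'"
      and E: "(\<integral>\<^sup>+z\<in>cball 0 (exp 1). ennreal (exp (p * K' z)) \<partial>lborel) \<le> ennreal E" "0 \<le> E"
      by (rule finite_distortion_data_exists[OF fd _ int])
    interpret finite_distortion_data f g1 g2 K' by (rule data)
    have "f (exp w) \<noteq> 0" for w using inj f0 by (metis exp_not_eq_zero inj_eq)
    moreover have "continuous_on UNIV (\<lambda>w. f (exp w))"
      by (rule continuous_on_compose2[OF cont]) (auto intro!: continuous_intros)
    \<comment> \<open>The map f(exp w) has no zeros and the plane is contractible, so it has a
      continuous logarithm. Subtracting \<open>G 0\<close> normalises it and stays a logarithm
      because exp(G 0) = f 1 = 1.\<close>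
    ultimately obtain G where G: "continuous_on UNIV G" "\<And>w. f (exp w) = exp (G w)"
      using continuous_logarithm_on_contractible[of UNIV "\<lambda>w. f (exp w)"] convex_imp_contractible[of UNIV] by auto
    define F where "F = (\<lambda>w. G w - G 0)"
    have contF: "continuous_on UNIV F" unfolding F_def by (intro continuous_intros G)
    have expF: "exp (F w) = f (exp w)" for w using G(2)[of w] G(2)[of 0] f1 by (simp add: F_def exp_diff)
    have F0: "F 0 = 0" by (simp add: F_def)
    obtain B where B: "\<And>T \<theta>. 0 \<le> T \<Longrightarrow> \<bar>\<theta>\<bar> \<le> pi \<Longrightarrow>
      \<bar>Im (F (Complex (- T) \<theta>))\<bar> \<le> C2 * ((E + 72 * (T + 6) * (T + 8)) / p) + B"
      using argument_bound[OF contF expF F0 p E C_def] unfolding C2_def by blast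
    \<comment> \<open>The threshold behind the radius: once T exceeds it, the terms depending on f,
      namely C2 E + B p, are at most T and so at most T^2. This is the summand 1 in the final
      constant.\<close>
    define T0 where "T0 = max 1 (C2 * E + B * p)"
    show "\<exists>\<epsilon>>0. \<forall>z. 0 < cmod z \<and> cmod z < \<epsilon> \<longrightarrow> \<bar>principal_arg f z\<bar> \<le> (4536 * C2 + 1) / p * (ln (1 / cmod z))\<^sup>2"
    proof (intro exI[of _ "exp (- T0)"] conjI allI impI)
      fix z assume z: "0 < cmod z \<and> cmod z < exp (- T0)"
      define T where "T = ln (1 / cmod z)"
      have lnz: "ln (cmod z) = - T" using z by (simp add: T_def ln_div)
      have "ln (cmod z) < - T0" using z by (metis exp_gt_zero ln_exp ln_less_cancel_iff)
      then have T: "T > T0" using lnz by simp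
      then have T1: "T \<ge> 1" "T \<ge> C2 * E + B * p" by (auto simp: T0_def)
      have T2: "T \<le> T\<^sup>2" using T1 by (simp add: power2_eq_square)
      \<comment> \<open>For T \<ge> 1 the factors are at most 7 T and 9 T; 72 * 63 = 4536 is the
        coefficient of C2 in the final constant.\<close>
      have poly: "(T + 6) * (T + 8) \<le> 63 * T\<^sup>2"
      proof -
        have "(T + 6) * (T + 8) \<le> (7 * T) * (9 * T)" using T1 by (intro mult_mono) auto
        then show ?thesis by (simp add: power2_eq_square)
      qed
      have "principal_arg f z = Im (F (Complex (- T) (Arg z)))"
        unfolding principal_arg_def using polar_arg_eq[OF contF expF F0, of "cmod z" "Arg z"] z lnz by simp
      then have "\<bar>principal_arg f z\<bar> \<le> C2 * ((E + 72 * (T + 6) * (T + 8)) / p) + B"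
        using B[of T "Arg z"] T1 mpi_less_Arg[of z] Arg_le_pi[of z] by auto
      also have "\<dots> = (C2 * E + B * p + C2 * (72 * ((T + 6) * (T + 8)))) / p" using p by (simp add: field_simps)
      also have "\<dots> \<le> (T\<^sup>2 + C2 * (72 * (63 * T\<^sup>2))) / p"
        using p T1 T2 poly C2 by (intro divide_right_mono add_mono mult_left_mono) auto
      also have "\<dots> = (4536 * C2 + 1) / p * T\<^sup>2" by (simp add: algebra_simps add_divide_distrib)
      finally show "\<bar>principal_arg f z\<bar> \<le> (4536 * C2 + 1) / p * (ln (1 / cmod z))\<^sup>2" unfolding T_def .
    qed simp
  qed
qed

end
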